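(* No optimal 1-planar graph is 3-extendable.
   Context: All graphs are finite, simple and undirected. A graph is 1-planar if it can be drawn in the plane so that each edge is crossed by at most one other edge. A 1-planar graph $G$ is optimal if $|E(G)|=4|V(G)|-8$. A matching of $k$ edges is a $k$-matching. For an integer $n\ge 0$, a connected graph $G$ with at least $2n+2$ vertices is $n$-extendable if it has an $n$-matching and every $n$-matching of $G$ is contained in a perfect matching of $G$. *)

theory Defs
  imports "HOL-Analysis.Analysis"
begin

definition simple_graph :: "'a set \<Rightarrow> 'a set set \<Rightarrow> bool" where
  "simple_graph V E \<longleftrightarrow> finite V \<and> (\<forall>e\<in>E. e \<subseteq> V \<and> card e = 2)"

definition connected_graph :: "'a set \<Rightarrow> 'a set set \<Rightarrow> bool" where
  "connected_graph V E \<longleftrightarrow> V \<noteq> {} \<and> (\<forall>u\<in>V. \<forall>v\<in>V. (u, v) \<in> {(x, y). {x, y} \<in> E}\<^sup>*)"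

text \<open>
  The plane is the type of complex numbers.  Vertices are distinct points, edges are simple
  (Jordan) arcs joining the points of their two ends and passing through no other vertex, and two
  edges share only finitely many points.  No further restriction is made: two edges may cross
  several times, and adjacent edges may cross.
\<close>

definition drawing ::
  "'a set \<Rightarrow> 'a set set \<Rightarrow> ('a \<Rightarrow> complex) \<Rightarrow> ('a set \<Rightarrow> real \<Rightarrow> complex) \<Rightarrow> bool" where
  "drawing V E p \<gamma> \<longleftrightarrow>
     inj_on p V \<and>
     (\<forall>e\<in>E. arc (\<gamma> e) \<and> {pathstart (\<gamma> e), pathfinish (\<gamma> e)} = p ` e \<and>
             path_image (\<gamma> e) \<inter> p ` V = p ` e) \<and>
     (\<forall>e\<in>E. \<forall>f\<in>E. e \<noteq> f \<longrightarrow> finite (path_image (\<gamma> e) \<inter> path_image (\<gamma> f)))"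

text \<open>
  Every common point of two edges that is not a vertex counts as a crossing.  In drawings that
  forbid tangential contact these are exactly the crossing points; where contact occurs, counting
  it makes the condition below stricter.
\<close>

definition edges_cross ::
  "'a set \<Rightarrow> ('a \<Rightarrow> complex) \<Rightarrow> ('a set \<Rightarrow> real \<Rightarrow> complex) \<Rightarrow> 'a set \<Rightarrow> 'a set \<Rightarrow> bool" where
  "edges_cross V p \<gamma> e f \<longleftrightarrow>
     e \<noteq> f \<and> path_image (\<gamma> e) \<inter> path_image (\<gamma> f) - p ` V \<noteq> {}"

definition one_planar :: "'a set \<Rightarrow> 'a set set \<Rightarrow> bool" where
  "one_planar V E \<longleftrightarrow>
     (\<exists>p \<gamma>. drawing V E p \<gamma> \<and> (\<forall>e\<in>E. card {f \<in> E. edges_cross V p \<gamma> e f} \<le> 1))"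

text \<open>The count is over the integers, so that the subtraction is not truncated.\<close>

definition optimal_one_planar :: "'a set \<Rightarrow> 'a set set \<Rightarrow> bool" where
  "optimal_one_planar V E \<longleftrightarrow>
     one_planar V E \<and> int (card E) = 4 * int (card V) - 8"

definition matching :: "'a set set \<Rightarrow> 'a set set \<Rightarrow> bool" where
  "matching E M \<longleftrightarrow> M \<subseteq> E \<and> disjoint M"

definition k_matching :: "nat \<Rightarrow> 'a set set \<Rightarrow> 'a set set \<Rightarrow> bool" where
  "k_matching k E M \<longleftrightarrow> matching E M \<and> finite M \<and> card M = k"

definition perfect_matching :: "'a set \<Rightarrow> 'a set set \<Rightarrow> 'a set set \<Rightarrow> bool" where
  "perfect_matching V E M \<longleftrightarrow> matching E M \<and> \<Union>M = V"

definition extendable :: "nat \<Rightarrow> 'a set \<Rightarrow> 'a set set \<Rightarrow> bool" where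
  "extendable n V E \<longleftrightarrow>
     connected_graph V E \<and> card V \<ge> 2 * n + 2 \<and>
     (\<exists>M. k_matching n E M) \<and>
     (\<forall>M. k_matching n E M \<longrightarrow> (\<exists>P. perfect_matching V E P \<and> M \<subseteq> P))"

end

theory Submission
  imports Defs
begin

text \<open>The plane graph whose nodes are the vertices and the crossings has at most \<open>3 (n + c) - 6\<close> edges,
  and its bipartite subgraph between vertices and crossings at most \<open>2 (n + c) - 4\<close>, where \<open>n\<close> is
  the number of vertices and \<open>c\<close> that of crossings. With \<open>4 n - 8\<close> edges in the given graph both bounds
  are attained: \<open>c = n - 2\<close>, every face is a triangle with exactly one crossing among its corners, and the
  ends of two crossing edges span a 4-cycle of uncrossed edges. As \<open>4 c < 4 n\<close>, some vertex \<open>v\<close> has at most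
  three crossed edges. Each uncrossed edge at \<open>v\<close> lies in two of the corresponding 4-cycles, so the
  neighbours of \<open>v\<close> are covered by a matching of at most three edges, each joining the far end of a
  crossed edge at \<open>v\<close> to the end of an uncrossed one. No perfect matching contains it.

  For the number of faces, points \<open>x\<close> and \<open>y\<close> are in the same component of the complement of a compact set
  iff \<open>(z - x) / (z - y)\<close> has a continuous logarithm on it. This shows that an arc has at most two sides.\<close>

section \<open>Logarithms and separation of the plane\<close>

text \<open>The drawing is purely topological: two arcs may cross many times, and adjacent edges may
  cross. So crossings are not single points, and faces have no boundary walks to count along. A face
  only gets the set of edges that it touches. Three facts replace the walks: an edge touches at most
  two faces, at most two edges do not separate the plane, and a face stays a face when the edges
  that it does not touch are deleted. Of Euler's formula only the lower bound for the number of
  faces enters.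

  Here \<open>c\<close> counts the crossing pairs without a common end. The planarization has
  \<open>n + c\<close> nodes and \<open>4 n - 8 + 2 c\<close> edges, of which \<open>4 c\<close>
  join vertices to crossings. The first bound gives \<open>c \<ge> n - 2\<close>, the second
  \<open>c \<le> n - 2\<close>.

  At \<open>v\<close>, each crossing sees two far ends of uncrossed edges and each such end two
  crossings. Distinct representatives therefore exist, and they exhaust these ends because both
  sides have the same size.\<close>

text \<open>Each value of \<open>k\<close> is an integer multiple of \<open>2 * pi * \<i>\<close>,
  so distinct values are at least \<open>2 * pi\<close> apart and connectedness leaves only
  one.\<close>

lemma exp_one_constant:
  fixes k :: "'a::topological_space \<Rightarrow> complex"
  assumes "connected S" "continuous_on S k" and k: "\<And>z. z \<in> S \<Longrightarrow> exp (k z) = 1"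
  shows "k constant_on S"
proof (rule continuous_discrete_range_constant[OF assms(1,2)])
  fix x assume x: "x \<in> S"
  have "2 * pi \<le> norm (k y - k x)" if "y \<in> S" "k y \<noteq> k x" for y
  proof -
    have "exp (k y - k x) = 1" using k x that by (simp add: exp_diff)
    then obtain n :: int where n: "Re (k y - k x) = 0" "Im (k y - k x) = of_int (2 * n) * pi"
      by (auto simp: exp_eq_1)
    have "k y - k x = Complex 0 (of_int (2 * n) * pi)"
      using n by (simp add: complex_eq_iff)
    moreover have "n \<noteq> 0"
      using n that by (auto simp: complex_eq_iff)
    then have "1 \<le> \<bar>real_of_int n\<bar>" by linarith
    then have "2 * pi \<le> 2 * pi * \<bar>real_of_int n\<bar>" by simp
    ultimately show ?thesis by (simp add: norm_complex_def abs_mult)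
  qed
  then show "\<exists>e>0. \<forall>y. y \<in> S \<and> k y \<noteq> k x \<longrightarrow> e \<le> norm (k y - k x)"
    by (intro exI[of _ "2 * pi"]) auto
qed

text \<open>The winding number of \<open>(z - x) powi n\<close> along the circle is
  \<open>n\<close>. On the parametrization \<open>c\<close>, the function \<open>h\<close> can
  differ from the explicit logarithm \<open>n * (ln r + \<i> * t)\<close> only by a constant, and
  the latter has equal values at \<open>0\<close> and \<open>2 * pi\<close> only for
  \<open>n = 0\<close>.\<close>

lemma circle_no_log:
  fixes h :: "complex \<Rightarrow> complex"
  assumes r: "r > 0" and h: "continuous_on (sphere x r) h"
    and eq: "\<And>z. z \<in> sphere x r \<Longrightarrow> exp (h z) = (z - x) powi n"
  shows "n = 0"
proof -
  define c where "c = (\<lambda>t. x + exp ((of_real (ln r) + \<i> * of_real t)))"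
  have cs: "c t \<in> sphere x r" for t
    using r by (simp add: c_def dist_norm)
  define k where "k = (\<lambda>t. h (c t) - of_int n * (of_real (ln r) + \<i> * of_real t))"
  have ex: "exp (of_int n * w) = exp w powi n" for w :: complex
    by (cases "n \<ge> 0")
       (auto simp: power_int_def exp_of_nat_mult[symmetric] exp_minus[symmetric])
  have cont: "continuous_on {0..2*pi} k"
    unfolding k_def
  proof (intro continuous_intros)
    show "continuous_on {0..2 * pi} (\<lambda>t. h (c t))"
      by (rule continuous_on_compose2[OF h])
         (use cs in \<open>auto simp: c_def intro!: continuous_intros\<close>)
  qed
  have "k constant_on {0..2*pi}"
  proof (rule exp_one_constant[OF _ cont])
    fix t
    have "exp (k t) = (c t - x) powi n / exp ((of_real (ln r) + \<i> * of_real t)) powi n"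
      unfolding k_def by (simp add: exp_diff eq[OF cs] ex)
    then show "exp (k t) = 1" by (simp add: c_def)
  qed simp
  then have "k 0 = k (2 * pi)"
    by (force simp: constant_on_def)
  moreover have "c 0 = c (2 * pi)"
    using exp_two_pi_i by (simp add: c_def exp_add mult_ac)
  ultimately have "of_int n * (of_real (ln r) + \<i> * of_real 0) = of_int n * (of_real (ln r) + \<i> * of_real (2 * pi))"
    by (simp add: k_def)
  then show ?thesis by (auto simp: complex_eq_iff)
qed

text \<open>Extending \<open>exp L\<close> into \<open>C\<close> and dividing by \<open>q\<close> there gives a nowhere vanishing function
  on the whole plane that agrees with \<open>(z - x) powi n\<close> outside \<open>C\<close>.\<close>
lemma exponent_zero_bounded_component:
  fixes X :: "complex set"
  assumes X: "compact X" and C: "C \<in> components (-X)" "bounded C" "x \<in> C"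
    and L: "continuous_on X L" "\<And>z. z \<in> X \<Longrightarrow> exp (L z) = (z - x) powi n * q z"
    and q: "continuous_on (X \<union> C) q" "\<And>z. z \<in> X \<union> C \<Longrightarrow> q z \<noteq> 0"
  shows "n = 0"
proof -
  have oC: "open C"
    using C(1) X by (meson compact_imp_closed open_Compl open_components)
  have cC: "closure C \<subseteq> C \<union> X"
    using closure_Un_frontier[of C] frontier_of_components_closed_complement[of X C] C(1) X compact_imp_closed
    by blast
  obtain L' where L': "continuous_on UNIV L'" "\<And>z. z \<in> X \<Longrightarrow> L' z = L z"
    using Tietze_unbounded[of X L UNIV] L(1) X compact_imp_closed by auto
  define \<psi> where "\<psi> = (\<lambda>z. if z \<in> C then exp (L' z) / q z else (z - x) powi n)"
  have cont: "continuous_on (closure C \<union> - C) \<psi>"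
    unfolding \<psi>_def
  proof (rule continuous_on_cases)
    show "continuous_on (closure C) (\<lambda>z. exp (L' z) / q z)"
      by (intro continuous_intros continuous_on_subset[OF L'(1)] continuous_on_subset[OF q(1)])
         (use cC q in auto)
    show "continuous_on (- C) (\<lambda>z. (z - x) powi n)"
      by (intro continuous_intros) (use C in auto)
    show "\<forall>z. z \<in> closure C \<and> z \<notin> C \<or> z \<in> - C \<and> z \<in> C \<longrightarrow> exp (L' z) / q z = (z - x) powi n"
      using cC q L' L by auto
  qed (use oC in auto)
  have "closure C \<union> - C = UNIV" using closure_subset by blast
  then have "continuous_on UNIV \<psi>" using cont by simp
  moreover have "\<psi> z \<noteq> 0" for z
    using q C by (auto simp: \<psi>_def)
  \<comment> \<open>The plane is contractible, so \<open>\<psi>\<close> has a global logarithm; on a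
    circle around \<open>C\<close> it is a logarithm of \<open>(z - x) powi n\<close>.\<close>
  ultimately obtain g where g: "continuous_on UNIV g" "\<And>z. \<psi> z = exp (g z)"
    using continuous_logarithm_on_contractible[of UNIV \<psi>] by (metis contractible_UNIV UNIV_I)
  obtain r where r: "r > 0" "C \<subseteq> ball x r"
    using C(2) by (meson bounded_subset_ballD)
  show ?thesis
  proof (rule circle_no_log[OF r(1)])
    show "continuous_on (sphere x r) g"
      using g(1) continuous_on_subset by blast
    fix z assume "z \<in> sphere x r"
    then have "z \<notin> C" using r by auto
    then show "exp (g z) = (z - x) powi n"
      using g(2)[of z] by (simp add: \<psi>_def)
  qed
qed

text \<open>In the component of \<open>p\<close> the factors of the other points have neither zeros
  nor poles, so a bounded component forces the exponent of its point to vanish. At most one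
  component is unbounded; the exponent of its point is then zero because the exponents sum to
  zero.\<close>

lemma exponents_zero:
  fixes X :: "complex set" and n :: "complex \<Rightarrow> int"
  assumes X: "compact X" and P: "finite P" "P \<inter> X = {}"
    and sep: "\<And>p q. \<lbrakk>p \<in> P; q \<in> P; p \<noteq> q\<rbrakk> \<Longrightarrow> \<not> connected_component (-X) p q"
    and sum: "sum n P = 0"
    and L: "continuous_on X L" "\<And>z. z \<in> X \<Longrightarrow> exp (L z) = (\<Prod>p\<in>P. (z - p) powi n p)"
    and p: "p \<in> P"
  shows "n p = 0"
proof -
  define C where "C = connected_component_set (- X)"
  have C: "C p \<in> components (-X)" if "p \<in> P" for p
    using that P by (auto simp: C_def components_def)
  have bd: "n p = 0" if p: "p \<in> P" and b: "bounded (C p)" for p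
  proof (rule exponent_zero_bounded_component[OF X C[OF p] b _ L(1)])
    show "p \<in> C p" using P p by (auto simp: C_def)
    show "exp (L z) = (z - p) powi n p * (\<Prod>p\<in>P-{p}. (z - p) powi n p)" if "z \<in> X" for z
      using that p P by (simp add: L(2) prod.remove)
    have ne: "z - p' \<noteq> 0" if "z \<in> X \<union> C p" "p' \<in> P - {p}" for z p'
      using that P sep[of p p'] p by (auto simp: C_def)
    then show "continuous_on (X \<union> C p) (\<lambda>z. \<Prod>p\<in>P-{p}. (z - p) powi n p)"
      by (intro continuous_intros) auto
    show "(\<Prod>p'\<in>P-{p}. (z - p') powi n p') \<noteq> 0" if "z \<in> X \<union> C p" for z
      using ne[OF that] P by auto
  qed
  show ?thesis
  proof (cases "bounded (C p)")
    case False
    have "n p' = 0" if "p' \<in> P - {p}" for p'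
    proof (rule bd)
      show "bounded (C p')"
      proof (rule ccontr)
        assume "\<not> bounded (C p')"
        then have "C p' = C p"
          using cobounded_unique_unbounded_components[of "-X" "C p'" "C p"] C False that p X
          by (auto simp: compact_imp_bounded)
        moreover have "p' \<in> C p'" using that P by (auto simp: C_def)
        ultimately show False using sep[of p p'] p that by (auto simp: C_def)
      qed
    qed (use that in auto)
    then have "sum n P = n p" using P p by (simp add: sum.remove)
    then show ?thesis using sum by simp
  qed (use bd p in auto)
qed

text \<open>Borsuk's criterion: the unit vectors pointing from \<open>x\<close> and from
  \<open>y\<close> to \<open>z\<close> are homotopic circle maps on \<open>K\<close>. Their quotient
  is therefore inessential and has a continuous argument, to which the logarithm of the modulus is
  added.\<close>

lemma log_on_connected_component:
  fixes K :: "complex set"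
  assumes K: "compact K" and cc: "connected_component (- K) x y"
  obtains g where "continuous_on K g" "\<And>z. z \<in> K \<Longrightarrow> exp (g z) = (z - x) / (z - y)"
proof -
  have xy: "x \<notin> K" "y \<notin> K"
    using cc connected_component_in by fastforce+
  let ?u = "\<lambda>a z. (z - a) /\<^sub>R cmod (z - a)"
  have "homotopic_with_canon (\<lambda>z. True) K (sphere 0 1) (?u x) (?u y)"
    using Borsuk_maps_homotopic_in_connected_component_eq[OF K xy] cc by simp
  then have "\<exists>c. homotopic_with_canon (\<lambda>z. True) K (sphere 0 1) (\<lambda>z. ?u x z / ?u y z) (\<lambda>z. c)"
    by (subst (asm) homotopic_circlemaps_divide) (elim conjE)
  then obtain g where g: "continuous_on K g"
    and g_eq: "\<forall>z\<in>K. ?u x z / ?u y z = exp (\<i> * of_real (g z))"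
    unfolding inessential_eq_continuous_logarithm_circle by blast
  have ge: "exp (\<i> * of_real (g z)) = ?u x z / ?u y z" if "z \<in> K" for z
    using bspec[OF g_eq that] by (rule sym)
  show ?thesis
  proof
    show "continuous_on K (\<lambda>z. \<i> * of_real (g z) + of_real (ln (cmod (z - x) / cmod (z - y))))"
      by (intro continuous_intros g) (use xy in auto)
    fix z assume z: "z \<in> K"
    then have "z \<noteq> x" "z \<noteq> y" using xy by auto
    then show "exp (\<i> * of_real (g z) + of_real (ln (cmod (z - x) / cmod (z - y)))) = (z - x) / (z - y)"
      using ge[OF z] by (simp add: exp_add exp_of_real field_simps scaleR_conv_of_real)
  qed
qed

text \<open>The shift \<open>g a - h a\<close> is a multiple of \<open>2 * pi * \<i>\<close>. Adding
  it to \<open>h\<close> makes the two logarithms agree at \<open>a\<close> and, the mismatches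
  being equal, also at \<open>b\<close>.\<close>

lemma glue_logs:
  fixes g h :: "complex \<Rightarrow> complex"
  assumes K: "closed K" and A: "closed A" and int: "K \<inter> A = {a, b}"
    and g: "continuous_on K g" and h: "continuous_on A h"
    and e: "exp (g a) = exp (h a)" and eq: "g a - h a = g b - h b"
  obtains l where "continuous_on (K \<union> A) l"
    "\<And>z. z \<in> K \<Longrightarrow> exp (l z) = exp (g z)" "\<And>z. z \<in> A \<Longrightarrow> exp (l z) = exp (h z)"
proof
  define l where "l = (\<lambda>z. if z \<in> K then g z else h z + (g a - h a))"
  have agree: "g z = h z + (g a - h a)" if "z \<in> K" "z \<in> A" for z
  proof -
    have "z = a \<or> z = b" using that int by blast
    then show ?thesis using eq by (auto simp: algebra_simps)
  qed
  have c: "exp (g a - h a) = 1" using e by (simp add: exp_diff)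
  show "continuous_on (K \<union> A) l"
    unfolding l_def
    by (rule continuous_on_cases) (use K A g h agree in \<open>auto intro!: continuous_intros\<close>)
  show "exp (l z) = exp (g z)" if "z \<in> K" for z using that by (simp add: l_def)
  show "exp (l z) = exp (h z)" if "z \<in> A" for z
    using that agree[of z] c exp_add[of "h z" "g a - h a"] by (auto simp: l_def)
qed

text \<open>The mismatch \<open>n\<close> at the end of the arc of logarithms of \<open>(z - x) / (z - y)\<close> on \<open>K\<close> and on
  the arc is additive, so a suitable combination of two such functions has none.\<close>
lemma arc_at_most_two_components:
  fixes K :: "complex set"
  assumes K: "compact K" and A: "arc A" and int: "K \<inter> path_image A = {pathstart A, pathfinish A}"
    and xy: "connected_component (-K) x y" and xw: "connected_component (-K) x w"
    and nA: "x \<notin> path_image A" "y \<notin> path_image A" "w \<notin> path_image A"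
  shows "connected_component (- (K \<union> path_image A)) x y \<or>
         connected_component (- (K \<union> path_image A)) x w \<or>
         connected_component (- (K \<union> path_image A)) y w"
proof (rule ccontr)
  assume neg: "\<not> ?thesis"
  define X where "X = K \<union> path_image A"
  define a where "a = pathstart A"
  define b where "b = pathfinish A"
  have ab: "a \<in> K" "b \<in> K" "a \<in> path_image A" "b \<in> path_image A" using int by (auto simp: a_def b_def)
  have cA: "compact (path_image A)" using A by (simp add: compact_arc_image)
  then have X: "compact X" using K by (simp add: X_def compact_Un)
  have out: "x \<notin> X" "y \<notin> X" "w \<notin> X"
    using xy xw nA connected_component_in by (fastforce simp: X_def)+
  have dist: "x \<noteq> y" "x \<noteq> w" "y \<noteq> w" using neg out X_def
    by (metis ComplI connected_component_refl_eq)+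
  have ex: "exp (of_int n * w) = exp w powi n" for w :: complex and n
    by (cases "n \<ge> 0")
       (auto simp: power_int_def exp_of_nat_mult[symmetric] exp_minus[symmetric])
  have logs: "\<exists>g h n. continuous_on K g \<and> continuous_on (path_image A) h \<and>
       (\<forall>z\<in>K. exp (g z) = (z - x) / (z - y)) \<and> (\<forall>z\<in>path_image A. exp (h z) = (z - x) / (z - y)) \<and>
       (g b - h b) - (g a - h a) = of_int n * (2 * pi * \<i>)"
    if cc: "connected_component (-K) x y" and nX: "x \<notin> X" "y \<notin> X" for x y
  proof -
    obtain g where g: "continuous_on K g" "\<And>z. z \<in> K \<Longrightarrow> exp (g z) = (z - x) / (z - y)"
      using log_on_connected_component[OF K cc] by blast
    have c: "connected_component (- path_image A) x y"
      using connected_arc_complement[of A] A nX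
      by (metis Compl_iff DIM_complex UnCI X_def connected_iff_connected_component order_refl)
    obtain h where h: "continuous_on (path_image A) h"
        "\<And>z. z \<in> path_image A \<Longrightarrow> exp (h z) = (z - x) / (z - y)"
      using log_on_connected_component[OF cA c] by blast
    have "exp ((g b - h b) - (g a - h a)) = 1"
      using g h ab nX by (auto simp: exp_diff X_def)
    then obtain n :: int where "Re ((g b - h b) - (g a - h a)) = 0" 
        "Im ((g b - h b) - (g a - h a)) = of_int (2 * n) * pi"
      by (auto simp: exp_eq_1)
    then have "(g b - h b) - (g a - h a) = of_int n * (2 * pi * \<i>)"
      by (auto simp: complex_eq_iff)
    then show ?thesis using g h by blast
  qed
  obtain g1 h1 n1 where 1: "continuous_on K g1" "continuous_on (path_image A) h1"
       "\<And>z. z \<in> K \<Longrightarrow> exp (g1 z) = (z - x) / (z - y)" 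
       "\<And>z. z \<in> path_image A \<Longrightarrow> exp (h1 z) = (z - x) / (z - y)"
       "(g1 b - h1 b) - (g1 a - h1 a) = of_int n1 * (2 * pi * \<i>)"
    using logs[OF xy out(1,2)] by blast
  obtain g2 h2 n2 where 2: "continuous_on K g2" "continuous_on (path_image A) h2"
       "\<And>z. z \<in> K \<Longrightarrow> exp (g2 z) = (z - x) / (z - w)" 
       "\<And>z. z \<in> path_image A \<Longrightarrow> exp (h2 z) = (z - x) / (z - w)"
       "(g2 b - h2 b) - (g2 a - h2 a) = of_int n2 * (2 * pi * \<i>)"
    using logs[OF xw out(1,3)] by blast
  \<comment> \<open>When the mismatches cancel, the combined logarithms glue to one of
    \<open>R\<close> on all of \<open>X\<close>. As \<open>R\<close> is a product of powers of
    \<open>z - x\<close>, \<open>z - y\<close>, \<open>z - w\<close> with exponents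
    \<open>m1 + m2\<close>, \<open>- m1\<close>, \<open>- m2\<close> of sum zero, and the points lie
    in distinct components, all exponents vanish.\<close>
  have zero: "m1 = 0 \<and> m2 = 0" if m: "m1 * n1 + m2 * n2 = 0" for m1 m2 :: int
  proof -
    define g where "g = (\<lambda>z. of_int m1 * g1 z + of_int m2 * g2 z)"
    define h where "h = (\<lambda>z. of_int m1 * h1 z + of_int m2 * h2 z)"
    define R where "R = (\<lambda>z. ((z - x) / (z - y)) powi m1 * ((z - x) / (z - w)) powi m2)"
    have eg: "exp (g z) = R z" if "z \<in> K" for z
      using that 1(3) 2(3) by (simp add: g_def exp_add ex R_def)
    have eh: "exp (h z) = R z" if "z \<in> path_image A" for z
      using that 1(4) 2(4) by (simp add: h_def exp_add ex R_def)
    have "(g b - h b) - (g a - h a) = of_int m1 * ((g1 b - h1 b) - (g1 a - h1 a)) 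
         + of_int m2 * ((g2 b - h2 b) - (g2 a - h2 a))"
      by (simp add: g_def h_def algebra_simps)
    also have "\<dots> = of_int (m1 * n1 + m2 * n2) * (2 * pi * \<i>)"
      unfolding 1(5) 2(5) by (simp add: algebra_simps)
    finally have eq: "g a - h a = g b - h b" using m by simp
    obtain l where l: "continuous_on X l" "\<And>z. z \<in> X \<Longrightarrow> exp (l z) = R z"
    proof (rule glue_logs[of K "path_image A" a b g h])
      show "K \<inter> path_image A = {a, b}" using int by (simp add: a_def b_def)
      show "continuous_on K g" "continuous_on (path_image A) h"
        unfolding g_def h_def using 1 2 by (auto intro!: continuous_intros)
      show "exp (g a) = exp (h a)" using eg eh ab by simp
    qed (use K cA eq eg eh in \<open>auto simp: compact_imp_closed X_def\<close>)
    define n where "n = (\<lambda>p. if p = x then m1 + m2 else if p = y then - m1 else - m2)"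
    have *: "n p = 0" if "p \<in> {x, y, w}" for p
    proof (rule exponents_zero[OF X _ _ _ _ l(1) _ that])
      show "sum n {x, y, w} = 0" using dist by (simp add: n_def)
      show "{x, y, w} \<inter> X = {}" using out by blast
      show "\<not> connected_component (- X) p q" if "p \<in> {x, y, w}" "q \<in> {x, y, w}" "p \<noteq> q" for p q
        using that neg by (auto simp: X_def connected_component_sym_eq)
      show "exp (l z) = (\<Prod>p\<in>{x, y, w}. (z - p) powi n p)" if "z \<in> X" for z
      proof -
        have "z \<noteq> x" "z \<noteq> y" "z \<noteq> w" using that out by auto
        then show ?thesis using dist that
          by (simp add: l(2) R_def n_def power_int_add power_int_minus power_int_divide_distrib field_simps)
      qed
    qed simp
    show ?thesis using *[of y] *[of w] dist by (auto simp: n_def)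
  qed
  \<comment> \<open>The pair \<open>n2\<close>, \<open>- n1\<close> always satisfies the relation,
    hence both mismatches are zero. Then \<open>1\<close>, \<open>0\<close> satisfies it as well,
    which is absurd.\<close>
  have "n1 = 0" "n2 = 0" using zero[of n2 "- n1"] by auto
  then show False using zero[of 1 0] by simp
qed

section \<open>Attaching an arc to a compact set\<close>

lemma card_le_2_if_no_three:
  assumes "\<And>a b c. \<lbrakk>a \<in> S; b \<in> S; c \<in> S\<rbrakk> \<Longrightarrow> a = b \<or> a = c \<or> b = c"
  shows "finite S \<and> card S \<le> 2"
proof (cases "\<exists>a\<in>S. \<exists>b\<in>S. a \<noteq> b")
  case True
  then obtain a b where ab: "a \<in> S" "b \<in> S" "a \<noteq> b" by blast
  have "S \<subseteq> {a, b}" using assms ab by blast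
  then show ?thesis using card_mono[of "{a, b}" S] ab finite_subset[of S "{a, b}"] by simp
next
  case False
  then have "S = {} \<or> (\<exists>a. S = {a})" by blast
  then show ?thesis by auto
qed

lemma components_in_superset:
  assumes "C \<in> components X" "X \<subseteq> Y"
  shows "\<exists>D\<in>components Y. C \<subseteq> D"
proof -
  have "C \<subseteq> Y" "connected C" "C \<noteq> {}"
    using in_components_subset[OF assms(1)] in_components_connected[OF assms(1)] in_components_nonempty[OF assms(1)] assms(2)
    by auto
  then show ?thesis using exists_component_superset[of C Y] by blast
qed

lemma component_unique:
  assumes "C \<in> components X" "D \<in> components X" "x \<in> C" "x \<in> D"
  shows "C = D"
  using components_eq[OF assms(1,2)] assms(3,4) by blast

lemma connected_component_iff_component:
  assumes "C \<in> components X" "x \<in> C"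
  shows "connected_component X x y \<longleftrightarrow> y \<in> C"
proof -
  obtain p where p: "C = connected_component_set X p" using assms(1) by (rule componentsE)
  then have "connected_component_set X x = C" using assms(2) connected_component_eq by fastforce
  then show ?thesis by auto
qed

lemma arc_interior_connected:
  assumes "arc g"
  shows "connected (path_image g - {pathstart g, pathfinish g})"
    "path_image g - {pathstart g, pathfinish g} \<noteq> {}"
  using connected_simple_path_endless[OF arc_imp_simple_path[OF assms]]
    nonempty_simple_path_endless[OF arc_imp_simple_path[OF assms]] .

text \<open>One step in drawing a plane graph: \<open>K\<close> is what is drawn already and
  \<open>A\<close> the next edge. All counts of faces come from comparing the components of
  \<open>- K\<close> with those of \<open>- X\<close>.\<close>

locale arc_attached =
  fixes K :: "complex set" and A :: "real \<Rightarrow> complex"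
  assumes K: "compact K" and A: "arc A" and ends: "K \<inter> path_image A = {pathstart A, pathfinish A}"
begin

abbreviation "X \<equiv> K \<union> path_image A"

lemma compact_X: "compact X" and compact_A: "compact (path_image A)"
  using K A by (simp_all add: compact_arc_image compact_Un)

lemma open_complements: "open (- K)" "open (- X)"
  using K compact_X by (simp_all only: compact_imp_closed open_Compl)

lemma no_three_components:
  assumes W: "W \<in> components (- K)" and C: "C1 \<in> components (- X)" "C2 \<in> components (- X)" "C3 \<in> components (- X)"
    and sub: "C1 \<subseteq> W" "C2 \<subseteq> W" "C3 \<subseteq> W"
  shows "C1 = C2 \<or> C1 = C3 \<or> C2 = C3"
proof -
  have "C1 \<noteq> {}" "C2 \<noteq> {}" "C3 \<noteq> {}" using in_components_nonempty[OF C(1)]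
      in_components_nonempty[OF C(2)] in_components_nonempty[OF C(3)] by auto
  then obtain x y w where p: "x \<in> C1" "y \<in> C2" "w \<in> C3" by auto
  have n: "x \<notin> X" "y \<notin> X" "w \<notin> X" using p C in_components_subset by fastforce+
  have "connected_component (-K) x y" "connected_component (-K) x w"
    using connected_component_iff_component[OF W, of x] p sub by auto
  then have "connected_component (- X) x y \<or> connected_component (- X) x w \<or> connected_component (- X) y w"
    using arc_at_most_two_components[OF K A ends] n by blast
  then have "y \<in> C1 \<or> w \<in> C1 \<or> w \<in> C2"
    using connected_component_iff_component[OF C(1) p(1)] connected_component_iff_component[OF C(2) p(2)] by blast
  then show ?thesis
    using component_unique[OF C(1,2), of y] component_unique[OF C(1,3), of w] component_unique[OF C(2,3), of w] p by blast
qed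

text \<open>Every component of \<open>- X\<close> lies in one of \<open>- K\<close>, and each of
  these holds at most two.\<close>

lemma finite_components:
  assumes "finite (components (- K))"
  shows "finite (components (- X))"
proof -
  have "components (- X) \<subseteq> (\<Union>W\<in>components (- K). {C \<in> components (- X). C \<subseteq> W})"
    using components_in_superset[of _ "- X" "- K"] by fastforce
  moreover have "finite {C \<in> components (- X). C \<subseteq> W}" if "W \<in> components (- K)" for W
    using card_le_2_if_no_three[of "{C \<in> components (- X). C \<subseteq> W}"] no_three_components[OF that] by blast
  then have "finite (\<Union>W\<in>components (- K). {C \<in> components (- X). C \<subseteq> W})"
    using assms by (rule finite_UN_I[rotated])
  ultimately show ?thesis by (rule finite_subset)
qed

lemma card_components_le_2:
  assumes "connected (- K)"
  shows "card (components (- X)) \<le> 2"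
proof -
  have "- K \<noteq> {}" using K
    by (metis Compl_empty_eq compact_imp_bounded double_complement not_bounded_UNIV)
  then have W: "-K \<in> components (- K)" using assms by (simp add: in_components_self)
  show ?thesis
  proof (rule card_le_2_if_no_three[THEN conjunct2])
    fix C1 C2 C3 assume C: "C1 \<in> components (- X)" "C2 \<in> components (- X)" "C3 \<in> components (- X)"
    have "C1 \<subseteq> - K" "C2 \<subseteq> - K" "C3 \<subseteq> - K"
      using C[THEN in_components_subset] by auto
    then show "C1 = C2 \<or> C1 = C3 \<or> C2 = C3" using no_three_components[OF W C] by blast
  qed
qed

text \<open>The arc without its ends is connected and avoids \<open>K\<close>, so it lies in a
  single component \<open>U\<close> of \<open>- K\<close>. A face with such a point on its frontier
  meets the open set \<open>U\<close>, hence lies in it, and \<open>U\<close> splits into at most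
  two pieces.\<close>

lemma at_most_two_sides:
  defines "B \<equiv> {F \<in> components (- X). frontier F \<inter> (path_image A - {pathstart A, pathfinish A}) \<noteq> {}}"
  shows "card B \<le> 2"
proof -
  let ?A = "path_image A - {pathstart A, pathfinish A}"
  have "?A \<subseteq> - K" "connected ?A" "?A \<noteq> {}"
    using ends arc_interior_connected[OF A] by auto
  then obtain U where U: "U \<in> components (- K)" "?A \<subseteq> U"
    using exists_component_superset[of ?A "-K"] by blast
  have oU: "open U" using U open_complements(1) open_components by blast
  have "F \<subseteq> U" if F: "F \<in> B" for F
  proof -
    obtain z where "z \<in> frontier F" "z \<in> U" using F U by (auto simp: B_def)
    then obtain y where "y \<in> F" "y \<in> U"
      using open_Int_closure_eq_empty[OF oU, of F] by (auto simp: frontier_def)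
    moreover obtain D where "D \<in> components (- K)" "F \<subseteq> D"
      using components_in_superset[of F "- X" "- K"] F by (auto simp: B_def)
    ultimately show ?thesis using component_unique[OF U(1)] by blast
  qed
  then show ?thesis
    using card_le_2_if_no_three[of B] no_three_components[OF U(1)] by (auto simp: B_def)
qed

text \<open>Otherwise \<open>W\<close> would be the arc without its ends: an open set whose frontier
  has at most two points. The plane minus these points is connected, so \<open>W\<close> would be
  all of it, and the compact arc would fill the plane.\<close>

lemma component_not_subset_arc:
  assumes W: "W \<in> components (- K)"
  shows "\<not> W \<subseteq> path_image A"
proof
  let ?A = "path_image A - {pathstart A, pathfinish A}"
  assume sub: "W \<subseteq> path_image A"
  have WK: "W \<subseteq> - K" "W \<noteq> {}" using W in_components_subset in_components_nonempty by auto
  then have WA: "W \<subseteq> ?A" using sub ends by blast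
  have "?A \<subseteq> W"
    using components_maximal[OF W arc_interior_connected(1)[OF A]] ends WA WK by blast
  with WA have eq: "W = ?A" by blast
  have oW: "open W" using W open_complements(1) open_components by blast
  have "frontier W \<subseteq> {pathstart A, pathfinish A}"
  proof -
    have "closure W \<subseteq> path_image A" using sub compact_A compact_imp_closed closure_minimal by blast
    then show ?thesis using oW eq by (auto simp: frontier_def interior_open)
  qed
  moreover have "connected (- {pathstart A, pathfinish A})"
    using connected_open_diff_countable[of UNIV "{pathstart A, pathfinish A}"] by (simp add: Compl_eq_Diff_UNIV connected_UNIV)
  moreover have "- {pathstart A, pathfinish A} \<inter> W \<noteq> {}" using eq WK by blast
  moreover have "- {pathstart A, pathfinish A} - W \<noteq> {}"
  proof
    assume "- {pathstart A, pathfinish A} - W = {}"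
    then have "UNIV \<subseteq> W \<union> {pathstart A, pathfinish A}" by blast
    then have "UNIV = path_image A" using sub pathstart_in_path_image[of A] pathfinish_in_path_image[of A] by blast
    then show False using compact_A by (metis compact_imp_bounded not_bounded_UNIV)
  qed
  ultimately show False using connected_Int_frontier by blast
qed

lemma component_inside:
  assumes W: "W \<in> components (- K)"
  shows "\<exists>C\<in>components (- X). C \<subseteq> W"
proof -
  obtain x where x: "x \<in> W" "x \<notin> path_image A" using component_not_subset_arc[OF W] by blast
  then have "x \<in> - X" using W in_components_subset by fastforce
  then obtain C where C: "C \<in> components (- X)" "x \<in> C" using Union_components by (metis UnionE)
  then have "C \<subseteq> W"
    using components_in_superset[of C "- X" "- K"] component_unique[OF W _ x(1)] by blast
  then show ?thesis using C by blast
qed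

text \<open>A component of \<open>- X\<close> chosen inside a component of \<open>- K\<close>
  determines it, since the components of \<open>- K\<close> are disjoint.\<close>

lemma card_components_mono:
  assumes "finite (components (- K))"
  shows "card (components (- K)) \<le> card (components (- X))"
proof -
  define \<phi> where "\<phi> = (\<lambda>W. SOME C. C \<in> components (- X) \<and> C \<subseteq> W)"
  have \<phi>: "\<phi> W \<in> components (- X)" "\<phi> W \<subseteq> W" if "W \<in> components (- K)" for W
    using someI_ex[of "\<lambda>C. C \<in> components (- X) \<and> C \<subseteq> W"] component_inside[OF that] by (auto simp: \<phi>_def)
  have "inj_on \<phi> (components (- K))"
  proof (rule inj_onI)
    fix V V' assume V: "V \<in> components (- K)" "V' \<in> components (- K)" "\<phi> V = \<phi> V'"
    obtain x where "x \<in> \<phi> V" using in_components_nonempty[OF \<phi>(1)[OF V(1)]] by blast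
    then show "V = V'" using component_unique[OF V(1,2), of x] \<phi>(2)[OF V(1)] \<phi>(2)[OF V(2)] V(3) by auto
  qed
  then show ?thesis
    by (rule card_inj_on_le) (use \<phi> finite_components[OF assms] in auto)
qed

text \<open>With an arc in \<open>K\<close> the arc \<open>A\<close> closes up to a Jordan curve, and near an inner point of \<open>A\<close>
  there are points of both of its sides.\<close>
lemma card_components_Suc:
  assumes fin: "finite (components (- K))" and pc: "path_component K (pathstart A) (pathfinish A)"
  shows "Suc (card (components (- K))) \<le> card (components (- X))"
proof -
  have ne: "pathstart A \<noteq> pathfinish A" using A arc_distinct_ends by metis
  obtain p where p: "path p" "path_image p \<subseteq> K" "pathstart p = pathfinish A" "pathfinish p = pathstart A"
    using path_component_sym[OF pc] unfolding path_component_def by auto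
  \<comment> \<open>A path in \<open>K\<close> may cross itself; an arc inside it makes
    \<open>c\<close> a simple closed curve.\<close>
  obtain q where q: "arc q" "path_image q \<subseteq> path_image p" "pathstart q = pathfinish A" "pathfinish q = pathstart A"
    using path_contains_arc[OF p(1,3,4)] ne by metis
  define c where "c = A +++ q"
  have "path_image A \<inter> path_image q \<subseteq> {pathstart A, pathstart q}"
  proof -
    have "path_image A \<inter> path_image q \<subseteq> K \<inter> path_image A" using p(2) q(2) by auto
    then show ?thesis using ends q(3) by simp
  qed
  then have c: "simple_path c" "pathfinish c = pathstart c" "path_image c = path_image A \<union> path_image q"
    unfolding c_def using A q by (simp_all add: simple_path_join_loop path_image_join)
  note J = Jordan_inside_outside[OF c(1,2)]
  obtain z where z: "z \<in> path_image A - {pathstart A, pathfinish A}" using arc_interior_connected(2)[OF A] by blast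
  then have zK: "z \<in> - K" using ends by blast
  then obtain W where W: "W \<in> components (- K)" "z \<in> W" using Union_components by (metis UnionE)
  have oW: "open W" using W open_complements(1) open_components by blast
  \<comment> \<open>\<open>z\<close> lies on the frontier of both sides of the curve, so its open
    neighbourhood \<open>W\<close> meets both.\<close>
  have meet: "\<exists>x. x \<in> W \<and> x \<in> G" if "frontier G = path_image c" for G
  proof -
    have "z \<in> closure G" using that z c by (auto simp: frontier_def)
    then show ?thesis using open_Int_closure_eq_empty[OF oW, of G] W(2) by blast
  qed
  have clo: "\<exists>C\<in>components (- X). C \<subseteq> W \<and> C \<inter> G \<noteq> {}"
    if G: "frontier G = path_image c" "open G" "G \<inter> path_image c = {}" for G
  proof -
    have "open (G \<inter> W)" using G oW by blast
    moreover have "G \<inter> W \<noteq> {}" using meet[OF G(1)] by blast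
    ultimately obtain x where x: "x \<in> G \<inter> W" by blast
    then have "x \<in> - X" using G c W in_components_subset by fastforce
    then obtain C where C: "C \<in> components (- X)" "x \<in> C" using Union_components by (metis UnionE)
    then have "C \<subseteq> W"
      using components_in_superset[of C "- X" "- K"] component_unique[OF W(1)] x by blast
    then show ?thesis using C x by blast
  qed
  obtain C1 where C1: "C1 \<in> components (- X)" "C1 \<subseteq> W" "C1 \<inter> inside (path_image c) \<noteq> {}"
    using clo[of "inside (path_image c)"] J inside_no_overlap by blast
  obtain C2 where C2: "C2 \<in> components (- X)" "C2 \<subseteq> W" "C2 \<inter> outside (path_image c) \<noteq> {}"
    using clo[of "outside (path_image c)"] J outside_no_overlap by blast
  have cX: "path_image c \<subseteq> X" using c q p by blast
  have "C1 \<noteq> C2"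
  proof
    assume "C1 = C2"
    then have "C1 - inside (path_image c) \<noteq> {}"
      using C2(3) inside_Int_outside[of "path_image c"] by blast
    then have "C1 \<inter> frontier (inside (path_image c)) \<noteq> {}"
      using connected_Int_frontier[of C1 "inside (path_image c)"] C1(3) in_components_connected[OF C1(1)] by simp
    then have "C1 \<inter> path_image c \<noteq> {}" using J by simp
    then show False using cX in_components_subset[OF C1(1)] by auto
  qed
  define \<phi> where "\<phi> = (\<lambda>W. SOME C. C \<in> components (- X) \<and> C \<subseteq> W)"
  have \<phi>: "\<phi> W \<in> components (- X)" "\<phi> W \<subseteq> W" if "W \<in> components (- K)" for W
    using someI_ex[of "\<lambda>C. C \<in> components (- X) \<and> C \<subseteq> W"] component_inside[OF that] by (auto simp: \<phi>_def)
  have uniq: "V = V'" if "V \<in> components (- K)" "V' \<in> components (- K)" "C \<in> components (- X)" "C \<subseteq> V" "C \<subseteq> V'" for V V' C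
    using component_unique[OF that(1,2)] in_components_nonempty[OF that(3)] that(4,5) by blast
  \<comment> \<open>\<open>C1\<close> and \<open>C2\<close> both lie in \<open>W\<close>, so one of
    them differs from \<open>\<phi> W\<close>. No other component of \<open>- K\<close> can have
    chosen it: this is the extra component.\<close>
  obtain C where C: "C \<in> components (- X)" "C \<subseteq> W" "C \<noteq> \<phi> W" using C1 C2 \<open>C1 \<noteq> C2\<close> by blast
  have "C \<notin> \<phi> ` components (- K)" using C uniq \<phi> W(1) by blast
  moreover have "inj_on \<phi> (components (- K))"
    by (rule inj_onI) (use \<phi> uniq in \<open>metis order_refl\<close>)
  moreover have "insert C (\<phi> ` components (- K)) \<subseteq> components (- X)" using C \<phi> by blast
  ultimately show ?thesis
    using card_mono[OF finite_components[OF fin], of "insert C (\<phi> ` components (- K))"] fin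
    by (simp add: card_image)
qed

end

section \<open>Plane graphs with extended nodes\<close>

lemma card_image_classes_insert:
  fixes R :: "('n \<times> 'n) set" and u v :: 'n
  assumes R: "sym R" and fin: "finite N" and u: "u \<in> N" and v: "v \<in> N" and uv: "(u, v) \<notin> R\<^sup>*"
  defines "R' \<equiv> insert (u, v) (insert (v, u) R)"
  shows "Suc (card ((\<lambda>w. R'\<^sup>* `` {w}) ` N)) \<le> card ((\<lambda>w. R\<^sup>* `` {w}) ` N)"
proof -
  define c where "c w = R\<^sup>* `` {w}" for w
  define c' where "c' w = R'\<^sup>* `` {w}" for w
  have sub: "R\<^sup>* \<subseteq> R'\<^sup>*" unfolding R'_def by (intro rtrancl_mono) auto
  have g: "c' w = R'\<^sup>* `` c w" for w
    using sub by (auto simp: c_def c'_def intro: rtrancl_trans)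
  have "(u, v) \<in> R'\<^sup>*" "(v, u) \<in> R'\<^sup>*" by (auto simp: R'_def)
  then have eq: "c' u = c' v" by (auto simp: c'_def intro: rtrancl_trans)
  have ne: "c u \<noteq> c v"
  proof
    assume "c u = c v"
    moreover have "v \<in> c v" by (simp add: c_def)
    ultimately have "v \<in> c u" by simp
    then show False using uv by (simp add: c_def)
  qed
  have "c' ` N \<subseteq> (\<lambda>C. R'\<^sup>* `` C) ` (c ` N - {c v})"
  proof (rule image_subsetI)
    fix w assume w: "w \<in> N"
    show "c' w \<in> (\<lambda>C. R'\<^sup>* `` C) ` (c ` N - {c v})"
    proof (cases "c w = c v")
      case True
      then have "c' w = c' v" by (simp add: g)
      then have "c' w = R'\<^sup>* `` c u" using eq g by simp
      then show ?thesis using ne u by (intro image_eqI[of _ _ "c u"]) auto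
    next
      case False
      then show ?thesis using w g by (intro image_eqI[of _ _ "c w"]) auto
    qed
  qed
  then have "card (c' ` N) \<le> card (c ` N - {c v})"
    using fin by (intro surj_card_le) auto
  moreover have "c v \<in> c ` N" using v by simp
  then have "Suc (card (c ` N - {c v})) = card (c ` N)"
    using fin by (intro card_Suc_Diff1) auto
  ultimately show ?thesis unfolding c_def c'_def by simp
qed

text \<open>Without a leaf every vertex lies on at least two of the three edges, so there are at
  most three vertices and the edges form a triangle. The cases ask which of the other two edges
  shares the end \<open>a\<close> of \<open>e1\<close>.\<close>

lemma three_edges_leaf_or_triangle:
  assumes J: "card J = 3" "\<And>e. e \<in> J \<Longrightarrow> card e = 2"
  shows "(\<exists>e\<in>J. \<exists>u\<in>e. u \<notin> \<Union>(J - {e})) \<or>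
    (\<exists>a b c. a \<noteq> b \<and> a \<noteq> c \<and> b \<noteq> c \<and> J = {{a, b}, {a, c}, {b, c}})"
proof (cases "\<exists>e\<in>J. \<exists>u\<in>e. u \<notin> \<Union>(J - {e})")
  case False
  obtain e1 e2 e3 where e: "J = {e1, e2, e3}" "e1 \<noteq> e2" "e1 \<noteq> e3" "e2 \<noteq> e3"
    using J(1) by (metis card_3_iff)
  obtain a b where ab: "e1 = {a, b}" "a \<noteq> b" using J(2)[of e1] e by (auto simp: card_2_iff)
  obtain c d where cd: "e2 = {c, d}" "c \<noteq> d" using J(2)[of e2] e by (auto simp: card_2_iff)
  obtain x y where xy: "e3 = {x, y}" "x \<noteq> y" using J(2)[of e3] e by (auto simp: card_2_iff)
  have 1: "a \<in> e2 \<union> e3" "b \<in> e2 \<union> e3" using False e ab by auto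
  have 2: "c \<in> e1 \<union> e3" "d \<in> e1 \<union> e3" using False e cd by auto
  have 3: "x \<in> e1 \<union> e2" "y \<in> e1 \<union> e2" using False e xy by auto
  have "\<exists>a b c. a \<noteq> b \<and> a \<noteq> c \<and> b \<noteq> c \<and> {e1, e2, e3} = {{a, b}, {a, c}, {b, c}}"
  proof (cases "a \<in> e2")
    case True
    then obtain c' where c': "e2 = {a, c'}" "c' \<noteq> a" using cd by blast
    have "c' \<noteq> b" using c' ab e by auto
    then have "c' \<in> e3" using 2 c' cd ab by auto
    moreover have "b \<in> e3" using 1 c' \<open>c' \<noteq> b\<close> ab by auto
    ultimately have "e3 = {b, c'}" using xy \<open>c' \<noteq> b\<close> by auto
    then have "{e1, e2, e3} = {{a, b}, {a, c'}, {b, c'}}" using ab(1) c'(1) by simp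
    then show ?thesis using ab(2) c'(2)[symmetric] \<open>c' \<noteq> b\<close>[symmetric] by (intro exI conjI)
  next
    case False
    then have "a \<in> e3" using 1 by auto
    then obtain c' where c': "e3 = {a, c'}" "c' \<noteq> a" using xy by blast
    have "c' \<noteq> b" using c' ab e by auto
    then have "c' \<in> e2" using 3 c' xy ab by auto
    moreover have "b \<in> e2" using 1 c' \<open>c' \<noteq> b\<close> ab by auto
    ultimately have "e2 = {b, c'}" using cd \<open>c' \<noteq> b\<close> by auto
    then have "{e1, e2, e3} = {{a, b}, {a, c'}, {b, c'}}" using ab(1) c'(1) by (simp add: insert_commute)
    then show ?thesis using ab(2) c'(2)[symmetric] \<open>c' \<noteq> b\<close>[symmetric] by (intro exI conjI)
  qed
  then show ?thesis unfolding e(1) by (rule disjI2)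
qed (rule disjI1)

text \<open>Nodes are sets rather than points: two edges may cross several times, so that their crossing
  becomes an arc, and crossing edges with a common end are separated by enlarging that end.\<close>
locale fat_plane_graph =
  fixes N :: "'n set" and E :: "'n set set" and S :: "'n \<Rightarrow> complex set" and \<rho> :: "'n set \<Rightarrow> real \<Rightarrow> complex"
  assumes finN: "finite N"
    and edge: "\<And>e. e \<in> E \<Longrightarrow> e \<subseteq> N \<and> card e = 2"
    and node: "\<And>v. v \<in> N \<Longrightarrow> compact (S v) \<and> path_connected (S v) \<and> connected (- S v)"
    and disj: "\<And>u v. \<lbrakk>u \<in> N; v \<in> N; u \<noteq> v\<rbrakk> \<Longrightarrow> S u \<inter> S v = {}"
    and arc: "\<And>e. e \<in> E \<Longrightarrow> arc (\<rho> e)"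
    and edge_ends: "\<And>e. e \<in> E \<Longrightarrow> \<exists>u v. e = {u, v} \<and> pathstart (\<rho> e) \<in> S u \<and> pathfinish (\<rho> e) \<in> S v"
    and edge_node: "\<And>e v. \<lbrakk>e \<in> E; v \<in> N\<rbrakk> \<Longrightarrow> path_image (\<rho> e) \<inter> S v \<subseteq> {pathstart (\<rho> e), pathfinish (\<rho> e)}"
    and edge_edge: "\<And>e f. \<lbrakk>e \<in> E; f \<in> E; e \<noteq> f\<rbrakk> \<Longrightarrow> path_image (\<rho> e) \<inter> path_image (\<rho> f) \<subseteq> \<Union>(S ` N)"
begin

text \<open>\<open>W\<close> and \<open>J\<close> vary separately: the connectedness proofs attach
  node sets one at a time, while the face count keeps \<open>W = N\<close> and lets \<open>J\<close>
  grow.\<close>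

definition support :: "'n set \<Rightarrow> 'n set set \<Rightarrow> complex set" where
  "support W J = \<Union>(S ` W) \<union> (\<Union>e\<in>J. path_image (\<rho> e))"

definition faces :: "complex set set" where
  "faces = components (- support N E)"

text \<open>Ends are left out because they lie on node sets, where a face may touch an edge without
  running along it. Being a set, the border counts an edge once even if the face lies on both sides
  of it.\<close>

definition border :: "complex set \<Rightarrow> 'n set set" where
  "border F = {e \<in> E. frontier F \<inter> (path_image (\<rho> e) - {pathstart (\<rho> e), pathfinish (\<rho> e)}) \<noteq> {}}"

lemma finE: "finite E"
  using finN edge by (meson Pow_iff finite_Pow_iff finite_subset subsetI)

lemma finJ: "J \<subseteq> E \<Longrightarrow> finite J"
  using finE finite_subset by blast

lemma compact_support:
  assumes "W \<subseteq> N" "J \<subseteq> E"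
  shows "compact (support W J)"
  unfolding support_def
proof (intro compact_Un compact_UN)
  show "finite W" "finite J" using assms finN finE finite_subset by auto
  show "compact (S v)" if "v \<in> W" for v using node that assms by auto
  show "compact (path_image (\<rho> e))" if "e \<in> J" for e using arc that assms by (auto intro: compact_arc_image)
qed

lemma support_insert: "support W (insert e J) = support W J \<union> path_image (\<rho> e)"
  by (auto simp: support_def)

lemma support_mono: "J \<subseteq> J' \<Longrightarrow> support W J \<subseteq> support W J'"
  by (auto simp: support_def)

lemma ends_in_support:
  assumes "e \<in> E"
  shows "pathstart (\<rho> e) \<in> \<Union>(S ` N)" "pathfinish (\<rho> e) \<in> \<Union>(S ` N)"
  using edge_ends[OF assms] edge[OF assms] by auto

lemma edge_inter_support:
  assumes e: "e \<in> E" "e \<notin> J" and J: "J \<subseteq> E"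
  shows "support N J \<inter> path_image (\<rho> e) = {pathstart (\<rho> e), pathfinish (\<rho> e)}"
proof
  have nodes: "\<Union>(S ` N) \<inter> path_image (\<rho> e) \<subseteq> {pathstart (\<rho> e), pathfinish (\<rho> e)}"
    using edge_node[OF e(1)] by blast
  have "path_image (\<rho> f) \<inter> path_image (\<rho> e) \<subseteq> \<Union>(S ` N)" if "f \<in> J" for f
    using edge_edge[of f e] that e J by blast
  then show "support N J \<inter> path_image (\<rho> e) \<subseteq> {pathstart (\<rho> e), pathfinish (\<rho> e)}"
    using nodes unfolding support_def by blast
  show "{pathstart (\<rho> e), pathfinish (\<rho> e)} \<subseteq> support N J \<inter> path_image (\<rho> e)"
    using ends_in_support[OF e(1)] by (auto simp: support_def)
qed

lemma edge_attached:
  assumes "e \<in> E" "e \<notin> J" "J \<subseteq> E"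
  shows "arc_attached (support N J) (\<rho> e)"
  using edge_inter_support[OF assms] compact_support[OF order_refl assms(3)] arc[OF assms(1)]
  by unfold_locales

lemma complement_nonempty:
  assumes "W \<subseteq> N" "J \<subseteq> E"
  shows "- support W J \<noteq> {}"
  using compact_support[OF assms]
  by (metis Compl_empty_eq compact_imp_bounded double_complement not_bounded_UNIV)

section \<open>Edge sets that do not separate the plane\<close>

lemma connected_insert_node:
  assumes "W \<subseteq> N" "J \<subseteq> E" "\<Union>J \<subseteq> W" "u \<in> N" "u \<notin> W" and c: "connected (- support W J)"
  shows "connected (- support (insert u W) J)"
proof -
  have "support W J \<inter> S u = {}"
  proof -
    have "S w \<inter> S u = {}" if "w \<in> W" for w using disj[of w u] that assms by blast
    moreover have "path_image (\<rho> e) \<inter> S u = {}" if e: "e \<in> J" for e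
    proof -
      have eE: "e \<in> E" using e assms by auto
      obtain a b where ab: "e = {a, b}" "pathstart (\<rho> e) \<in> S a" "pathfinish (\<rho> e) \<in> S b"
        using edge_ends[OF eE] by blast
      have "a \<in> W" "b \<in> W" using ab e assms by auto
      then have "S a \<inter> S u = {}" "S b \<inter> S u = {}" using disj assms by blast+
      then show ?thesis using edge_node[OF eE assms(4)] ab by blast
    qed
    ultimately show ?thesis unfolding support_def by blast
  qed
  then have "connected (- (support W J \<union> S u))"
    using Janiszewski_connected[of "support W J" "S u"] compact_support[of W J] node[OF assms(4)] assms c
    by (simp add: compact_imp_closed)
  moreover have "support W J \<union> S u = support (insert u W) J" by (auto simp: support_def)
  ultimately show ?thesis by simp
qed

lemma connected_insert_nodes:
  assumes "finite U" "U \<subseteq> N" "W \<subseteq> N" "J \<subseteq> E" "\<Union>J \<subseteq> W" and c: "connected (- support W J)"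
  shows "connected (- support (U \<union> W) J)"
  using assms(1,2)
proof (induction U)
  case (insert u U)
  show ?case
  proof (cases "u \<in> U \<union> W")
    case False
    then show ?thesis
      using connected_insert_node[of "U \<union> W" J u] insert assms by (simp add: le_supI2)
  qed (use insert in \<open>auto simp: insert_absorb\<close>)
qed (use c in simp)

text \<open>Janiszewski's theorem, used twice: compact sets that do not separate the plane and have
  a connected intersection have a union that does not separate it. The edge meets the old support
  only in its end \<open>b\<close> on \<open>S v\<close>, and the new node set meets the result only
  in the other end \<open>a\<close>.\<close>

lemma connected_insert_leaf:
  assumes W: "W \<subseteq> N" "J \<subseteq> E" "\<Union>J \<subseteq> W" "u \<in> N" "u \<notin> W" and e: "e \<in> E" "u \<in> e" "e \<subseteq> insert u W"
    and c: "connected (- support W J)"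
  shows "connected (- support (insert u W) (insert e J))"
proof -
  obtain v where v: "e = {u, v}" "v \<noteq> u" using edge[OF e(1)] e(2) by (auto simp: card_2_iff)
  have vW: "v \<in> W" using v e by auto
  obtain a b where ab: "{a, b} = {pathstart (\<rho> e), pathfinish (\<rho> e)}" "a \<in> S u" "b \<in> S v"
    using edge_ends[OF e(1)] v by (auto simp: doubleton_eq_iff insert_commute)
  have duv: "S u \<inter> S v = {}" using disj v W vW by blast
  have eJ: "e \<notin> J" using W e by auto
  have sub: "support W J \<subseteq> support N J" using W by (auto simp: support_def)
  have comp: "compact (support W J)" "compact (path_image (\<rho> e))" "compact (S u)"
    using compact_support W arc[OF e(1)] node by (auto intro: compact_arc_image)
  have dis: "support W J \<inter> S u = {}"
  proof -
    have "S w \<inter> S u = {}" if "w \<in> W" for w using disj[of w u] that W by blast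
    moreover have "path_image (\<rho> f) \<inter> S u = {}" if f: "f \<in> J" for f
    proof -
      have fE: "f \<in> E" using f W by auto
      obtain a b where ab: "f = {a, b}" "pathstart (\<rho> f) \<in> S a" "pathfinish (\<rho> f) \<in> S b"
        using edge_ends[OF fE] by blast
      have "a \<in> W" "b \<in> W" using ab f W by auto
      then have "S a \<inter> S u = {}" "S b \<inter> S u = {}" using disj W by blast+
      then show ?thesis using edge_node[OF fE W(4)] ab by blast
    qed
    ultimately show ?thesis unfolding support_def by blast
  qed
  have i1: "support W J \<inter> path_image (\<rho> e) = {b}"
  proof
    have "support W J \<inter> path_image (\<rho> e) \<subseteq> {a, b}"
      using edge_inter_support[OF e(1) eJ W(2)] sub ab(1) by blast
    then show "support W J \<inter> path_image (\<rho> e) \<subseteq> {b}" using dis ab(2) by blast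
    have "b \<in> path_image (\<rho> e)" using ab(1) pathstart_in_path_image[of "\<rho> e"] pathfinish_in_path_image[of "\<rho> e"]
      by (metis doubleton_eq_iff)
    then show "{b} \<subseteq> support W J \<inter> path_image (\<rho> e)" using ab vW by (auto simp: support_def)
  qed
  have "connected (- path_image (\<rho> e))" using connected_arc_complement[OF arc[OF e(1)]] by simp
  then have c1: "connected (- (support W J \<union> path_image (\<rho> e)))"
    using Janiszewski_connected[of "support W J" "path_image (\<rho> e)"] comp i1 c by (simp add: compact_imp_closed)
  have i2: "(support W J \<union> path_image (\<rho> e)) \<inter> S u = {a}"
  proof
    have "path_image (\<rho> e) \<inter> S u \<subseteq> {a, b}" using edge_node[OF e(1) W(4)] ab(1) by simp
    then show "(support W J \<union> path_image (\<rho> e)) \<inter> S u \<subseteq> {a}" using dis ab(3) duv by blast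
    have "a \<in> path_image (\<rho> e)" using ab(1) pathstart_in_path_image[of "\<rho> e"] pathfinish_in_path_image[of "\<rho> e"]
      by (metis doubleton_eq_iff)
    then show "{a} \<subseteq> (support W J \<union> path_image (\<rho> e)) \<inter> S u" using ab by auto
  qed
  have "connected (- ((support W J \<union> path_image (\<rho> e)) \<union> S u))"
    using Janiszewski_connected[of "support W J \<union> path_image (\<rho> e)" "S u"] comp i2 c1 node[OF W(4)]
    by (simp add: compact_imp_closed compact_Un)
  moreover have "(support W J \<union> path_image (\<rho> e)) \<union> S u = support (insert u W) (insert e J)"
    by (auto simp: support_def)
  ultimately show ?thesis by simp
qed

lemma connected_no_edges: "W \<subseteq> N \<Longrightarrow> connected (- support W {})"
proof -
  assume "W \<subseteq> N"
  moreover have "connected (- support {} {})" by (simp add: support_def connected_UNIV)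
  ultimately show ?thesis
    using connected_insert_nodes[of W "{}" "{}"] finN finite_subset by fastforce
qed

lemma connected_add_leaf:
  assumes "J \<subseteq> E" "e \<in> E" "u \<in> e" "u \<notin> \<Union>J" "\<Union>J \<subseteq> W" "e \<subseteq> W" "W \<subseteq> N"
    and "connected (- support (W - {u}) J)"
  shows "connected (- support W (insert e J))"
proof -
  have "connected (- support (insert u (W - {u})) (insert e J))"
    by (rule connected_insert_leaf) (use assms in auto)
  moreover have "insert u (W - {u}) = W" using assms by auto
  ultimately show ?thesis by simp
qed

lemma connected_one_edge:
  assumes "e \<in> E" "e \<subseteq> W" "W \<subseteq> N"
  shows "connected (- support W {e})"
proof -
  obtain u where "u \<in> e" using edge[OF assms(1)] by fastforce
  then show ?thesis
    by (intro connected_add_leaf[of "{}" e u]) (use assms connected_no_edges[of "W - {u}"] in auto)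
qed

lemma connected_two_edges:
  assumes "e \<in> E" "f \<in> E" "e \<subseteq> W" "f \<subseteq> W" "W \<subseteq> N"
  shows "connected (- support W {e, f})"
proof (cases "e = f")
  case False
  obtain a b where ab: "e = {a, b}" "a \<noteq> b" using edge[OF assms(1)] by (auto simp: card_2_iff)
  obtain c d where cd: "f = {c, d}" "c \<noteq> d" using edge[OF assms(2)] by (auto simp: card_2_iff)
  obtain u where u: "u \<in> e" "u \<notin> f" using ab cd False by auto
  have "connected (- support W (insert e {f}))"
    by (rule connected_add_leaf[of "{f}" e u]) (use assms u connected_one_edge[of f "W - {u}"] in auto)
  then show ?thesis .
qed (use connected_one_edge[OF assms(1,3,5)] in simp)

text \<open>Two edges of a simple graph cannot close a cycle, so each can be attached as a
  leaf.\<close>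

lemma connected_le_2_edges:
  assumes "J \<subseteq> E" "card J \<le> 2" "\<Union>J \<subseteq> W" "W \<subseteq> N"
  shows "connected (- support W J)"
proof -
  have "finite J" by (rule finJ[OF assms(1)])
  from assms(2) consider "card J = 0" | "card J = 1" | "card J = 2" by linarith
  then show ?thesis
  proof cases
    case 1
    then have "J = {}" using \<open>finite J\<close> by simp
    then show ?thesis using connected_no_edges assms(4) by simp
  next
    case 2
    then obtain e where "J = {e}" by (rule card_1_singletonE)
    then show ?thesis using connected_one_edge[of e W] assms by simp
  next
    case 3
    then obtain e f where "J = {e, f}" by (auto simp: card_2_iff)
    then show ?thesis using connected_two_edges[of e f W] assms by simp
  qed
qed

text \<open>The edge with the leaf is attached last, to a set of two edges.\<close>

lemma connected_three_edges_leaf: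
  assumes J: "J \<subseteq> E" "card J = 3" and e: "e \<in> J" "u \<in> e" "u \<notin> \<Union>(J - {e})"
  shows "connected (- support N J)"
proof -
  have sub: "\<Union>J \<subseteq> N" using J edge by blast
  have "card (J - {e}) \<le> 2" using J e finJ by simp
  then have c: "connected (- support (N - {u}) (J - {e}))"
    by (intro connected_le_2_edges) (use J e sub in auto)
  have "connected (- support N (insert e (J - {e})))"
    by (rule connected_add_leaf[of "J - {e}" e u N]) (use J e sub c in auto)
  moreover have "insert e (J - {e}) = J" using e by auto
  ultimately show ?thesis by simp
qed

section \<open>A lower bound for the number of faces\<close>

lemma finite_components_support:
  assumes "J \<subseteq> E"
  shows "finite (components (- support N J))"
  using finJ[OF assms] assms
proof (induction J)
  case empty
  have "components (- support N {}) = {- support N {}}"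
    using connected_no_edges[of N] complement_nonempty[of N "{}"] by (simp add: components_eq_sing_iff)
  then show ?case by simp
next
  case (insert e J)
  then show ?case
    using arc_attached.finite_components[OF edge_attached[of e J]] by (simp add: support_insert)
qed

text \<open>Node sets are path connected and edges are arcs, so a walk in the graph can be followed
  in the plane. This supplies the path that closes a further edge of the same class to a Jordan
  curve.\<close>

lemma path_component_support:
  assumes J: "J \<subseteq> E" and u: "u \<in> N" and r: "(u, v) \<in> {(x, y). {x, y} \<in> J}\<^sup>*" and xy: "x \<in> S u" "y \<in> S v"
  shows "path_component (support N J) x y"
proof -
  have "v \<in> N \<and> (\<forall>y\<in>S v. path_component (support N J) x y)"
    using r
  proof (induction rule: rtrancl_induct)
    case base
    have "path_component (S u) x y" if "y \<in> S u" for y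
      using node[OF u] xy that path_connected_component by blast
    moreover have "S u \<subseteq> support N J" using u by (auto simp: support_def)
    ultimately show ?case using u path_component_of_subset by blast
  next
    case (step v w)
    then have e: "{v, w} \<in> J" "{v, w} \<in> E" using J by auto
    have w: "w \<in> N" using edge[OF e(2)] by auto
    obtain p q where pq: "p \<in> S v" "q \<in> S w" "p \<in> path_image (\<rho> {v, w})" "q \<in> path_image (\<rho> {v, w})"
      using edge_ends[OF e(2)] by (auto simp: doubleton_eq_iff)
    have "path_component (path_image (\<rho> {v, w})) p q"
      using path_connected_path_image[OF arc_imp_path[OF arc[OF e(2)]]] pq path_connected_component by blast
    then have 1: "path_component (support N J) p q"
      using path_component_of_subset[of "path_image (\<rho> {v, w})" "support N J"] e by (auto simp: support_def)
    have 2: "path_component (support N J) x p" using step.IH pq by blast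
    have "path_component (support N J) q y" if "y \<in> S w" for y
    proof -
      have "path_component (S w) q y"
        using node[OF w] pq that path_connected_component by blast
      moreover have "S w \<subseteq> support N J" using w by (auto simp: support_def)
      ultimately show ?thesis using path_component_of_subset by blast
    qed
    then show ?case using w path_component_trans[OF path_component_trans[OF 2 1]] by blast
  qed
  then show ?thesis using xy by blast
qed

text \<open>An edge inside a class splits a face by the Jordan curve theorem; any other edge lowers the
  number of classes.\<close>
lemma card_components_support:
  assumes "J \<subseteq> E"
  shows "Suc (card J) + card ((\<lambda>w. {(x, y). {x, y} \<in> J}\<^sup>* `` {w}) ` N) \<le> card (components (- support N J)) + card N"
  using finJ[OF assms] assms
proof (induction J)
  case empty
  have "components (- support N {}) \<noteq> {}"
    using complement_nonempty[of N "{}"] by (simp add: components_eq_empty)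
  then have "0 < card (components (- support N {}))"
    using finite_components_support[of "{}"] by (simp add: card_gt_0_iff)
  moreover have "card ((\<lambda>w. {(x, y). {x, y} \<in> {}}\<^sup>* `` {w}) ` N) \<le> card N"
    using finN by (rule card_image_le)
  ultimately show ?case by simp
next
  case (insert e J)
  then have e: "e \<in> E" "e \<notin> J" "J \<subseteq> E" by auto
  interpret arc_attached "support N J" "\<rho> e" by (rule edge_attached[OF e])
  let ?R = "{(x, y). {x, y} \<in> J}"
  obtain u v where uv: "e = {u, v}" "pathstart (\<rho> e) \<in> S u" "pathfinish (\<rho> e) \<in> S v"
    using edge_ends[OF e(1)] by blast
  have uN: "u \<in> N" and vN: "v \<in> N" using uv edge[OF e(1)] by auto
  have R: "{(x, y). {x, y} \<in> insert e J} = insert (u, v) (insert (v, u) ?R)"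
    by (auto simp: uv doubleton_eq_iff)
  have sym: "sym ?R" by (auto simp: sym_def insert_commute)
  have fin: "finite (components (- support N J))" using finite_components_support[OF e(3)] .
  show ?case
  proof (cases "(u, v) \<in> ?R\<^sup>*")
    case True
    then have "(v, u) \<in> ?R\<^sup>*" using sym_rtrancl[OF sym] by (auto dest: symD)
    then have "(insert (u, v) (insert (v, u) ?R))\<^sup>* = ?R\<^sup>*"
      using True by (intro rtrancl_subset) auto
    moreover have "Suc (card (components (- support N J))) \<le> card (components (- support N (insert e J)))"
      using card_components_Suc[OF fin path_component_support[OF e(3) uN True uv(2,3)]] by (simp add: support_insert)
    ultimately show ?thesis unfolding R using insert.IH e insert.hyps by simp
  next
    case False
    have "Suc (card ((\<lambda>w. (insert (u, v) (insert (v, u) ?R))\<^sup>* `` {w}) ` N)) \<le> card ((\<lambda>w. ?R\<^sup>* `` {w}) ` N)"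
      by (rule card_image_classes_insert[OF sym finN uN vN False])
    moreover have "card (components (- support N J)) \<le> card (components (- support N (insert e J)))"
      using card_components_mono[OF fin] by (simp add: support_insert)
    ultimately show ?thesis unfolding R using insert.IH e insert.hyps by simp
  qed
qed

lemma finite_faces: "finite faces"
  unfolding faces_def by (rule finite_components_support) simp

text \<open>Half of Euler's formula, with the number of classes bounded below by one. It is the half
  that turns lower bounds on border sizes into upper bounds on the number of edges.\<close>

lemma card_faces_ge:
  assumes "N \<noteq> {}"
  shows "card E + 2 \<le> card faces + card N"
proof -
  have "0 < card ((\<lambda>w. {(x, y). {x, y} \<in> E}\<^sup>* `` {w}) ` N)"
    using assms finN by (simp add: card_gt_0_iff)
  then show ?thesis using card_components_support[of E] by (simp add: faces_def)
qed

section \<open>Faces and the edges on their borders\<close>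

lemma card_edge_sides:
  assumes e: "e \<in> E"
  shows "card {F \<in> faces. e \<in> border F} \<le> 2"
proof -
  interpret arc_attached "support N (E - {e})" "\<rho> e" using e by (intro edge_attached) auto
  have "support N (E - {e}) \<union> path_image (\<rho> e) = support N E"
    using support_insert[of N e "E - {e}"] e by (simp add: insert_absorb)
  then show ?thesis using at_most_two_sides e by (simp add: faces_def border_def)
qed

lemma sum_card_border: "(\<Sum>F\<in>faces. card (border F)) = (\<Sum>e\<in>E. card {F \<in> faces. e \<in> border F})"
proof -
  have "border F = {e \<in> E. e \<in> border F}" for F by (auto simp: border_def)
  then show ?thesis
    using sum_multicount_gen[OF finite_faces finE, of "\<lambda>F e. e \<in> border F" "\<lambda>e. card {F \<in> faces. e \<in> border F}"]
    by simp
qed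

text \<open>The frontier of \<open>F\<close> lies on node sets and border edges only, so a connected
  set that avoids these and meets \<open>F\<close> cannot leave it. Questions about a face thereby
  reduce to the few edges on its border.\<close>

lemma face_component_of_border:
  assumes F: "F \<in> faces"
  shows "F \<in> components (- support N (border F))"
proof -
  have b: "border F \<subseteq> E" by (auto simp: border_def)
  have sub: "F \<subseteq> - support N E" "connected F" "F \<noteq> {}"
    using F in_components_subset[of F] in_components_connected[of F] in_components_nonempty[of F] by (auto simp: faces_def)
  have fr: "frontier F \<subseteq> support N (border F)"
  proof
    fix z assume z: "z \<in> frontier F"
    have "z \<in> support N E"
      using frontier_of_components_closed_complement[of "support N E" F] F z compact_support[of N E]
      by (auto simp: faces_def compact_imp_closed)
    then consider "z \<in> \<Union>(S ` N)" | e where "e \<in> E" "z \<in> path_image (\<rho> e)"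
      by (auto simp: support_def)
    then show "z \<in> support N (border F)"
    proof cases
      case 2
      show ?thesis
      proof (cases "z \<in> {pathstart (\<rho> e), pathfinish (\<rho> e)}")
        case True
        then show ?thesis using ends_in_support[OF 2(1)] by (auto simp: support_def)
      next
        case False
        then have "e \<in> border F" using 2 z by (auto simp: border_def)
        then show ?thesis using 2 by (auto simp: support_def)
      qed
    qed (auto simp: support_def)
  qed
  have sb: "F \<subseteq> - support N (border F)" using sub(1) support_mono[OF b] by blast
  obtain C where C: "C \<in> components (- support N (border F))" "F \<subseteq> C"
    using exists_component_superset[of F "- support N (border F)"] sb sub by blast
  have "C \<subseteq> F"
  proof (rule ccontr)
    assume "\<not> C \<subseteq> F"
    then have "C \<inter> frontier F \<noteq> {}"
      using connected_Int_frontier[of C F] in_components_connected[OF C(1)] C(2) sub(3) by blast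
    then show False using fr in_components_subset[OF C(1)] by blast
  qed
  then show ?thesis using C by auto
qed

text \<open>An inner point of an edge outside \<open>J\<close> would lie in a component of the
  complement of the support of \<open>J\<close>. Such a component is a face, and faces avoid all
  edges.\<close>

lemma components_cover_imp_all_edges:
  assumes J: "J \<subseteq> E" and c: "components (- support N J) \<subseteq> faces"
  shows "J = E"
proof (rule ccontr)
  assume "J \<noteq> E"
  then obtain e where e: "e \<in> E" "e \<notin> J" using J by blast
  obtain z where z: "z \<in> path_image (\<rho> e)" "z \<notin> {pathstart (\<rho> e), pathfinish (\<rho> e)}"
    using arc_interior_connected(2)[OF arc[OF e(1)]] by blast
  then have "z \<in> - support N J" using edge_inter_support[OF e J] by blast
  then obtain C where C: "C \<in> components (- support N J)" "z \<in> C" using Union_components by (metis UnionE)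
  then have "C \<subseteq> - support N E" using c in_components_subset by (auto simp: faces_def)
  then show False using C e z by (auto simp: support_def)
qed

text \<open>If the border does not separate the plane, its complement is a single component, which
  must be \<open>F\<close>.\<close>

lemma connected_border_imp_all_edges:
  assumes F: "F \<in> faces" and c: "connected (- support N (border F))"
  shows "border F = E"
proof (rule components_cover_imp_all_edges)
  show b: "border F \<subseteq> E" by (auto simp: border_def)
  have "components (- support N (border F)) = {- support N (border F)}"
    using c complement_nonempty[OF order_refl b] by (simp add: components_eq_sing_iff)
  then show "components (- support N (border F)) \<subseteq> faces"
    using face_component_of_border[OF F] F by auto
qed

text \<open>At most two edges do not separate the plane, so such a border would contain all edges,
  and there are more.\<close>

lemma card_border_ge_3:
  assumes F: "F \<in> faces" and E: "3 \<le> card E"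
  shows "3 \<le> card (border F)"
proof (rule ccontr)
  assume n: "\<not> 3 \<le> card (border F)"
  have b: "border F \<subseteq> E" by (auto simp: border_def)
  then have "\<Union>(border F) \<subseteq> N" using edge by blast
  then have "connected (- support N (border F))"
    using connected_le_2_edges[OF b] n by simp
  then have "border F = E" by (rule connected_border_imp_all_edges[OF F])
  then show False using n E by simp
qed

text \<open>Three edges with a leaf do not separate the plane and would again be all edges, against
  the fourth one.\<close>

lemma border_triangle:
  assumes F: "F \<in> faces" and E: "4 \<le> card E" and b: "card (border F) = 3"
  shows "\<exists>x y z. x \<noteq> y \<and> x \<noteq> z \<and> y \<noteq> z \<and> border F = {{x, y}, {x, z}, {y, z}}"
proof -
  have bE: "border F \<subseteq> E" by (auto simp: border_def)
  then have c: "\<And>e. e \<in> border F \<Longrightarrow> card e = 2" using edge by blast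
  have leaf: False if "e \<in> border F" "u \<in> e" "u \<notin> \<Union>(border F - {e})" for e u
    using connected_border_imp_all_edges[OF F connected_three_edges_leaf[OF bE b that]] b E by simp
  show ?thesis
  proof (rule disjE[OF three_edges_leaf_or_triangle[OF b c]])
    assume "\<exists>e\<in>border F. \<exists>u\<in>e. u \<notin> \<Union>(border F - {e})"
    then show ?thesis using leaf by (elim bexE) (rule FalseE)
  qed
qed

text \<open>Needed so that distinct faces give distinct triples of nodes. Two edges of a triangle do
  not separate the plane, and attaching the third leaves at most two components. Two faces with the
  same triangular border would be all of these, so no fourth edge could be drawn.\<close>

lemma inj_on_border:
  assumes E: "4 \<le> card E" and b: "\<And>F. F \<in> faces \<Longrightarrow> card (border F) = 3"
  shows "inj_on border faces"
proof (rule inj_onI, rule ccontr)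
  fix F G assume FG: "F \<in> faces" "G \<in> faces" "border F = border G" "F \<noteq> G"
  have bE: "border F \<subseteq> E" by (auto simp: border_def)
  obtain e where e: "e \<in> border F" using b[OF FG(1)] by fastforce
  then have eE: "e \<in> E" using bE by auto
  let ?J = "border F - {e}"
  have J: "?J \<subseteq> E" "e \<notin> ?J" "card ?J = 2" using bE e b[OF FG(1)] finJ by auto
  have "connected (- support N ?J)"
    by (rule connected_le_2_edges) (use J edge in auto)
  then have "card (components (- (support N ?J \<union> path_image (\<rho> e)))) \<le> 2"
    by (rule arc_attached.card_components_le_2[OF edge_attached[OF eE J(2,1)]])
  moreover have eq: "support N ?J \<union> path_image (\<rho> e) = support N (border F)"
    using support_insert[of N e ?J] e by (simp add: insert_absorb)
  moreover have "{F, G} \<subseteq> components (- support N (border F))"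
    using face_component_of_border[of F] face_component_of_border[of G] FG by auto
  ultimately have "components (- support N (border F)) = {F, G}"
    using finite_components_support[OF bE] FG(4) card_seteq[of "components (- support N (border F))" "{F, G}"] by simp
  then have "border F = E" using components_cover_imp_all_edges[OF bE] FG by simp
  then show False using b[OF FG(1)] E by simp
qed

section \<open>Edge bounds and the case of equality\<close>

lemma sum_card_border_le: "(\<Sum>F\<in>faces. card (border F)) \<le> 2 * card E"
proof -
  have "(\<Sum>e\<in>E. card {F \<in> faces. e \<in> border F}) \<le> (\<Sum>e\<in>E. 2)"
    by (rule sum_mono) (use card_edge_sides in auto)
  then show ?thesis by (simp add: sum_card_border)
qed

lemma nodes_nonempty: "3 \<le> card E \<Longrightarrow> N \<noteq> {}"
proof
  assume "3 \<le> card E" "N = {}"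
  then obtain e where "e \<in> E" by fastforce
  then show False using edge[of e] \<open>N = {}\<close> by auto
qed

text \<open>Counting pairs of a face and an edge on its border gives
  \<open>3 * card faces \<le> 2 * card E\<close>; the lower bound for the faces eliminates
  \<open>card faces\<close>.\<close>

theorem card_edges_le:
  assumes E: "3 \<le> card E"
  shows "card E + 6 \<le> 3 * card N"
proof -
  have "3 * card faces \<le> (\<Sum>F\<in>faces. card (border F))"
    using sum_mono[of faces "\<lambda>_. 3" "\<lambda>F. card (border F)"] card_border_ge_3 E by simp
  then show ?thesis
    using sum_card_border_le card_faces_ge[OF nodes_nonempty[OF E]] by linarith
qed

text \<open>A border with three edges would be a triangle of the graph, so borders have at least
  four edges and the factor 3 improves to 4.\<close>

theorem card_edges_le_triangle_free:
  assumes E: "4 \<le> card E"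
    and tf: "\<And>x y z. \<lbrakk>x \<noteq> y; x \<noteq> z; y \<noteq> z; {x, y} \<in> E; {x, z} \<in> E\<rbrakk> \<Longrightarrow> {y, z} \<notin> E"
  shows "card E + 4 \<le> 2 * card N"
proof -
  have "4 \<le> card (border F)" if F: "F \<in> faces" for F
  proof (rule ccontr)
    assume "\<not> 4 \<le> card (border F)"
    then have "card (border F) = 3" using card_border_ge_3[OF F] E by simp
    then obtain x y z where xyz: "x \<noteq> y" "x \<noteq> z" "y \<noteq> z" "border F = {{x, y}, {x, z}, {y, z}}"
      using border_triangle[OF F E] by blast
    have "border F \<subseteq> E" by (auto simp: border_def)
    then show False using tf[of x y z] xyz by simp
  qed
  then have "4 * card faces \<le> (\<Sum>F\<in>faces. card (border F))"
    using sum_mono[of faces "\<lambda>_. 4" "\<lambda>F. card (border F)"] by simp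
  moreover have "N \<noteq> {}" using nodes_nonempty E by simp
  ultimately show ?thesis
    using sum_card_border_le card_faces_ge by fastforce
qed

text \<open>Equality in \<open>card_edges_le\<close> makes every inequality behind it an equality:
  each border has three edges and each edge two sides. Faces are recorded by their corner triples,
  so that the plane is no longer involved afterwards.\<close>

theorem triangulation:
  assumes E: "4 \<le> card E" and tight: "card E + 6 = 3 * card N"
  obtains T where "finite T" "3 * card T = 2 * card E"
    "\<And>t. t \<in> T \<Longrightarrow> card t = 3"
    "\<And>t x y. \<lbrakk>t \<in> T; x \<in> t; y \<in> t; x \<noteq> y\<rbrakk> \<Longrightarrow> {x, y} \<in> E"
    "\<And>e. e \<in> E \<Longrightarrow> card {t \<in> T. e \<subseteq> t} = 2"
proof -
  have ge: "3 \<le> card (border F)" if "F \<in> faces" for F using card_border_ge_3[OF that] E by simp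
  have N: "N \<noteq> {}" using nodes_nonempty E by simp
  have "3 * card faces \<le> (\<Sum>F\<in>faces. card (border F))"
    using sum_mono[of faces "\<lambda>_. 3" "\<lambda>F. card (border F)"] ge by simp
  then have sum: "(\<Sum>F\<in>faces. card (border F)) = 2 * card E" and f: "3 * card faces = 2 * card E"
    using sum_card_border_le card_faces_ge[OF N] tight by linarith+
  have b3: "card (border F) = 3" if F: "F \<in> faces" for F
  proof (rule ccontr)
    assume "card (border F) \<noteq> 3"
    then have "3 < card (border F)" using ge[OF F] by simp
    then have "(\<Sum>F\<in>faces. 3) < (\<Sum>F\<in>faces. card (border F))"
      using F ge finite_faces by (intro sum_strict_mono_ex1) auto
    then show False using sum f by simp
  qed
  have e2: "card {F \<in> faces. e \<in> border F} = 2" if e: "e \<in> E" for e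
  proof (rule ccontr)
    assume "card {F \<in> faces. e \<in> border F} \<noteq> 2"
    then have "card {F \<in> faces. e \<in> border F} < 2" using card_edge_sides[OF e] by simp
    then have "(\<Sum>e\<in>E. card {F \<in> faces. e \<in> border F}) < (\<Sum>e\<in>E. 2)"
      using e card_edge_sides finE by (intro sum_strict_mono_ex1) auto
    then show False using sum sum_card_border by simp
  qed
  note inj = inj_on_border[OF E b3]
  define \<tau> where "\<tau> F = \<Union>(border F)" for F
  have shape: "\<exists>a b c. a \<noteq> b \<and> a \<noteq> c \<and> b \<noteq> c \<and> border F = {{a, b}, {a, c}, {b, c}} \<and> \<tau> F = {a, b, c}"
    if F: "F \<in> faces" for F
  proof -
    obtain a b c where abc: "a \<noteq> b" "a \<noteq> c" "b \<noteq> c" "border F = {{a, b}, {a, c}, {b, c}}"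
      using border_triangle[OF F E b3[OF F]] by blast
    then have "\<tau> F = {a, b, c}" by (auto simp: \<tau>_def)
    then show ?thesis using abc by (intro exI conjI)
  qed
  have tri: "card (\<tau> F) = 3" if "F \<in> faces" for F
    using shape[OF that] by auto
  have pair: "{x, y} \<in> border F" if F: "F \<in> faces" and xy: "x \<in> \<tau> F" "y \<in> \<tau> F" "x \<noteq> y" for F x y
  proof -
    obtain a b c where abc: "border F = {{a, b}, {a, c}, {b, c}}" "\<tau> F = {a, b, c}" using shape[OF F] by blast
    show ?thesis using xy unfolding abc by (auto simp: insert_commute)
  qed
  \<comment> \<open>The border is the full triangle on its corners and can be recovered from them,
    so distinct faces have distinct corner triples.\<close>
  have edges: "e \<in> border F \<longleftrightarrow> e \<subseteq> \<tau> F" if F: "F \<in> faces" and e: "card e = 2" for F e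
  proof
    assume "e \<subseteq> \<tau> F"
    moreover obtain x y where "e = {x, y}" "x \<noteq> y" using e by (auto simp: card_2_iff)
    ultimately show "e \<in> border F" using pair[OF F] by simp
  qed (auto simp: \<tau>_def)
  have inj': "inj_on \<tau> faces"
  proof (rule inj_onI)
    fix F G assume FG: "F \<in> faces" "G \<in> faces" "\<tau> F = \<tau> G"
    have "card e = 2" if "e \<in> border F \<or> e \<in> border G" for e using that edge by (auto simp: border_def)
    then have "border F = border G" using edges[OF FG(1)] edges[OF FG(2)] FG(3) by (metis set_eqI)
    then show "F = G" using inj FG by (simp add: inj_on_def)
  qed
  show ?thesis
  proof
    show "finite (\<tau> ` faces)" using finite_faces by simp
    show "3 * card (\<tau> ` faces) = 2 * card E" using f inj' by (simp add: card_image)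
    show "card t = 3" if "t \<in> \<tau> ` faces" for t
      using that tri by auto
    show "{x, y} \<in> E" if t: "t \<in> \<tau> ` faces" and xy: "x \<in> t" "y \<in> t" "x \<noteq> y" for t x y
    proof -
      obtain F where F: "F \<in> faces" "t = \<tau> F" using t by blast
      then have "{x, y} \<in> border F" using pair[OF F(1)] xy F(2) by simp
      then show ?thesis by (simp add: border_def)
    qed
    show "card {t \<in> \<tau> ` faces. e \<subseteq> t} = 2" if e: "e \<in> E" for e
    proof -
      have "{t \<in> \<tau> ` faces. e \<subseteq> t} = \<tau> ` {F \<in> faces. e \<in> border F}"
        using edges[of _ e] edge[OF e] by auto
      moreover have "card (\<tau> ` {F \<in> faces. e \<in> border F}) = card {F \<in> faces. e \<in> border F}"
        by (rule card_image) (use inj' in \<open>auto intro: inj_on_subset\<close>)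
      ultimately show ?thesis using e2[OF e] by simp
    qed
  qed
qed

end

section \<open>Matchings and crossing pairs\<close>

text \<open>Two edges cover at most four vertices. Four vertices meet at most
  \<open>6 + 4 * (card V - 4)\<close> edges, two fewer than the graph has.\<close>

lemma edge_disjoint_from_small_matching:
  assumes V: "finite V" "8 \<le> card V" and E: "\<And>e. e \<in> E \<Longrightarrow> e \<subseteq> V \<and> card e = 2"
    and cE: "int (card E) = 4 * int (card V) - 8" and M: "M \<subseteq> E" "finite M" "card M \<le> 2"
  shows "\<exists>e\<in>E. e \<inter> \<Union>M = {}"
proof (rule ccontr)
  assume neg: "\<not> ?thesis"
  have "card (\<Union>M) \<le> (\<Sum>e\<in>M. card e)" using card_Union_le_sum_card[of M] by blast
  also have "\<dots> = 2 * card M" using M E by (simp add: subset_iff)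
  finally have "card (\<Union>M) \<le> 4" using M by simp
  moreover have "\<Union>M \<subseteq> V" using M E by blast
  ultimately obtain W where W: "\<Union>M \<subseteq> W" "W \<subseteq> V" "card W = 4"
    using V exists_subset_between[of "\<Union>M" 4 V] by auto
  have finW: "finite W" by (rule finite_subset[OF W(2) V(1)])
  let ?A = "{B. B \<subseteq> W \<and> card B = 2}" and ?B = "(\<lambda>(w, u). {w, u}) ` (W \<times> (V - W))"
  have "E \<subseteq> ?A \<union> ?B"
  proof
    fix e assume e: "e \<in> E"
    obtain w where w: "w \<in> e" "w \<in> W" using neg e W(1) by blast
    then obtain u where u: "e = {w, u}" "w \<noteq> u" using E[OF e] by (auto simp: card_2_iff)
    show "e \<in> ?A \<union> ?B"
    proof (cases "u \<in> W")
      case True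
      then show ?thesis using u w by auto
    next
      case False
      then have "(w, u) \<in> W \<times> (V - W)" using u w E[OF e] by auto
      then show ?thesis using u by (intro UnI2 image_eqI[of _ _ "(w, u)"]) auto
    qed
  qed
  then have "card E \<le> card (?A \<union> ?B)" using finW V by (intro card_mono) auto
  also have "\<dots> \<le> card ?A + card ?B" by (rule card_Un_le)
  also have "card ?A = 6" using n_subsets[OF finW, of 2] W by (simp add: choose_two)
  also have "card ?B \<le> card (W \<times> (V - W))" using finW V by (intro card_image_le) auto
  also have "\<dots> = 4 * (card V - 4)" using W finW by (simp add: card_cartesian_product card_Diff_subset)
  finally show False using cE V by linarith
qed

text \<open>\<open>extendable 3\<close> speaks of matchings with exactly three edges, so a smaller
  one has to be padded by disjoint edges.\<close>

lemma matching_extends: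
  assumes V: "finite V" "8 \<le> card V" and E: "\<And>e. e \<in> E \<Longrightarrow> e \<subseteq> V \<and> card e = 2"
    and cE: "int (card E) = 4 * int (card V) - 8" and M: "matching E M" "finite M" "card M \<le> 3"
  shows "\<exists>M'. k_matching 3 E M' \<and> M \<subseteq> M'"
  using M
proof (induction "3 - card M" arbitrary: M)
  case 0
  then show ?case by (auto simp: k_matching_def)
next
  case (Suc k)
  then have sub: "M \<subseteq> E" "card M \<le> 2" by (auto simp: matching_def)
  obtain e where e: "e \<in> E" "e \<inter> \<Union>M = {}"
    using edge_disjoint_from_small_matching[OF V E cE sub(1) Suc.prems(2) sub(2)] by blast
  have "e \<noteq> {}" using E[OF e(1)] by auto
  then have "e \<notin> M" using e(2) by blast
  have "matching E (insert e M)"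
    using Suc.prems(1) e unfolding matching_def by (auto simp: disjoint_def pairwise_insert disjnt_def)
  then have "\<exists>M'. k_matching 3 E M' \<and> insert e M \<subseteq> M'"
    using Suc.prems sub \<open>e \<notin> M\<close> Suc.hyps(2) by (intro Suc.hyps(1)) auto
  then show ?case by blast
qed

text \<open>A perfect matching containing \<open>M\<close> would match \<open>v\<close> with a
  neighbour that \<open>M\<close> already matches with another vertex.\<close>

lemma matching_covering_neighbours_not_extendable:
  assumes V: "finite V" and E: "\<And>e. e \<in> E \<Longrightarrow> e \<subseteq> V \<and> card e = 2"
    and cE: "int (card E) = 4 * int (card V) - 8" and M: "matching E M" "finite M" "card M \<le> 3"
    and v: "v \<in> V" "v \<notin> \<Union>M" and cover: "\<And>w. {v, w} \<in> E \<Longrightarrow> w \<in> \<Union>M"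
  shows "\<not> extendable 3 V E"
proof
  assume ext: "extendable 3 V E"
  then have "8 \<le> card V" by (simp add: extendable_def)
  then obtain M' where M': "k_matching 3 E M'" "M \<subseteq> M'"
    using matching_extends[OF V _ E cE M] by blast
  then obtain P where P: "perfect_matching V E P" "M \<subseteq> P"
    using ext by (auto simp: extendable_def)
  then obtain e where e: "e \<in> P" "v \<in> e" using v(1) by (auto simp: perfect_matching_def)
  have "e \<in> E" using e(1) P by (auto simp: perfect_matching_def matching_def)
  then obtain w where w: "e = {v, w}" using E[of e] e(2) by (auto simp: card_2_iff)
  then obtain f where f: "f \<in> M" "w \<in> f" using cover \<open>e \<in> E\<close> by blast
  have "f \<noteq> e" using f v(2) e(2) by blast
  moreover have "f \<in> P" using f P by blast
  ultimately have "e \<inter> f = {}"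
    using P(1) e(1) by (auto simp: perfect_matching_def matching_def disjoint_def)
  then show False using f w by blast
qed

lemma card_filter_eq_sum: "finite A \<Longrightarrow> card {z \<in> A. Q z} = (\<Sum>z\<in>A. if Q z then 1 else 0)"
  by (simp add: sum.If_cases Int_def)

text \<open>The incidence between \<open>A\<close> and \<open>X\<close> is 2-regular on both sides,
  so Hall's condition holds. For at most three sets the representatives are chosen by hand.\<close>

lemma distinct_representatives_le_3:
  assumes A: "finite A" "card A \<le> 3" and P: "\<And>z. z \<in> A \<Longrightarrow> card (P z) = 2 \<and> P z \<subseteq> X"
    and X: "\<And>x. x \<in> X \<Longrightarrow> card {z \<in> A. x \<in> P z} = 2"
  shows "\<exists>m. inj_on m A \<and> (\<forall>z\<in>A. m z \<in> P z)"
proof -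
  consider "card A = 0" | "card A = 1" | "card A = 2" | "card A = 3" using A(2) by linarith
  then show ?thesis
  proof cases
    case 1
    then show ?thesis using A by simp
  next
    \<comment> \<open>Impossible: an element of \<open>P z\<close> lies in two of the sets, but
      there is only one.\<close>
    case 2
    then obtain z where z: "A = {z}" by (rule card_1_singletonE)
    obtain x where x: "x \<in> P z" using P[of z] z by fastforce
    then have "card {y \<in> A. x \<in> P y} = 2" using X[of x] P[of z] z by blast
    moreover have "card {y \<in> A. x \<in> P y} \<le> card A" using A by (intro card_mono) auto
    ultimately show ?thesis using 2 by simp
  next
    case 3
    then obtain y z where yz: "A = {y, z}" "y \<noteq> z" by (auto simp: card_2_iff)
    obtain p q where pq: "P y = {p, q}" "p \<noteq> q" using P[of y] yz by (auto simp: card_2_iff)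
    have "q \<in> X" using P[of y] yz pq by auto
    then have "(\<Sum>w\<in>A. if q \<in> P w then 1 else 0) = (2::nat)"
      using X card_filter_eq_sum[OF A(1)] by metis
    then have "q \<in> P z" using yz by (simp split: if_splits)
    then show ?thesis using yz pq by (intro exI[of _ "\<lambda>w. if w = y then p else q"]) (auto simp: inj_on_def)
  next
    case 4
    then obtain y z w where yz: "A = {y, z, w}" "y \<noteq> z" "y \<noteq> w" "z \<noteq> w" by (auto simp: card_3_iff)
    have cnt: "(if x \<in> P y then 1 else 0) + ((if x \<in> P z then 1 else 0) + (if x \<in> P w then 1 else 0)) = (2::nat)"
      if "x \<in> X" for x
    proof -
      have "(\<Sum>w\<in>A. if x \<in> P w then 1 else 0) = (2::nat)"
        using X[OF that] card_filter_eq_sum[OF A(1)] by metis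
      then show ?thesis using yz by simp
    qed
    have PX: "P y \<subseteq> X" "P z \<subseteq> X" "P w \<subseteq> X" using P yz by auto
    obtain p q where pq: "P y = {p, q}" "p \<noteq> q" using P[of y] yz by (auto simp: card_2_iff)
    \<comment> \<open>Representatives are \<open>p\<close> for \<open>y\<close>, the other element
      \<open>r\<close> of \<open>P z\<close> for \<open>z\<close>, and \<open>q\<close> for
      \<open>w\<close>. If \<open>r = q\<close>, then \<open>P y = P z\<close>, and an element of
      \<open>P w\<close> would be covered three times or once.\<close>
    have fin: "\<exists>m. inj_on m A \<and> (\<forall>z\<in>A. m z \<in> P z)"
      if zw: "A = {y, z, w}" "y \<noteq> z" "y \<noteq> w" "z \<noteq> w" and p: "p \<in> P z" "p \<notin> P w" and PX: "P z \<subseteq> X" "P w \<subseteq> X" and 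
        cnt: "\<And>x. x \<in> X \<Longrightarrow> (if x \<in> P y then 1 else 0) + ((if x \<in> P z then 1 else 0) + (if x \<in> P w then 1 else 0)) = (2::nat)"
        and q: "q \<in> X"
      for z w
    proof -
      obtain a b where "P z = {a, b}" "a \<noteq> b" using P[of z] zw by (auto simp: card_2_iff)
      then obtain r where r: "P z = {p, r}" "r \<noteq> p" using p(1) by (cases "p = a") auto
      have "r \<noteq> q"
      proof
        assume "r = q"
        then have eq: "P z = P y" using r pq by simp
        obtain x where x: "x \<in> P w" using P[of w] zw by fastforce
        then have "x \<in> X" using PX by auto
        then show False using cnt[of x] x eq by (cases "x \<in> P y") auto
      qed
      then have "q \<notin> P z" using r pq by auto
      then have "q \<in> P w" using cnt[OF q] pq by (auto split: if_splits)
      then show ?thesis using zw r pq \<open>r \<noteq> q\<close> 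
        by (intro exI[of _ "\<lambda>u. if u = y then p else if u = z then r else q"]) (auto simp: inj_on_def)
    qed
    have X': "p \<in> X" "q \<in> X" using PX pq by auto
    show ?thesis
    proof (cases "p \<in> P z")
      case True
      then have "p \<notin> P w" using cnt[OF X'(1)] pq by (auto split: if_splits)
      show ?thesis by (rule fin[of z w]) (use yz True \<open>p \<notin> P w\<close> PX cnt X' in auto)
    next
      case False
      then have "p \<in> P w" using cnt[OF X'(1)] pq by (auto split: if_splits)
      have cnt': "(if x \<in> P y then 1 else 0) + ((if x \<in> P w then 1 else 0) + (if x \<in> P z then 1 else 0)) = (2::nat)"
        if "x \<in> X" for x
        using cnt[OF that] by simp
      have "A = {y, w, z}" using yz(1) by auto
      then show ?thesis
        using yz(2-4) False \<open>p \<in> P w\<close> PX X' cnt' by (intro fin[of w z]) auto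
    qed
  qed
qed

text \<open>\<open>Z\<close> is the set of the pairs of crossing edges without a common end; \<open>Inr z\<close> is the node of the
  planarization at which the two edges of \<open>z\<close> cross.\<close>
locale crossing_pairs =
  fixes V :: "'a set" and E :: "'a set set" and Z :: "'a set set set"
  assumes finV: "finite V" and edge: "\<And>e. e \<in> E \<Longrightarrow> e \<subseteq> V \<and> card e = 2"
    and pair: "\<And>z. z \<in> Z \<Longrightarrow> \<exists>e f. z = {e, f} \<and> e \<in> E \<and> f \<in> E \<and> e \<inter> f = {}"
    and pairs_disjoint: "\<And>z z'. \<lbrakk>z \<in> Z; z' \<in> Z; z \<noteq> z'\<rbrakk> \<Longrightarrow> z \<inter> z' = {}"
begin

definition nodes :: "('a + 'a set set) set" where
  "nodes = Inl ` V \<union> Inr ` Z"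

text \<open>As \<open>Z\<close> holds only pairs without a common end, an edge that crosses an
  adjacent edge counts as plain.\<close>

definition plain_edges :: "('a + 'a set set) set set" where
  "plain_edges = (`) Inl ` (E - \<Union>Z)"

definition star_edges :: "('a + 'a set set) set set" where
  "star_edges = (\<Union>z\<in>Z. (\<lambda>v. {Inl v, Inr z}) ` \<Union>z)"

lemma finE: "finite E"
  using finV edge by (meson Pow_iff finite_Pow_iff finite_subset subsetI)

lemma Z_subset: "Z \<subseteq> Pow E"
  using pair by blast

lemma finZ: "finite Z"
  using finite_subset[OF Z_subset] finE by simp

lemma pairE:
  assumes "z \<in> Z"
  obtains a b c d where "z = {{a, b}, {c, d}}" "{a, b} \<in> E" "{c, d} \<in> E" 
    "a \<noteq> b" "a \<noteq> c" "a \<noteq> d" "b \<noteq> c" "b \<noteq> d" "c \<noteq> d"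
proof -
  obtain e f where ef: "z = {e, f}" "e \<in> E" "f \<in> E" "e \<inter> f = {}" using pair[OF assms] by blast
  obtain a b where ab: "e = {a, b}" "a \<noteq> b" using edge[OF ef(2)] by (auto simp: card_2_iff)
  obtain c d where cd: "f = {c, d}" "c \<noteq> d" using edge[OF ef(3)] by (auto simp: card_2_iff)
  show ?thesis using ef ab cd by (intro that[of a b c d]) auto
qed

lemma card_pair: "z \<in> Z \<Longrightarrow> card z = 2"
  by (erule pairE) (auto simp: doubleton_eq_iff)

lemma card_Union_pair: "z \<in> Z \<Longrightarrow> card (\<Union>z) = 4"
  by (erule pairE) auto

lemma Union_pair_subset: "z \<in> Z \<Longrightarrow> \<Union>z \<subseteq> V"
  using Z_subset edge by blast

lemma finite_Union_pair: "z \<in> Z \<Longrightarrow> finite (\<Union>z)"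
  by (rule finite_subset[OF Union_pair_subset finV])

lemma card_nodes: "card nodes = card V + card Z"
  unfolding nodes_def using finV finZ
  by (subst card_Un_disjoint) (auto simp: card_image)

lemma card_plain_edges: "card plain_edges + 2 * card Z = card E"
proof -
  have "card (\<Union>Z) = (\<Sum>z\<in>Z. card z)"
  proof (rule card_Union_disjoint)
    show "pairwise disjnt Z" using pairs_disjoint by (simp add: pairwise_def disjnt_def)
    show "finite z" if "z \<in> Z" for z using card_pair[OF that] card_ge_0_finite by force
  qed
  also have "\<dots> = 2 * card Z" using card_pair by simp
  finally have c: "card (\<Union>Z) = 2 * card Z" .
  have sub: "\<Union>Z \<subseteq> E" using Z_subset by blast
  have "inj_on ((`) (Inl :: 'a \<Rightarrow> 'a + 'a set set)) (E - \<Union>Z)"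
    by (rule inj_on_image) simp
  then have "card plain_edges = card (E - \<Union>Z)"
    unfolding plain_edges_def by (rule card_image)
  also have "\<dots> = card E - card (\<Union>Z)"
    using finite_subset[OF sub finE] sub by (rule card_Diff_subset)
  moreover have "card (\<Union>Z) \<le> card E" using sub finE by (rule card_mono[rotated])
  ultimately show ?thesis using c by simp
qed

lemma card_star_edges: "card star_edges = 4 * card Z"
proof -
  have "card star_edges = (\<Sum>z\<in>Z. card ((\<lambda>v. {Inl v, Inr z} :: ('a + 'a set set) set) ` \<Union>z))"
    unfolding star_edges_def using finZ finite_Union_pair
    by (intro card_UN_disjoint) (auto simp: doubleton_eq_iff)
  also have "\<dots> = (\<Sum>z\<in>Z. card (\<Union>z))"
    by (intro sum.cong card_image) (auto simp: inj_on_def doubleton_eq_iff)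
  also have "\<dots> = 4 * card Z" using card_Union_pair by simp
  finally show ?thesis .
qed

lemma plain_star_disjoint: "plain_edges \<inter> star_edges = {}"
  by (auto simp: plain_edges_def star_edges_def)

lemma finite_plain_star: "finite plain_edges" "finite star_edges"
  using finE finZ finite_Union_pair by (auto simp: plain_edges_def star_edges_def)

text \<open>Each crossing pair trades its two edges for four star edges.\<close>

lemma card_all_edges: "card (plain_edges \<union> star_edges) = card E + 2 * card Z"
  using card_Un_disjoint[OF finite_plain_star plain_star_disjoint] card_plain_edges card_star_edges by simp

lemma Inl_Inl_edge: "{Inl u, Inl v} \<in> plain_edges \<union> star_edges \<longleftrightarrow> {u, v} \<in> E - \<Union>Z"
proof
  assume "{Inl u, Inl v} \<in> plain_edges \<union> star_edges"
  then obtain e where e: "e \<in> E - \<Union>Z" "Inl ` e = ({Inl u, Inl v} :: ('a + 'a set set) set)"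
    by (auto simp: plain_edges_def star_edges_def doubleton_eq_iff)
  have "(Inl :: 'a \<Rightarrow> 'a + 'a set set) ` e = Inl ` {u, v}" using e(2) by simp
  then have "e = {u, v}" using inj_image_eq_iff[OF inj_Inl] by blast
  then show "{u, v} \<in> E - \<Union>Z" using e by simp
next
  assume "{u, v} \<in> E - \<Union>Z"
  then have "Inl ` {u, v} \<in> plain_edges" unfolding plain_edges_def by (rule imageI)
  then show "{Inl u, Inl v} \<in> plain_edges \<union> star_edges" by simp
qed

lemma Inr_not_plain: "Inr z \<in> e \<Longrightarrow> e \<notin> plain_edges"
  by (auto simp: plain_edges_def)

lemma star_edge_cases:
  assumes "e \<in> star_edges"
  obtains v z where "z \<in> Z" "v \<in> \<Union>z" "e = {Inl v, Inr z}"
  using assms unfolding star_edges_def by blast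

lemma Inl_Inr_edge: "{Inl u, Inr z} \<in> plain_edges \<union> star_edges \<longleftrightarrow> z \<in> Z \<and> u \<in> \<Union>z"
proof
  assume "{Inl u, Inr z} \<in> plain_edges \<union> star_edges"
  then have "{Inl u, Inr z} \<in> star_edges" using Inr_not_plain[of z "{Inl u, Inr z}"] by simp
  then show "z \<in> Z \<and> u \<in> \<Union>z" by (rule star_edge_cases) (auto simp: doubleton_eq_iff)
next
  assume "z \<in> Z \<and> u \<in> \<Union>z"
  then show "{Inl u, Inr z} \<in> plain_edges \<union> star_edges" unfolding star_edges_def by blast
qed

lemma Inr_Inr_edge: "{Inr y, Inr z} \<notin> plain_edges \<union> star_edges"
proof
  assume "{Inr y, Inr z} \<in> plain_edges \<union> star_edges"
  then have "{Inr y, Inr z} \<in> star_edges" using Inr_not_plain[of z "{Inr y, Inr z}"] by simp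
  then show False by (rule star_edge_cases) (auto simp: doubleton_eq_iff)
qed

text \<open>Star edges join vertices to crossings, so they form a bipartite graph.\<close>

lemma star_edges_triangle_free:
  assumes "x \<noteq> y" "x \<noteq> z" "y \<noteq> z" "{x, y} \<in> star_edges" "{x, z} \<in> star_edges"
  shows "{y, z} \<notin> star_edges"
proof
  assume yz: "{y, z} \<in> star_edges"
  have "isl a \<noteq> isl b" if "{a, b} \<in> star_edges" for a b
    using that by (rule star_edge_cases) (auto simp: doubleton_eq_iff)
  from this[OF assms(4)] this[OF assms(5)] this[OF yz] show False by simp
qed

end

text \<open>What remains of the drawing once both edge bounds are attained. The rest of the argument
  is combinatorial and refers to \<open>T\<close> alone.\<close>

locale triangulated_crossing_pairs = crossing_pairs +
  fixes T :: "('a + 'a set set) set set"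
  assumes finT: "finite T" and card_T: "3 * card T = 2 * card (plain_edges \<union> star_edges)"
    and card_triangle: "\<And>t. t \<in> T \<Longrightarrow> card t = 3"
    and triangle_edge: "\<And>t x y. \<lbrakk>t \<in> T; x \<in> t; y \<in> t; x \<noteq> y\<rbrakk> \<Longrightarrow> {x, y} \<in> plain_edges \<union> star_edges"
    and two_triangles: "\<And>e. e \<in> plain_edges \<union> star_edges \<Longrightarrow> card {t \<in> T. e \<subseteq> t} = 2"
    and card_E: "int (card E) = 4 * int (card V) - 8" and card_Z: "int (card Z) = int (card V) - 2"
begin

lemma triangle_third:
  assumes t: "t \<in> T" and xy: "x \<in> t" "y \<in> t" "x \<noteq> y"
  obtains w where "t = {x, y, w}" "w \<noteq> x" "w \<noteq> y"
proof -
  have f: "finite t" "card t = 3" using card_triangle[OF t] card_ge_0_finite[of t] by auto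
  then have "card (t - {x, y}) = 1" using xy by (simp add: card_Diff_subset)
  then obtain w where w: "t - {x, y} = {w}" by (rule card_1_singletonE)
  then show ?thesis using xy by (intro that[of w]) blast+
qed

text \<open>The edge from \<open>a\<close> to the crossing lies in two triangles. Their third
  corners are ends of the pair joined to \<open>a\<close> by plain edges. This excludes
  \<open>b\<close>, as \<open>{a, b}\<close> is a crossed edge, so the corners are \<open>c\<close>
  and \<open>d\<close>.\<close>

lemma star_triangles_aux:
  assumes z: "z \<in> Z" "z = {{a, b}, {c, d}}" and ne: "a \<noteq> c" "a \<noteq> d" "c \<noteq> d"
  shows "{a, c} \<in> E - \<Union>Z \<and> {Inl a, Inl c, Inr z} \<in> T" "{a, d} \<in> E - \<Union>Z \<and> {Inl a, Inl d, Inr z} \<in> T"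
proof -
  have "card {t \<in> T. {Inl a, Inr z} \<subseteq> t} = 2"
    by (rule two_triangles) (use z in \<open>simp add: Inl_Inr_edge[simplified]\<close>)
  then obtain t t' where t: "{t \<in> T. {Inl a, Inr z} \<subseteq> t} = {t, t'}" "t \<noteq> t'" by (auto simp: card_2_iff)
  have third: "\<exists>x\<in>{c, d}. s = {Inl a, Inl x, Inr z} \<and> {a, x} \<in> E - \<Union>Z" if "s \<in> {t, t'}" for s
  proof -
    have s: "s \<in> T" "Inl a \<in> s" "Inr z \<in> s" using that t(1) by blast+
    obtain w where w: "s = {Inl a, Inr z, w}" "w \<noteq> Inl a" "w \<noteq> Inr z"
      using triangle_third[OF s] by blast
    have e1: "{Inr z, w} \<in> plain_edges \<union> star_edges" and e2: "{Inl a, w} \<in> plain_edges \<union> star_edges"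
      using triangle_edge[OF s(1), of "Inr z" w] triangle_edge[OF s(1), of "Inl a" w] w by auto
    obtain x where x: "w = Inl x"
    proof (cases w)
      case (Inr y)
      then show ?thesis using e1 Inr_Inr_edge by blast
    qed
    have "x \<in> \<Union>z" using e1 x Inl_Inr_edge[of x z] by (simp add: insert_commute)
    moreover have ax: "{a, x} \<in> E - \<Union>Z" using e2 x Inl_Inl_edge by blast
    then have "{a, x} \<notin> z" using z(1) by blast
    then have "x \<noteq> b" using z(2) by blast
    moreover have "x \<noteq> a" using w x by blast
    ultimately have "x \<in> {c, d}" using z(2) by auto
    then show ?thesis using w(1) x ax by (intro bexI[of _ x]) (auto simp: insert_commute)
  qed
  obtain x x' where x: "x \<in> {c, d}" "t = {Inl a, Inl x, Inr z}" "{a, x} \<in> E - \<Union>Z"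
      and x': "x' \<in> {c, d}" "t' = {Inl a, Inl x', Inr z}" "{a, x'} \<in> E - \<Union>Z"
    using third[of t] third[of t'] by blast
  have "x \<noteq> x'" using x(2) x'(2) t(2) by blast
  moreover have "t \<in> T" "t' \<in> T" using t(1) by blast+
  ultimately have "x = c \<and> x' = d \<or> x = d \<and> x' = c" using x(1) x'(1) by blast
  then show "{a, c} \<in> E - \<Union>Z \<and> {Inl a, Inl c, Inr z} \<in> T" "{a, d} \<in> E - \<Union>Z \<and> {Inl a, Inl d, Inr z} \<in> T"
    using x x' \<open>t \<in> T\<close> \<open>t' \<in> T\<close> by auto
qed

text \<open>Each of the four ends takes the role of \<open>a\<close> once, which yields the whole
  4-cycle around the crossing with its four triangles.\<close>

lemma star_triangles:
  assumes z: "z \<in> Z" and ef: "e \<in> z" "f \<in> z" "e \<noteq> f" and ac: "a \<in> e" "c \<in> f"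
  shows "{a, c} \<in> E - \<Union>Z" "{Inl a, Inl c, Inr z} \<in> T"
proof -
  obtain p q r s where z': "z = {{p, q}, {r, s}}" and
    ne: "p \<noteq> q" "p \<noteq> r" "p \<noteq> s" "q \<noteq> r" "q \<noteq> s" "r \<noteq> s" using pairE[OF z] by metis
  have z2: "z = {{q, p}, {r, s}}" "z = {{r, s}, {p, q}}" "z = {{s, r}, {p, q}}" using z' by auto
  note * = star_triangles_aux[OF z z'] star_triangles_aux[OF z z2(1)]
    star_triangles_aux[OF z z2(2)] star_triangles_aux[OF z z2(3)]
  have "e = {p, q} \<and> f = {r, s} \<or> e = {r, s} \<and> f = {p, q}" using ef z' by auto
  then have "{a, c} \<in> E - \<Union>Z \<and> {Inl a, Inl c, Inr z} \<in> T"
  proof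
    assume "e = {p, q} \<and> f = {r, s}"
    then have "a = p \<or> a = q" "c = r \<or> c = s" using ac by auto
    then show ?thesis using * ne by metis
  next
    assume "e = {r, s} \<and> f = {p, q}"
    then have "a = r \<or> a = s" "c = p \<or> c = q" using ac by auto
    then show ?thesis using * ne by metis
  qed
  then show "{a, c} \<in> E - \<Union>Z" "{Inl a, Inl c, Inr z} \<in> T" by simp_all
qed

text \<open>Each crossing lies in at least four triangles, and crossings, being pairwise
  non-adjacent, share none. Since \<open>3 * card T = 2 * (card E + 2 * card Z)\<close> and
  \<open>card E = 4 * card Z\<close>, there are exactly \<open>4 * card Z\<close> triangles, so none
  is left over.\<close>

lemma triangle_contains_crossing:
  assumes t: "t \<in> T"
  shows "\<exists>z\<in>Z. Inr z \<in> t"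
proof -
  define S where "S z = {t \<in> T. Inr z \<in> t}" for z
  have ge: "4 \<le> card (S z)" if z: "z \<in> Z" for z
  proof -
    obtain p q r s where z': "z = {{p, q}, {r, s}}" and
      ne: "p \<noteq> q" "p \<noteq> r" "p \<noteq> s" "q \<noteq> r" "q \<noteq> s" "r \<noteq> s" using pairE[OF z] by metis
    let ?f = "\<lambda>(a, c). {Inl a, Inl c, Inr z} :: ('a + 'a set set) set"
    have d: "{p, q} \<noteq> {r, s}" using ne by auto
    have "?f ` ({p, q} \<times> {r, s}) \<subseteq> S z"
      using star_triangles(2)[OF z, of "{p, q}" "{r, s}"] z' d by (auto simp: S_def)
    moreover have "inj_on ?f ({p, q} \<times> {r, s})"
    proof (rule inj_onI)
      fix u w assume uw: "u \<in> {p, q} \<times> {r, s}" "w \<in> {p, q} \<times> {r, s}" "?f u = ?f w"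
      obtain a c a' c' where e: "u = (a, c)" "w = (a', c')" by (cases u, cases w) auto
      have m: "a \<in> {p, q}" "c \<in> {r, s}" "a' \<in> {p, q}" "c' \<in> {r, s}" using uw(1,2) e by auto
      have eq: "{Inl a, Inl c, Inr z} = ({Inl a', Inl c', Inr z} :: ('a + 'a set set) set)" using uw(3) e by simp
      have "Inl a \<in> ({Inl a', Inl c', Inr z} :: ('a + 'a set set) set)" by (subst eq[symmetric]) simp
      then have "a = a' \<or> a = c'" by simp
      moreover have "Inl c \<in> ({Inl a', Inl c', Inr z} :: ('a + 'a set set) set)" by (subst eq[symmetric]) simp
      then have "c = a' \<or> c = c'" by simp
      ultimately show "u = w" using m ne e by auto
    qed
    moreover have "finite (S z)" using finT by (simp add: S_def)
    ultimately have "card ({p, q} \<times> {r, s}) \<le> card (S z)"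
      using card_inj_on_le[of ?f "{p, q} \<times> {r, s}" "S z"] by simp
    then show ?thesis using ne by (simp add: card_cartesian_product)
  qed
  have "card (\<Union>z\<in>Z. S z) = (\<Sum>z\<in>Z. card (S z))"
  proof (intro card_UN_disjoint ballI impI)
    fix y z assume yz: "y \<in> Z" "z \<in> Z" "y \<noteq> z"
    have False if "t \<in> T" "Inr y \<in> t" "Inr z \<in> t" for t
      using triangle_edge[OF that] yz(3) Inr_Inr_edge by blast
    then show "S y \<inter> S z = {}" by (auto simp: S_def)
  qed (use finZ finT in \<open>auto simp: S_def\<close>)
  also have "\<dots> \<ge> (\<Sum>z\<in>Z. 4)" using ge by (intro sum_mono)
  finally have "4 * card Z \<le> card (\<Union>z\<in>Z. S z)" by simp
  moreover have "card T = 4 * card Z"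
    using card_T card_all_edges card_E card_Z by linarith
  ultimately have "(\<Union>z\<in>Z. S z) = T"
    using finT by (intro card_seteq) (auto simp: S_def)
  then show ?thesis using t by (auto simp: S_def)
qed

text \<open>The two triangles at a plain edge have crossings as third corners, and every crossing
  that involves both ends yields such a triangle.\<close>

lemma plain_edge_two_crossings:
  assumes e: "{v, x} \<in> E - \<Union>Z"
  shows "card {z \<in> Z. v \<in> \<Union>z \<and> x \<in> \<Union>z} = 2"
proof -
  have vx: "v \<noteq> x" using edge[of "{v, x}"] e by auto
  let ?f = "\<lambda>z. {Inl v, Inl x, Inr z} :: ('a + 'a set set) set"
  have "{t \<in> T. {Inl v, Inl x} \<subseteq> t} = ?f ` {z \<in> Z. v \<in> \<Union>z \<and> x \<in> \<Union>z}"
  proof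
    show "{t \<in> T. {Inl v, Inl x} \<subseteq> t} \<subseteq> ?f ` {z \<in> Z. v \<in> \<Union>z \<and> x \<in> \<Union>z}"
    proof clarify
      fix t assume t: "t \<in> T" "{Inl v, Inl x} \<subseteq> t"
      obtain z where z: "z \<in> Z" "Inr z \<in> t" using triangle_contains_crossing[OF t(1)] by blast
      obtain w where w: "t = {Inl v, Inl x, w}" using triangle_third[of t "Inl v" "Inl x"] t vx by auto
      then have "t = ?f z" using z by auto
      moreover have "v \<in> \<Union>z" "x \<in> \<Union>z"
        using triangle_edge[of t "Inl v" "Inr z"] triangle_edge[of t "Inl x" "Inr z"] t z Inl_Inr_edge by auto
      ultimately show "t \<in> ?f ` {z \<in> Z. v \<in> \<Union>z \<and> x \<in> \<Union>z}" using z by blast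
    qed
    show "?f ` {z \<in> Z. v \<in> \<Union>z \<and> x \<in> \<Union>z} \<subseteq> {t \<in> T. {Inl v, Inl x} \<subseteq> t}"
    proof clarify
      fix z f g assume z: "z \<in> Z" "f \<in> z" "v \<in> f" "g \<in> z" "x \<in> g"
      \<comment> \<open>A single edge of the pair containing both \<open>v\<close> and
        \<open>x\<close> would be \<open>{v, x}\<close> itself, which is not crossed.\<close>
      have "f \<noteq> g"
      proof
        assume "f = g"
        have "f \<in> E" using z(1,2) Z_subset by blast
        then have "f = {v, x}" using edge[of f] z \<open>f = g\<close> vx by (auto simp: card_2_iff)
        then show False using e z by blast
      qed
      then show "?f z \<in> T \<and> {Inl v, Inl x} \<subseteq> ?f z" using star_triangles(2)[OF z(1,2,4)] z by simp
    qed
  qed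
  moreover have "inj ?f" by (rule injI) (auto simp: set_eq_iff)
  ultimately have "card {t \<in> T. {Inl v, Inl x} \<subseteq> t} = card {z \<in> Z. v \<in> \<Union>z \<and> x \<in> \<Union>z}"
    by (simp add: card_image inj_on_subset)
  moreover have "card {t \<in> T. {Inl v, Inl x} \<subseteq> t} = 2"
    by (rule two_triangles) (use e Inl_Inl_edge in blast)
  ultimately show ?thesis by metis
qed

lemma vertex_in_three_crossings: "\<exists>v\<in>V. card {z \<in> Z. v \<in> \<Union>z} \<le> 3"
proof (rule ccontr)
  assume "\<not> ?thesis"
  then have "(\<Sum>v\<in>V. 4) \<le> (\<Sum>v\<in>V. card {z \<in> Z. v \<in> \<Union>z})" by (intro sum_mono) force
  also have "\<dots> = (\<Sum>z\<in>Z. card (\<Union>z))"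
  proof -
    have "{v \<in> V. v \<in> \<Union>z} = \<Union>z" if "z \<in> Z" for z using Union_pair_subset[OF that] by blast
    then show ?thesis
      using sum_multicount_gen[OF finV finZ, of "\<lambda>v z. v \<in> \<Union>z" "\<lambda>z. card (\<Union>z)"] by simp
  qed
  also have "\<dots> = 4 * card Z" using card_Union_pair by simp
  finally show False using card_Z by simp
qed

theorem not_extendable: "\<not> extendable 3 V E"
proof -
  obtain v where v: "v \<in> V" "card {z \<in> Z. v \<in> \<Union>z} \<le> 3" using vertex_in_three_crossings by blast
  define A where "A = {z \<in> Z. v \<in> \<Union>z}"
  define X where "X = {x. {v, x} \<in> E - \<Union>Z}"
  have "\<exists>a f. z = {{v, a}, f} \<and> {v, a} \<noteq> f" if z: "z \<in> A" for z
  proof -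
    have zZ: "z \<in> Z" "v \<in> \<Union>z" using z by (auto simp: A_def)
    obtain a b c d where abcd: "z = {{a, b}, {c, d}}" "a \<noteq> b" "a \<noteq> c" "a \<noteq> d" "b \<noteq> c" "b \<noteq> d" "c \<noteq> d"
      using pairE[OF zZ(1)] by metis
    then consider "v = a" | "v = b" | "v = c" | "v = d" using zZ(2) by blast
    then show ?thesis
    proof cases
      case 1
      then show ?thesis using abcd by (intro exI[of _ b] exI[of _ "{c, d}"]) auto
    next
      case 2
      then show ?thesis using abcd by (intro exI[of _ a] exI[of _ "{c, d}"]) auto
    next
      case 3
      then show ?thesis using abcd by (intro exI[of _ d] exI[of _ "{a, b}"]) auto
    next
      case 4
      then show ?thesis using abcd by (intro exI[of _ c] exI[of _ "{a, b}"]) auto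
    qed
  qed
  \<comment> \<open>\<open>{v, opp z}\<close> is the edge of the pair at \<open>v\<close> and
    \<open>P z\<close> the edge crossing it. The ends of \<open>P z\<close> are joined by plain
    edges to both \<open>v\<close> and \<open>opp z\<close>.\<close>
  then obtain opp P where opp: "\<And>z. z \<in> A \<Longrightarrow> z = {{v, opp z}, P z} \<and> {v, opp z} \<noteq> P z" by metis
  have AZ: "z \<in> Z" if "z \<in> A" for z using that by (simp add: A_def)
  have zE: "{v, opp z} \<in> E" "P z \<in> E" if "z \<in> A" for z using opp[OF that] AZ[OF that] Z_subset by blast+
  have plain: "{v, x} \<in> E - \<Union>Z" "{opp z, x} \<in> E - \<Union>Z" if "z \<in> A" "x \<in> P z" for z x
    using star_triangles(1)[OF AZ[OF that(1)], of "{v, opp z}" "P z"] opp[OF that(1)] that by auto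
  have in_P: "x \<in> P z \<longleftrightarrow> x \<in> \<Union>z" if "z \<in> A" "x \<in> X" for x z
  proof -
    have "x \<noteq> v" using that edge[of "{v, x}"] by (auto simp: X_def)
    moreover have "{v, opp z} \<in> \<Union>Z" using opp[OF that(1)] AZ[OF that(1)] by blast
    then have "x \<noteq> opp z" using that by (auto simp: X_def)
    moreover have "\<Union>z = {v, opp z} \<union> P z" using opp[OF that(1)] by (metis Union_insert Union_empty Un_empty_right)
    ultimately show ?thesis by simp
  qed
  have finA: "finite A" using finZ by (simp add: A_def)
  have PX: "card (P z) = 2 \<and> P z \<subseteq> X" if "z \<in> A" for z
    using edge[OF zE(2)[OF that]] plain(1)[OF that] by (auto simp: X_def)
  have XP: "card {z \<in> A. x \<in> P z} = 2" if x: "x \<in> X" for x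
  proof -
    have "{z \<in> A. x \<in> P z} = {z \<in> Z. v \<in> \<Union>z \<and> x \<in> \<Union>z}"
      using in_P[OF _ x] by (auto simp: A_def)
    then show ?thesis using plain_edge_two_crossings x by (simp add: X_def)
  qed
  have "card A \<le> 3" using v by (simp add: A_def)
  then have "\<exists>m. inj_on m A \<and> (\<forall>z\<in>A. m z \<in> P z)"
    using distinct_representatives_le_3[OF finA _ PX XP] by blast
  then obtain m where m: "inj_on m A" "\<And>z. z \<in> A \<Longrightarrow> m z \<in> P z" by blast
  have mX: "m z \<in> X" if "z \<in> A" for z using plain(1)[OF that m(2)[OF that]] by (simp add: X_def)
  have oppX: "opp z \<notin> X" if "z \<in> A" for z using opp[OF that] AZ[OF that] by (auto simp: X_def)
  have v_ne: "opp z \<noteq> v" "m z \<noteq> v" if "z \<in> A" for z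
    using edge[OF zE(1)[OF that]] mX[OF that] edge[of "{v, m z}"] by (auto simp: X_def)
  have inj_opp: "y = z" if "y \<in> A" "z \<in> A" "opp y = opp z" for y z
  proof (rule ccontr)
    assume "y \<noteq> z"
    then have "y \<inter> z = {}" using pairs_disjoint AZ that by blast
    moreover have "{v, opp y} \<in> y" "{v, opp y} \<in> z" using opp[OF that(1)] opp[OF that(2)] that(3) by auto
    ultimately show False by blast
  qed
  \<comment> \<open>\<open>m z\<close> is an end of \<open>P z\<close>, so
    \<open>{opp z, m z}\<close> is an edge: far ends of crossed edges at \<open>v\<close> are
    matched with far ends of plain ones, and \<open>v\<close> stays free.\<close>
  define M where "M = (\<lambda>z. {opp z, m z}) ` A"
  have disj: "{opp y, m y} \<inter> {opp z, m z} = {}" if yz: "y \<in> A" "z \<in> A" "y \<noteq> z" for y z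
  proof -
    have "opp y \<noteq> opp z" using inj_opp[OF yz(1,2)] yz(3) by metis
    moreover have "m y \<noteq> m z" using inj_onD[OF m(1)] yz by metis
    moreover have "opp y \<noteq> m z" "m y \<noteq> opp z" using oppX mX yz(1,2) by metis+
    ultimately show ?thesis by simp
  qed
  have UM: "\<Union>M = opp ` A \<union> m ` A" by (auto simp: M_def)
  show ?thesis
  proof (rule matching_covering_neighbours_not_extendable[OF finV edge card_E])
    show "matching E M"
      unfolding matching_def
    proof
      show "M \<subseteq> E" using plain(2) m(2) by (auto simp: M_def)
      show "disjoint M"
      proof (rule disjointI)
        fix e f assume ef: "e \<in> M" "f \<in> M" "e \<noteq> f"
        then obtain y z where yz: "y \<in> A" "z \<in> A" "e = {opp y, m y}" "f = {opp z, m z}" unfolding M_def by blast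
        then have "y \<noteq> z" using ef(3) by metis
        then show "e \<inter> f = {}" unfolding yz(3,4) by (rule disj[OF yz(1,2)])
      qed
    qed
    show "finite M" using finA by (simp add: M_def)
    show "card M \<le> 3" using card_image_le[OF finA, of "\<lambda>z. {opp z, m z}"] v by (simp add: M_def A_def)
    show "v \<notin> \<Union>M" using v_ne by (auto simp: UM)
    show "w \<in> \<Union>M" if w: "{v, w} \<in> E" for w
    proof (cases "{v, w} \<in> \<Union>Z")
      case True
      then obtain z where z: "z \<in> Z" "{v, w} \<in> z" by blast
      then have zA: "z \<in> A" by (auto simp: A_def)
      have "v \<notin> P z" using plain(1)[OF zA, of v] edge[of "{v, v}"] by auto
      have "z = {{v, opp z}, P z}" using opp[OF zA] by (rule conjunct1)
      then have "{v, w} = {v, opp z} \<or> {v, w} = P z" using z(2) by (metis insertE singletonD)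
      then have "{v, w} = {v, opp z}" using \<open>v \<notin> P z\<close> by auto
      then have "w = opp z" using v_ne(1)[OF zA] by (auto simp: doubleton_eq_iff)
      then show ?thesis using zA by (simp add: UM)
    next
      case False
      then have "w \<in> X" using w by (simp add: X_def)
      \<comment> \<open>Double counting: each crossing in \<open>A\<close> has two elements of
        \<open>X\<close> and each element of \<open>X\<close> two crossings in \<open>A\<close>. The
        sizes agree, so the injective \<open>m\<close> is onto.\<close>
      have "m ` A = X"
      proof -
        have finX: "finite X"
        proof (rule finite_subset[OF _ finV])
          show "X \<subseteq> V" using edge by (auto simp: X_def)
        qed
        have "(\<Sum>z\<in>A. card {x \<in> X. x \<in> P z}) = (\<Sum>x\<in>X. card {z \<in> A. x \<in> P z})"
          by (rule sum_multicount_gen[OF finA finX]) simp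
        moreover have "(\<Sum>z\<in>A. card {x \<in> X. x \<in> P z}) = (\<Sum>z\<in>A. 2)"
        proof (rule sum.cong)
          fix z assume z: "z \<in> A"
          have "{x \<in> X. x \<in> P z} = P z" using PX[OF z] by blast
          then show "card {x \<in> X. x \<in> P z} = 2" using PX[OF z] by simp
        qed simp
        ultimately have "card A = card X" using XP by simp
        then have "card (m ` A) = card X" using m(1) by (simp add: card_image)
        then show ?thesis using mX finX by (intro card_subset_eq) auto
      qed
      then show ?thesis using \<open>w \<in> X\<close> by (auto simp: UM)
    qed
  qed (use v in auto)
qed

end

section \<open>Crossing arcs\<close>

lemma first_hit:
  fixes h :: "real \<Rightarrow> complex"
  assumes h: "arc h" and S: "closed S" and start: "pathstart h \<notin> S" and hit: "path_image h \<inter> S \<noteq> {}"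
  obtains u where "0 < u" "u \<le> 1" "h u \<in> S" "\<And>x. \<lbrakk>0 \<le> x; x < u\<rbrakk> \<Longrightarrow> h x \<notin> S"
proof -
  let ?U = "{0..1} \<inter> h -` S"
  have "continuous_on {0..1} h" using h by (simp add: arc_def path_def)
  then have "closed ?U" using continuous_closed_preimage[of "{0..1}" h S] S by simp
  then have c: "compact ?U" using bounded_subset[OF bounded_closed_interval, of ?U 0 1] by (auto simp: compact_eq_bounded_closed)
  have "?U \<noteq> {}" using hit by (auto simp: path_image_def)
  then obtain u where u: "u \<in> ?U" "\<And>x. x \<in> ?U \<Longrightarrow> u \<le> x"
    using compact_attains_inf[OF c] by blast
  have "u \<noteq> 0" using u(1) start by (auto simp: pathstart_def)
  then show ?thesis using u by (intro that[of u]) force+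
qed

text \<open>The hub \<open>B\<close> of two crossing arcs: the arcs \<open>r x\<close> join it to the ends \<open>x\<close> that the two arcs do
  not share.\<close>
definition hub :: "(real \<Rightarrow> complex) \<Rightarrow> (real \<Rightarrow> complex) \<Rightarrow> complex set \<Rightarrow> (complex \<Rightarrow> real \<Rightarrow> complex) \<Rightarrow> bool" where
  "hub g h B r \<longleftrightarrow>
    (let G = {pathstart g, pathfinish g}; H = {pathstart h, pathfinish h}; K = path_image g \<union> path_image h in
      compact B \<and> path_connected B \<and> connected (- B) \<and> B \<subseteq> K \<and> B \<inter> (G \<union> H) = G \<inter> H \<and>
      (\<forall>x\<in>(G \<union> H) - (G \<inter> H). arc (r x) \<and> pathstart (r x) = x \<and> path_image (r x) \<inter> B = {pathfinish (r x)} \<and>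
          path_image (r x) \<subseteq> K \<and> path_image (r x) \<inter> (G \<union> H) = {x}) \<and>
      (\<forall>x\<in>(G \<union> H) - (G \<inter> H). \<forall>y\<in>(G \<union> H) - (G \<inter> H). x \<noteq> y \<longrightarrow> path_image (r x) \<inter> path_image (r y) \<subseteq> B))"

lemma connected_complement_subpath:
  fixes g :: "real \<Rightarrow> complex"
  assumes "arc g" "u \<in> {0..1}" "v \<in> {0..1}"
  shows "connected (- path_image (subpath u v g))"
proof (cases "u = v")
  case True
  then have "path_image (subpath u v g) = {g u}" by (simp add: path_image_subpath)
  then show ?thesis using connected_punctured_universe[of "g u"] by simp
next
  case False
  then show ?thesis using connected_arc_complement[of "subpath u v g"] arc_subpath_arc[OF assms] by simp
qed

text \<open>The hub is the part of \<open>g\<close> from the common end to the first point at which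
  \<open>h\<close>, run from its free end, meets \<open>g\<close>. The rest of \<open>g\<close> and
  the initial part of \<open>h\<close> become the arcs \<open>r x\<close>; what \<open>h\<close>
  does afterwards is discarded.\<close>

lemma hub_common_end:
  assumes g: "arc g" and h: "arc h" and a: "pathstart g = pathfinish h"
    and ng: "pathfinish g \<notin> path_image h" and nh: "pathstart h \<notin> path_image g"
    and cr: "z \<in> path_image g" "z \<in> path_image h" "z \<noteq> pathstart g"
  shows "\<exists>B r. hub g h B r"
proof -
  have ig: "\<And>x y. \<lbrakk>x \<in> {0..1}; y \<in> {0..1}; g x = g y\<rbrakk> \<Longrightarrow> x = y" and
    ih: "\<And>x y. \<lbrakk>x \<in> {0..1}; y \<in> {0..1}; h x = h y\<rbrakk> \<Longrightarrow> x = y"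
    by (rule arcD[OF g], assumption+) (rule arcD[OF h], assumption+)
  have memg: "g i \<in> g ` {c..d} \<longleftrightarrow> i \<in> {c..d}" and memh: "h i \<in> h ` {c..d} \<longleftrightarrow> i \<in> {c..d}"
    if "i \<in> {0..1}" "0 \<le> c" "d \<le> 1" for i c d
    using inj_on_image_mem_iff[OF arc_imp_inj_on[OF g], of i "{c..d}"]
      inj_on_image_mem_iff[OF arc_imp_inj_on[OF h], of i "{c..d}"] that by simp_all
  have clg: "closed (path_image g)" using g by (rule closed_arc_image)
  obtain u where u: "0 < u" "u \<le> 1" "h u \<in> path_image g" "\<And>x. \<lbrakk>0 \<le> x; x < u\<rbrakk> \<Longrightarrow> h x \<notin> path_image g"
    using first_hit[OF h clg nh] cr by blast
  obtain w where w: "w \<in> {0..1}" "z = h w" using cr(2) by (auto simp: path_image_def)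
  have "w \<noteq> 1" using w cr(3) a by (auto simp: pathfinish_def)
  \<comment> \<open>The crossing \<open>z\<close> guarantees that the first meeting comes before the
    common end.\<close>
  moreover have "u \<le> w" using u(4)[of w] w cr(1) by force
  ultimately have u1: "u < 1" using w by auto
  obtain s where s: "s \<in> {0..1}" "h u = g s" using u(3) by (auto simp: path_image_def)
  have "s \<noteq> 0"
  proof
    assume "s = 0"
    then have "h u = h 1" using s a by (simp add: pathstart_def pathfinish_def)
    then show False using ih[of u 1] u u1 by auto
  qed
  moreover have "s \<noteq> 1"
  proof
    assume "s = 1"
    then have "pathfinish g = h u" using s by (simp add: pathfinish_def)
    then show False using ng u u1 by (auto simp: path_image_def)
  qed
  ultimately have s01: "0 < s" "s < 1" using s by auto
  define B where "B = path_image (subpath 0 s g)"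
  define rg where "rg = subpath 1 s g"
  define rh where "rh = subpath 0 u h"
  have Bim: "B = g ` {0..s}" "path_image rg = g ` {s..1}" "path_image rh = h ` {0..u}"
    using s01 u by (auto simp: B_def rg_def rh_def path_image_subpath)
  have ends: "pathstart g = g 0" "pathfinish g = g 1" "pathstart h = h 0" "pathfinish h = g 0" "h 1 = g 0"
    using a by (auto simp: pathstart_def pathfinish_def)
  have sub: "B \<subseteq> path_image g" "path_image rg \<subseteq> path_image g" "path_image rh \<subseteq> path_image h"
    unfolding Bim unfolding path_image_def using s01 u by (auto intro!: image_mono)
  have ne: "g 1 \<noteq> g 0" "h 0 \<noteq> g 0" "h 0 \<noteq> g 1" "g 1 \<notin> B" "h 0 \<notin> B" "g 0 \<in> B"
  proof -
    show "g 1 \<noteq> g 0" using ig[of 1 0] by auto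
    show "h 0 \<noteq> g 0" "h 0 \<noteq> g 1"
      using nh pathstart_in_path_image[of g] pathfinish_in_path_image[of g] ends by metis+
    show "g 1 \<notin> B" "g 0 \<in> B" unfolding Bim using s01 by (simp_all add: memg)
    show "h 0 \<notin> B" using nh sub(1) ends by auto
  qed
  have 1: "path_image rg \<inter> B = {g s}"
  proof
    show "path_image rg \<inter> B \<subseteq> {g s}"
    proof
      fix x assume "x \<in> path_image rg \<inter> B"
      then obtain i j where ij: "i \<in> {s..1}" "j \<in> {0..s}" "x = g i" "x = g j" by (auto simp: Bim)
      then have "i = j" using ig[of i j] s01 by auto
      then have "i = s" using ij by auto
      then show "x \<in> {g s}" using ij by simp
    qed
  qed (use s01 in \<open>auto simp: Bim\<close>)
  have 2: "path_image rh \<inter> path_image g = {g s}"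
  proof
    show "path_image rh \<inter> path_image g \<subseteq> {g s}"
    proof
      fix x assume x: "x \<in> path_image rh \<inter> path_image g"
      then obtain i where i: "i \<in> {0..u}" "x = h i" by (auto simp: Bim)
      have "\<not> i < u" using u(4)[of i] i x by auto
      then show "x \<in> {g s}" using i s by simp
    qed
    have "g s \<in> path_image rh" unfolding Bim s(2)[symmetric] using u(1) by (intro imageI) auto
    then show "{g s} \<subseteq> path_image rh \<inter> path_image g" using s by (auto simp: path_image_def)
  qed
  have gsB: "g s \<in> B" using s01 by (auto simp: Bim)
  have r0: "g 0 \<notin> path_image rg" "h 0 \<notin> path_image rg" "g 1 \<notin> path_image rh" "g 0 \<notin> path_image rh"
    "g 1 \<in> path_image rg" "h 0 \<in> path_image rh"
  proof -
    show "g 0 \<notin> path_image rg" "g 1 \<in> path_image rg" unfolding Bim using s01 by (simp_all add: memg)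
    show "h 0 \<notin> path_image rg" "g 1 \<notin> path_image rh" using nh ng sub ends by auto
    have "h 1 \<notin> path_image rh" unfolding Bim using u u1 by (simp_all add: memh)
    then show "g 0 \<notin> path_image rh" using ends by simp
    show "h 0 \<in> path_image rh" using u by (auto simp: Bim)
  qed
  define r where "r x = (if x = g 1 then rg else rh)" for x
  have r: "r (g 1) = rg" "r (h 0) = rh" using ne by (auto simp: r_def)
  let ?G = "{pathstart g, pathfinish g}" and ?H = "{pathstart h, pathfinish h}"
  have "hub g h B r"
    unfolding hub_def Let_def
  proof (intro conjI)
    have pB: "path (subpath 0 s g)" using g s01 by (intro path_subpath arc_imp_path) auto
    show "compact B" "path_connected B"
      unfolding B_def by (rule compact_path_image[OF pB] path_connected_path_image[OF pB])+
    show "connected (- B)" unfolding B_def using g s by (intro connected_complement_subpath) auto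
    show "B \<subseteq> path_image g \<union> path_image h" using sub by blast
    have X: "(?G \<union> ?H) - (?G \<inter> ?H)
       = {g 1, h 0}" using ne ends by auto
    have W: "?G \<union> ?H = {g 0, g 1, h 0}" using ends by auto
    show "B \<inter> (?G \<union> ?H) = ?G \<inter> ?H"
      using ne ends by auto
    have arcs: "arc rg" "arc rh" unfolding rg_def rh_def using g h s01 u by (auto intro!: arc_subpath_arc)
    have pe: "pathstart rg = g 1" "pathfinish rg = g s" "pathstart rh = h 0" "pathfinish rh = g s"
      using s(2) by (simp_all add: rg_def rh_def)
    have 3: "path_image rh \<inter> B = {g s}" using 2 sub(1) gsB by blast
    show "\<forall>x\<in>(?G \<union> ?H) - (?G \<inter> ?H).
       arc (r x) \<and> pathstart (r x) = x \<and> path_image (r x) \<inter> B = {pathfinish (r x)} \<and>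
          path_image (r x) \<subseteq> path_image g \<union> path_image h \<and> 
          path_image (r x) \<inter> (?G \<union> ?H) = {x}"
      unfolding X unfolding W
      by (simp add: r arcs pe 1 3 sub r0 le_supI1 le_supI2)
    have "path_image rg \<inter> path_image rh \<subseteq> path_image rh \<inter> path_image g" using sub(2) by auto
    then have 4: "path_image rg \<inter> path_image rh \<subseteq> B" unfolding 2 using gsB by auto
    show "\<forall>x\<in>(?G \<union> ?H) - (?G \<inter> ?H).
       \<forall>y\<in>(?G \<union> ?H) - (?G \<inter> ?H).
         x \<noteq> y \<longrightarrow> path_image (r x) \<inter> path_image (r y) \<subseteq> B"
      unfolding X using 4 by (simp add: r Int_commute)
  qed
  then show ?thesis by blast
qed

text \<open>The hub is the part of \<open>g\<close> between the first and the last point of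
  \<open>h\<close> on \<open>g\<close>, possibly a single point. The middle of \<open>h\<close> is
  discarded; its outer parts and the two remaining parts of \<open>g\<close> lead to the four
  ends.\<close>

lemma hub_no_common_end:
  assumes g: "arc g" and h: "arc h"
    and ng: "pathstart g \<notin> path_image h" "pathfinish g \<notin> path_image h"
    and nh: "pathstart h \<notin> path_image g" "pathfinish h \<notin> path_image g"
    and cr: "path_image g \<inter> path_image h \<noteq> {}"
  shows "\<exists>B r. hub g h B r"
proof -
  have ig: "\<And>x y. \<lbrakk>x \<in> {0..1}; y \<in> {0..1}; g x = g y\<rbrakk> \<Longrightarrow> x = y" and
    ih: "\<And>x y. \<lbrakk>x \<in> {0..1}; y \<in> {0..1}; h x = h y\<rbrakk> \<Longrightarrow> x = y"
    by (rule arcD[OF g], assumption+) (rule arcD[OF h], assumption+)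
  have memg: "g i \<in> g ` {c..d} \<longleftrightarrow> i \<in> {c..d}" and memh: "h i \<in> h ` {c..d} \<longleftrightarrow> i \<in> {c..d}"
    if "i \<in> {0..1}" "0 \<le> c" "d \<le> 1" for i c d
    using inj_on_image_mem_iff[OF arc_imp_inj_on[OF g], of i "{c..d}"]
      inj_on_image_mem_iff[OF arc_imp_inj_on[OF h], of i "{c..d}"] that by simp_all
  have clg: "closed (path_image g)" using g by (rule closed_arc_image)
  obtain u where u: "0 < u" "u \<le> 1" "h u \<in> path_image g" "\<And>x. \<lbrakk>0 \<le> x; x < u\<rbrakk> \<Longrightarrow> h x \<notin> path_image g"
    using first_hit[OF h clg nh(1)] cr by blast
  have "arc (reversepath h)" "pathstart (reversepath h) \<notin> path_image g" "path_image (reversepath h) \<inter> path_image g \<noteq> {}"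
    using h nh cr by (auto simp: arc_reversepath)
  then obtain v' where v': "0 < v'" "v' \<le> 1" "reversepath h v' \<in> path_image g" 
      "\<And>x. \<lbrakk>0 \<le> x; x < v'\<rbrakk> \<Longrightarrow> reversepath h x \<notin> path_image g"
    using first_hit[OF _ clg] by blast
  define v where "v = 1 - v'"
  have v: "0 \<le> v" "v < 1" "h v \<in> path_image g" using v' by (auto simp: v_def reversepath_def)
  have v4: "h x \<notin> path_image g" if "v < x" "x \<le> 1" for x
    using v'(4)[of "1 - x"] that by (auto simp: v_def reversepath_def)
  have uv: "u \<le> v" using v4[of u] u by force
  obtain s where s: "s \<in> {0..1}" "h u = g s" using u(3) by (auto simp: path_image_def)
  obtain t where t: "t \<in> {0..1}" "h v = g t" using v(3) by (auto simp: path_image_def)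
  have im_h: "h u \<in> path_image h" "h v \<in> path_image h" using u v by (auto simp: path_image_def)
  have ends: "pathstart g = g 0" "pathfinish g = g 1" "pathstart h = h 0" "pathfinish h = h 1"
    by (auto simp: pathstart_def pathfinish_def)
  have st: "s \<noteq> 0" "s \<noteq> 1" "t \<noteq> 0" "t \<noteq> 1" using s t im_h ng ends by metis+
  \<comment> \<open>The first and last meeting points along \<open>h\<close> may come in the
    opposite order along \<open>g\<close>.\<close>
  define lo hi where "lo = min s t" and "hi = max s t"
  have lh: "0 < lo" "lo \<le> hi" "hi < 1" using s t st by (auto simp: lo_def hi_def)
  define B where "B = path_image (subpath lo hi g)"
  define r0 where "r0 = subpath 0 lo g"
  define r1 where "r1 = subpath 1 hi g"
  define q0 where "q0 = subpath 0 u h"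
  define q1 where "q1 = subpath 1 v h"
  have Bim: "B = g ` {lo..hi}" "path_image r0 = g ` {0..lo}" "path_image r1 = g ` {hi..1}"
    "path_image q0 = h ` {0..u}" "path_image q1 = h ` {v..1}"
    using lh u v by (auto simp: B_def r0_def r1_def q0_def q1_def path_image_subpath)
  have hB: "h u \<in> B" "h v \<in> B" "g lo \<in> B" "g hi \<in> B"
    using s t lh unfolding Bim s(2) t(2) by (auto simp: lo_def hi_def)
  have sub: "B \<subseteq> path_image g" "path_image r0 \<subseteq> path_image g" "path_image r1 \<subseteq> path_image g"
     "path_image q0 \<subseteq> path_image h" "path_image q1 \<subseteq> path_image h"
    unfolding Bim unfolding path_image_def using lh u v by (auto intro!: image_mono)
  have Bnot: "g 0 \<notin> B" "g 1 \<notin> B" "h 0 \<notin> B" "h 1 \<notin> B"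
  proof -
    show "g 0 \<notin> B" "g 1 \<notin> B" unfolding Bim using lh by (simp_all add: memg)
    show "h 0 \<notin> B" "h 1 \<notin> B" using nh sub(1) ends by auto
  qed
  have ne: "g 0 \<noteq> g 1" "h 0 \<noteq> h 1" "g 0 \<noteq> h 0" "g 0 \<noteq> h 1" "g 1 \<noteq> h 0" "g 1 \<noteq> h 1"
  proof -
    show "g 0 \<noteq> g 1" "h 0 \<noteq> h 1" using ig[of 0 1] ih[of 0 1] by auto
    show "g 0 \<noteq> h 0" "g 0 \<noteq> h 1" "g 1 \<noteq> h 0" "g 1 \<noteq> h 1"
      using nh pathstart_in_path_image[of g] pathfinish_in_path_image[of g] ends by metis+
  qed
  have 1: "path_image r0 \<inter> B = {g lo}"
  proof
    show "path_image r0 \<inter> B \<subseteq> {g lo}"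
    proof
      fix x assume "x \<in> path_image r0 \<inter> B"
      then obtain i j where ij: "i \<in> {0..lo}" "j \<in> {lo..hi}" "x = g i" "x = g j" unfolding Bim by blast
      then have "i = j" using ig[of i j] lh by auto
      then show "x \<in> {g lo}" using ij by auto
    qed
  qed (use lh in \<open>auto simp: Bim\<close>)
  have 2: "path_image r1 \<inter> B = {g hi}"
  proof
    show "path_image r1 \<inter> B \<subseteq> {g hi}"
    proof
      fix x assume "x \<in> path_image r1 \<inter> B"
      then obtain i j where ij: "i \<in> {hi..1}" "j \<in> {lo..hi}" "x = g i" "x = g j" unfolding Bim by blast
      then have "i = j" using ig[of i j] lh by auto
      then show "x \<in> {g hi}" using ij by auto
    qed
  qed (use lh in \<open>auto simp: Bim\<close>)
  have 3: "path_image q0 \<inter> path_image g \<subseteq> {h u}"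
  proof
    fix x assume x: "x \<in> path_image q0 \<inter> path_image g"
    then obtain i where i: "i \<in> {0..u}" "x = h i" unfolding Bim by blast
    have "\<not> i < u" using u(4)[of i] i x by auto
    then show "x \<in> {h u}" using i by simp
  qed
  have 4: "path_image q1 \<inter> path_image g \<subseteq> {h v}"
  proof
    fix x assume x: "x \<in> path_image q1 \<inter> path_image g"
    then obtain i where i: "i \<in> {v..1}" "x = h i" unfolding Bim by blast
    have "\<not> v < i" using v4[of i] i x by auto
    then show "x \<in> {h v}" using i by simp
  qed
  have mem: "h u \<in> path_image q0" "h v \<in> path_image q1" unfolding Bim using u v by auto
  have 5: "path_image q0 \<inter> B = {h u}" "path_image q1 \<inter> B = {h v}"
    using 3 4 mem hB sub(1) by blast+
  have 6: "path_image r0 \<inter> path_image r1 \<subseteq> B"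
  proof
    fix x assume "x \<in> path_image r0 \<inter> path_image r1"
    then obtain i j where ij: "i \<in> {0..lo}" "j \<in> {hi..1}" "x = g i" "x = g j" unfolding Bim by blast
    then have "i = j" using ig[of i j] lh by auto
    then have "i = lo" using ij(1,2) lh by auto
    then have "x = g lo" using ij(3) by simp
    then show "x \<in> B" using hB by simp
  qed
  have 7: "path_image q0 \<inter> path_image q1 \<subseteq> B"
  proof
    fix x assume "x \<in> path_image q0 \<inter> path_image q1"
    then obtain i j where ij: "i \<in> {0..u}" "j \<in> {v..1}" "x = h i" "x = h j" unfolding Bim by blast
    then have "i = j" using ih[of i j] u v by auto
    then have "i = u" using ij(1,2) uv by auto
    then have "x = h u" using ij(3) by simp
    then show "x \<in> B" using hB by simp
  qed
  have 8: "path_image q \<inter> path_image r \<subseteq> B"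
    if "path_image q \<inter> path_image g \<subseteq> {x}" "path_image r \<subseteq> path_image g" "x \<in> B" for q r :: "real \<Rightarrow> complex" and x
    using that by auto
  note 8 = 8[OF 3 sub(2) hB(1)] 8[OF 3 sub(3) hB(1)] 8[OF 4 sub(2) hB(2)] 8[OF 4 sub(3) hB(2)]
  have arcs: "arc r0" "arc r1" "arc q0" "arc q1"
    unfolding r0_def r1_def q0_def q1_def using g h lh u v by (auto intro!: arc_subpath_arc)
  have pe: "pathstart r0 = g 0" "pathfinish r0 = g lo" "pathstart r1 = g 1" "pathfinish r1 = g hi" 
     "pathstart q0 = h 0" "pathfinish q0 = h u" "pathstart q1 = h 1" "pathfinish q1 = h v"
    by (simp_all add: r0_def r1_def q0_def q1_def)
  have self: "g 0 \<in> path_image r0" "g 1 \<in> path_image r1" "h 0 \<in> path_image q0" "h 1 \<in> path_image q1"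
    using pathstart_in_path_image[of r0] pathstart_in_path_image[of r1] pathstart_in_path_image[of q0]
      pathstart_in_path_image[of q1] pe by simp_all
  have g01: "g 1 \<notin> path_image r0" "g 0 \<notin> path_image r1"
    unfolding Bim using lh by (simp_all add: memg)
  have h01: "h 1 \<notin> path_image q0" "h 0 \<notin> path_image q1"
    unfolding Bim using u v uv by (simp_all add: memh)
  have gh: "g 0 \<notin> path_image q0" "g 1 \<notin> path_image q0" "g 0 \<notin> path_image q1" "g 1 \<notin> path_image q1"
    "h 0 \<notin> path_image r0" "h 0 \<notin> path_image r1" "h 1 \<notin> path_image r0" "h 1 \<notin> path_image r1"
    using ng nh sub ends by auto
  define r where "r x = (if x = g 0 then r0 else if x = g 1 then r1 else if x = h 0 then q0 else q1)" for x
  have r: "r (g 0) = r0" "r (g 1) = r1" "r (h 0) = q0" "r (h 1) = q1" using ne by (auto simp: r_def)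
  let ?G = "{pathstart g, pathfinish g}" and ?H = "{pathstart h, pathfinish h}"
  have "hub g h B r"
    unfolding hub_def Let_def
  proof (intro conjI)
    have pB: "path (subpath lo hi g)" using g lh by (intro path_subpath arc_imp_path) auto
    show "compact B" "path_connected B"
      unfolding B_def by (rule compact_path_image[OF pB] path_connected_path_image[OF pB])+
    show "connected (- B)" unfolding B_def using g lh by (intro connected_complement_subpath) auto
    show "B \<subseteq> path_image g \<union> path_image h" using sub by blast
    have X: "(?G \<union> ?H) - (?G \<inter> ?H)
       = {g 0, g 1, h 0, h 1}" unfolding ends using ne by auto
    have W: "?G \<union> ?H = {g 0, g 1, h 0, h 1}" unfolding ends by auto
    show "B \<inter> (?G \<union> ?H) = ?G \<inter> ?H"
      unfolding ends using ne Bnot by auto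
    show "\<forall>x\<in>(?G \<union> ?H) - (?G \<inter> ?H).
       arc (r x) \<and> pathstart (r x) = x \<and> path_image (r x) \<inter> B = {pathfinish (r x)} \<and>
          path_image (r x) \<subseteq> path_image g \<union> path_image h \<and> 
          path_image (r x) \<inter> (?G \<union> ?H) = {x}"
      unfolding X unfolding W by (simp add: r arcs pe 1 2 5 sub le_supI1 le_supI2 self g01 h01 gh)
    show "\<forall>x\<in>(?G \<union> ?H) - (?G \<inter> ?H).
       \<forall>y\<in>(?G \<union> ?H) - (?G \<inter> ?H).
         x \<noteq> y \<longrightarrow> path_image (r x) \<inter> path_image (r y) \<subseteq> B"
      unfolding X using 6 7 8 by (simp add: r Int_commute)
  qed
  then show ?thesis by blast
qed

section \<open>Planarization of a 1-planar drawing\<close>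

lemma fat_plane_graph_subset:
  assumes "fat_plane_graph N E S \<rho>" "E' \<subseteq> E"
  shows "fat_plane_graph N E' S \<rho>"
proof -
  interpret fat_plane_graph N E S \<rho> by fact
  show ?thesis
    by unfold_locales (use assms(2) finN edge node disj arc edge_ends edge_node edge_edge in \<open>meson subsetD\<close>)+
qed

text \<open>Janiszewski's theorem, set by set: each new set meets the union of the earlier ones in
  \<open>a\<close> alone. It applies to all the hubs that are added to one vertex.\<close>

lemma bouquet:
  fixes B :: "'i \<Rightarrow> complex set"
  assumes "finite I" and B: "\<And>i. i \<in> I \<Longrightarrow> compact (B i) \<and> path_connected (B i) \<and> connected (- B i) \<and> a \<in> B i"
    and int: "\<And>i j. \<lbrakk>i \<in> I; j \<in> I; i \<noteq> j\<rbrakk> \<Longrightarrow> B i \<inter> B j \<subseteq> {a}"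
  shows "compact ({a} \<union> (\<Union>i\<in>I. B i)) \<and> path_connected ({a} \<union> (\<Union>i\<in>I. B i)) \<and> connected (- ({a} \<union> (\<Union>i\<in>I. B i)))"
  using assms
proof (induction I)
  case empty
  then show ?case using connected_punctured_universe[of a] by simp
next
  case (insert i I)
  let ?U = "{a} \<union> (\<Union>i\<in>I. B i)"
  have IH: "compact ?U" "path_connected ?U" "connected (- ?U)"
    using insert.IH[OF insert.prems] by auto
  have Bi: "compact (B i)" "path_connected (B i)" "connected (- B i)" "a \<in> B i" using insert.prems(1)[of i] by auto
  have "B j \<inter> B i \<subseteq> {a}" if "j \<in> I" for j
    using insert.prems(2)[of j i] that insert.hyps(2) by auto
  then have int: "?U \<inter> B i = {a}" using Bi(4) by auto
  have eq: "{a} \<union> (\<Union>i\<in>insert i I. B i) = ?U \<union> B i" by auto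
  have "connected (- (?U \<union> B i))"
    using Janiszewski_connected[of ?U "B i"] IH Bi unfolding int by (simp add: compact_imp_closed)
  moreover have "path_connected (?U \<union> B i)"
    using path_connected_Un[of ?U "B i"] IH Bi unfolding int by simp
  ultimately show ?case unfolding eq using compact_Un[OF IH(1) Bi(1)] by (intro conjI)
qed

lemma orient_arc:
  assumes "arc g" "{pathstart g, pathfinish g} = {x, y}" "x \<noteq> y"
  obtains g' where "arc g'" "path_image g' = path_image g" "pathstart g' = x" "pathfinish g' = y"
proof (cases "pathstart g = x")
  case True
  then have "pathfinish g = y" using assms by (auto simp: doubleton_eq_iff)
  then show ?thesis using True assms that by blast
next
  case False
  then have "pathstart g = y" "pathfinish g = x" using assms by (auto simp: doubleton_eq_iff)
  then show ?thesis using that[of "reversepath g"] assms by (simp add: arc_reversepath)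
qed

locale one_planar_drawing =
  fixes V :: "'a set" and E :: "'a set set" and p :: "'a \<Rightarrow> complex" and \<gamma> :: "'a set \<Rightarrow> real \<Rightarrow> complex"
  assumes simple: "simple_graph V E" and drawing: "drawing V E p \<gamma>"
    and one: "\<And>e. e \<in> E \<Longrightarrow> card {f \<in> E. edges_cross V p \<gamma> e f} \<le> 1"
begin

abbreviation "cross \<equiv> edges_cross V p \<gamma>"

lemma finV: "finite V" and edge: "\<And>e. e \<in> E \<Longrightarrow> e \<subseteq> V \<and> card e = 2"
  using simple by (auto simp: simple_graph_def)

lemma inj_p: "inj_on p V"
  using drawing by (simp add: drawing_def)

lemma edge_arc: "e \<in> E \<Longrightarrow> arc (\<gamma> e)"
  and edge_ends: "e \<in> E \<Longrightarrow> {pathstart (\<gamma> e), pathfinish (\<gamma> e)} = p ` e"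
  and edge_vertices: "e \<in> E \<Longrightarrow> path_image (\<gamma> e) \<inter> p ` V = p ` e"
  using drawing by (auto simp: drawing_def)

lemma finE: "finite E"
  using finV edge by (meson Pow_iff finite_Pow_iff finite_subset subsetI)

lemma cross_sym: "cross e f \<longleftrightarrow> cross f e"
  by (auto simp: edges_cross_def Int_commute)

lemma not_cross: "\<lbrakk>e \<noteq> f; \<not> cross e f\<rbrakk> \<Longrightarrow> path_image (\<gamma> e) \<inter> path_image (\<gamma> f) \<subseteq> p ` V"
  by (auto simp: edges_cross_def)

lemma partner_unique:
  assumes "e \<in> E" "f \<in> E" "g \<in> E" "cross e f" "cross e g"
  shows "f = g"
  using one[OF assms(1)] assms finE card_le_Suc0_iff_eq[of "{f \<in> E. cross e f}"] by simp

section \<open>Crossing pairs and their hubs\<close>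

definition pairs :: "'a set set set" where
  "pairs = {c. \<exists>e\<in>E. \<exists>f\<in>E. cross e f \<and> c = {e, f}}"

lemma pairs_cases:
  assumes "c \<in> pairs"
  obtains e f where "e \<in> E" "f \<in> E" "cross e f" "c = {e, f}" "e \<noteq> f"
  using assms by (auto simp: pairs_def edges_cross_def)

lemma finite_pairs: "finite pairs"
proof (rule finite_subset)
  show "pairs \<subseteq> Pow E" by (auto simp: pairs_def)
qed (use finE in simp)

text \<open>With at most one partner per edge, \<open>cross\<close> is a matching on the set of
  edges, whose members are the pairs.\<close>

lemma pairs_disjoint:
  assumes c: "c \<in> pairs" "c' \<in> pairs" "c \<noteq> c'" and e: "e \<in> c" "e' \<in> c'"
  shows "e \<noteq> e' \<and> \<not> cross e e'"
proof -
  have other: "\<exists>f\<in>E. cross e f \<and> c = {e, f} \<and> e \<in> E" if "c \<in> pairs" "e \<in> c" for c e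
    using that by (auto elim!: pairs_cases simp: cross_sym insert_commute)
  obtain f where f: "f \<in> E" "cross e f" "c = {e, f}" "e \<in> E" using other[OF c(1) e(1)] by blast
  obtain f' where f': "f' \<in> E" "cross e' f'" "c' = {e', f'}" "e' \<in> E" using other[OF c(2) e(2)] by blast
  have "e \<noteq> e'" using partner_unique[of e f f'] f f' c(3) by metis
  moreover have "\<not> cross e e'"
  proof
    assume x: "cross e e'"
    have "f = e'" using partner_unique[OF f(4,1) f'(4) f(2) x] .
    moreover have "f' = e" using partner_unique[OF f'(4,1) f(4) f'(2)] x cross_sym by blast
    ultimately show False using f f' c(3) by (simp add: insert_commute)
  qed
  ultimately show ?thesis ..
qed

definition cell :: "'a set set \<Rightarrow> complex set" where
  "cell c = (\<Union>e\<in>c. path_image (\<gamma> e))"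

lemma cell_inter_cell:
  assumes "c \<in> pairs" "c' \<in> pairs" "c \<noteq> c'"
  shows "cell c \<inter> cell c' \<subseteq> p ` V"
  using pairs_disjoint[OF assms] not_cross unfolding cell_def by blast

lemma cell_inter_edge:
  assumes c: "c \<in> pairs" and e: "e \<in> E" "e \<notin> \<Union>pairs"
  shows "cell c \<inter> path_image (\<gamma> e) \<subseteq> p ` V"
proof -
  have "path_image (\<gamma> f) \<inter> path_image (\<gamma> e) \<subseteq> p ` V" if f: "f \<in> c" for f
  proof (rule not_cross)
    show "f \<noteq> e" using c e f by blast
    have "f \<in> E" using c f by (auto simp: pairs_def)
    show "\<not> cross f e"
    proof
      assume "cross f e"
      then have "{f, e} \<in> pairs" using \<open>f \<in> E\<close> e by (auto simp: pairs_def)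
      then show False using e by blast
    qed
  qed
  then show ?thesis unfolding cell_def by blast
qed

lemma edge_inter_edge:
  assumes e: "e \<in> E" "e \<notin> \<Union>pairs" and f: "f \<in> E" "f \<noteq> e"
  shows "path_image (\<gamma> e) \<inter> path_image (\<gamma> f) \<subseteq> p ` V"
proof (rule not_cross)
  show "\<not> cross e f"
  proof
    assume "cross e f"
    then have "{e, f} \<in> pairs" using e f by (auto simp: pairs_def)
    then show False using e by blast
  qed
qed (use f in simp)

definition hub_at :: "'a set set \<Rightarrow> complex set \<Rightarrow> ('a \<Rightarrow> real \<Rightarrow> complex) \<Rightarrow> bool" where
  "hub_at c B r \<longleftrightarrow>
     compact B \<and> path_connected B \<and> connected (- B) \<and> B \<subseteq> cell c \<and> B \<inter> p ` V = p ` \<Inter>c \<and>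
     (\<forall>v\<in>\<Union>c - \<Inter>c. arc (r v) \<and> pathstart (r v) = p v \<and> path_image (r v) \<inter> B = {pathfinish (r v)} \<and>
        path_image (r v) \<subseteq> cell c \<and> path_image (r v) \<inter> p ` V = {p v}) \<and>
     (\<forall>v\<in>\<Union>c - \<Inter>c. \<forall>w\<in>\<Union>c - \<Inter>c. v \<noteq> w \<longrightarrow> path_image (r v) \<inter> path_image (r w) \<subseteq> B)"

lemma hub_imp_hub_at:
  assumes ef: "e \<in> E" "f \<in> E" and hub: "hub g h B r"
    and g: "path_image g = path_image (\<gamma> e)" "{pathstart g, pathfinish g} = p ` e"
    and h: "path_image h = path_image (\<gamma> f)" "{pathstart h, pathfinish h} = p ` f"
  shows "hub_at {e, f} B (\<lambda>v. r (p v))"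
proof -
  have sub: "e \<subseteq> V" "f \<subseteq> V" using ef edge by auto
  have cell: "cell {e, f} = path_image g \<union> path_image h" by (simp add: cell_def g h)
  have int: "p ` e \<inter> p ` f = p ` (e \<inter> f)" using inj_on_image_Int[OF inj_p sub] by simp
  have un: "p ` e \<union> p ` f = p ` (e \<union> f)" by auto
  have free: "p ` (e \<union> f) - p ` (e \<inter> f) = p ` ((e \<union> f) - (e \<inter> f))"
    using inj_on_image_set_diff[OF inj_p, of "e \<union> f" "e \<inter> f"] sub by auto
  have cv: "cell {e, f} \<inter> p ` V = p ` (e \<union> f)"
    using edge_vertices[OF ef(1)] edge_vertices[OF ef(2)] by (auto simp: cell_def)
  note H = hub[unfolded hub_def Let_def g(2) h(2) int un free, folded cell]
  have eqV: "A \<inter> p ` V = A \<inter> p ` (e \<union> f)" if "A \<subseteq> cell {e, f}" for A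
    using cv that by blast
  have B: "compact B" "path_connected B" "connected (- B)" "B \<subseteq> cell {e, f}" "B \<inter> p ` (e \<union> f) = p ` (e \<inter> f)"
    using H by auto
  have R: "arc (r (p v))" "pathstart (r (p v)) = p v" "path_image (r (p v)) \<inter> B = {pathfinish (r (p v))}"
    "path_image (r (p v)) \<subseteq> cell {e, f}" "path_image (r (p v)) \<inter> p ` (e \<union> f) = {p v}"
    if "v \<in> e \<union> f - e \<inter> f" for v
    using H that by blast+
  have RR: "path_image (r (p v)) \<inter> path_image (r (p w)) \<subseteq> B"
    if vw: "v \<in> e \<union> f - e \<inter> f" "w \<in> e \<union> f - e \<inter> f" "v \<noteq> w" for v w
  proof -
    have "v \<in> V" "w \<in> V" using vw sub by auto
    then have "p v \<noteq> p w" using inj_p vw(3) by (auto simp: inj_on_def)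
    then show ?thesis using H vw(1,2) by blast
  qed
  have c: "\<Union>{e, f} = e \<union> f" "\<Inter>{e, f} = e \<inter> f" by auto
  show ?thesis
    unfolding hub_at_def c
    using B R RR eqV[OF B(4)] eqV[OF R(4)] by simp
qed

lemma hub_exists:
  assumes c: "c \<in> pairs"
  shows "\<exists>B r. hub_at c B r"
proof -
  obtain e f where ef: "e \<in> E" "f \<in> E" "cross e f" "c = {e, f}" "e \<noteq> f" using c by (rule pairs_cases)
  obtain z where z: "z \<in> path_image (\<gamma> e)" "z \<in> path_image (\<gamma> f)" "z \<notin> p ` V"
    using ef(3) by (auto simp: edges_cross_def)
  have sub: "e \<subseteq> V" "f \<subseteq> V" "card e = 2" "card f = 2" using ef edge by auto
  have pv: "p v \<in> path_image (\<gamma> e) \<longleftrightarrow> v \<in> e" "p v \<in> path_image (\<gamma> f) \<longleftrightarrow> v \<in> f" if v: "v \<in> V" for v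
  proof -
    have "p v \<in> p ` e \<longleftrightarrow> v \<in> e" "p v \<in> p ` f \<longleftrightarrow> v \<in> f" 
      using inj_on_image_mem_iff[OF inj_p v] sub by auto
    moreover have "p v \<in> p ` V" using v by simp
    ultimately show "p v \<in> path_image (\<gamma> e) \<longleftrightarrow> v \<in> e" "p v \<in> path_image (\<gamma> f) \<longleftrightarrow> v \<in> f"
      using edge_vertices[OF ef(1)] edge_vertices[OF ef(2)] by blast+
  qed
  show ?thesis
  proof (cases "e \<inter> f = {}")
    case True
    have e: "pathstart (\<gamma> e) \<in> p ` e" "pathfinish (\<gamma> e) \<in> p ` e" using edge_ends[OF ef(1)] by auto
    have f: "pathstart (\<gamma> f) \<in> p ` f" "pathfinish (\<gamma> f) \<in> p ` f" using edge_ends[OF ef(2)] by auto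
    have ne: "x \<notin> path_image (\<gamma> f)" if "x \<in> p ` e" for x using that pv(2) sub True by auto
    have nf: "x \<notin> path_image (\<gamma> e)" if "x \<in> p ` f" for x using that pv(1) sub True by auto
    have "path_image (\<gamma> e) \<inter> path_image (\<gamma> f) \<noteq> {}" using z by blast
    then obtain B r where "hub (\<gamma> e) (\<gamma> f) B r"
      using hub_no_common_end[OF edge_arc[OF ef(1)] edge_arc[OF ef(2)] ne[OF e(1)] ne[OF e(2)] nf[OF f(1)] nf[OF f(2)]]
      by blast
    then show ?thesis
      using hub_imp_hub_at[OF ef(1,2) _ refl edge_ends[OF ef(1)] refl edge_ends[OF ef(2)]] ef(4) by blast
  next
    case False
    then obtain a where a: "a \<in> e" "a \<in> f" by blast
    obtain b where b: "e = {a, b}" "a \<noteq> b" using sub(3) a(1) by (auto simp: card_2_iff)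
    obtain d where d: "f = {a, d}" "a \<noteq> d" using sub(4) a(2) by (auto simp: card_2_iff)
    have abd: "a \<in> V" "b \<in> V" "d \<in> V" "b \<notin> f" "d \<notin> e" using sub b d ef(5) by auto
    have pne: "p a \<noteq> p b" "p d \<noteq> p a" using inj_onD[OF inj_p] abd b d by metis+
    have ends: "{pathstart (\<gamma> e), pathfinish (\<gamma> e)} = {p a, p b}" "{pathstart (\<gamma> f), pathfinish (\<gamma> f)} = {p d, p a}"
      using edge_ends[OF ef(1)] edge_ends[OF ef(2)] b d by auto
    \<comment> \<open>One arc has to leave the common end \<open>a\<close> and the other has to run
      into it, as \<open>hub_common_end\<close> expects.\<close>
    obtain g where g: "arc g" "path_image g = path_image (\<gamma> e)" "pathstart g = p a" "pathfinish g = p b"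
      using orient_arc[OF edge_arc[OF ef(1)] ends(1) pne(1)] .
    obtain h where h: "arc h" "path_image h = path_image (\<gamma> f)" "pathstart h = p d" "pathfinish h = p a"
      using orient_arc[OF edge_arc[OF ef(2)] ends(2) pne(2)] .
    have "z \<noteq> p a" using z(3) abd(1) by blast
    then have "\<exists>B r. hub g h B r"
      using hub_common_end[OF g(1) h(1), of z] g h pv abd z(1,2) by simp
    then obtain B r where "hub g h B r" by blast
    then have "hub_at {e, f} B (\<lambda>v. r (p v))"
      by (rule hub_imp_hub_at[OF ef(1,2)]) (use g h b d in auto)
    then show ?thesis using ef(4) by blast
  qed
qed

text \<open>The hub is fixed before the spokes, which are then chosen to fit this very hub.\<close>

definition hub_set :: "'a set set \<Rightarrow> complex set" where
  "hub_set c = (SOME B. \<exists>r. hub_at c B r)"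

definition spoke :: "'a set set \<Rightarrow> 'a \<Rightarrow> real \<Rightarrow> complex" where
  "spoke c = (SOME r. hub_at c (hub_set c) r)"

lemma hub_at_spoke:
  assumes "c \<in> pairs"
  shows "hub_at c (hub_set c) (spoke c)"
proof -
  have "\<exists>r. hub_at c (hub_set c) r"
    unfolding hub_set_def by (rule someI_ex) (rule hub_exists[OF assms])
  then show ?thesis unfolding spoke_def by (rule someI_ex)
qed

lemma hub_set:
  assumes "c \<in> pairs"
  shows "compact (hub_set c)" "path_connected (hub_set c)" "connected (- hub_set c)" "hub_set c \<subseteq> cell c"
    "hub_set c \<inter> p ` V = p ` \<Inter>c"
  using hub_at_spoke[OF assms] by (auto simp: hub_at_def)

lemma spoke:
  assumes "c \<in> pairs" "v \<in> \<Union>c - \<Inter>c"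
  shows "arc (spoke c v)" "pathstart (spoke c v) = p v" "path_image (spoke c v) \<inter> hub_set c = {pathfinish (spoke c v)}"
    "path_image (spoke c v) \<subseteq> cell c" "path_image (spoke c v) \<inter> p ` V = {p v}"
  using hub_at_spoke[OF assms(1)] assms(2) unfolding hub_at_def by blast+

lemma spoke_inter_spoke:
  assumes "c \<in> pairs" "v \<in> \<Union>c - \<Inter>c" "w \<in> \<Union>c - \<Inter>c" "v \<noteq> w"
  shows "path_image (spoke c v) \<inter> path_image (spoke c w) \<subseteq> hub_set c"
  using hub_at_spoke[OF assms(1)] assms(2-) unfolding hub_at_def by blast

definition Z :: "'a set set set" where
  "Z = {c \<in> pairs. \<Inter>c = {}}"

text \<open>Crossing edges with a common end get no node of their own: their hub is added to that end.\<close>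
definition host :: "'a set set \<Rightarrow> 'a + 'a set set" where
  "host c = (if \<Inter>c = {} then Inr c else Inl (the_elem (\<Inter>c)))"

text \<open>Distinct edges share at most one vertex, which makes \<open>the_elem\<close> in
  \<open>host\<close> meaningful.\<close>

lemma common_end:
  assumes "c \<in> pairs" "v \<in> \<Inter>c"
  shows "\<Inter>c = {v}" "host c = Inl v"
proof -
  obtain e f where ef: "e \<in> E" "f \<in> E" "c = {e, f}" "e \<noteq> f" using assms(1) by (rule pairs_cases)
  have v: "v \<in> e" "v \<in> f" using ef assms by auto
  obtain b where b: "e = {v, b}" using edge[OF ef(1)] v(1) by (auto simp: card_2_iff)
  obtain d where d: "f = {v, d}" using edge[OF ef(2)] v(2) by (auto simp: card_2_iff)
  show "\<Inter>c = {v}" using ef b d by auto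
  then show "host c = Inl v" by (simp add: host_def)
qed

lemma host_Inl:
  assumes "c \<in> pairs" "host c = Inl v"
  shows "\<Inter>c = {v}"
proof -
  have "\<Inter>c \<noteq> {}" using assms(2) by (auto simp: host_def)
  then obtain w where "w \<in> \<Inter>c" by blast
  then show ?thesis using common_end[OF assms(1)] assms(2) by fastforce
qed

lemma host_Inr: "host c = Inr z \<Longrightarrow> c = z \<and> \<Inter>c = {}"
  by (auto simp: host_def split: if_splits)

section \<open>Nodes and arcs of the planarization\<close>

sublocale crossing_pairs V E Z
proof
  show "\<exists>e f. z = {e, f} \<and> e \<in> E \<and> f \<in> E \<and> e \<inter> f = {}" if "z \<in> Z" for z
    using that by (auto simp: Z_def pairs_def)
  show "z \<inter> z' = {}" if "z \<in> Z" "z' \<in> Z" "z \<noteq> z'" for z z'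
    using pairs_disjoint[of z z'] that by (auto simp: Z_def)
qed (use finV edge in auto)

text \<open>A vertex is its point with a bouquet of hubs attached. Only \<open>z\<close> itself has
  host \<open>Inr z\<close>, so the node of a crossing is just its hub.\<close>

definition node_set :: "'a + 'a set set \<Rightarrow> complex set" where
  "node_set n = (case n of Inl v \<Rightarrow> {p v} | Inr _ \<Rightarrow> {}) \<union> (\<Union>c\<in>{c \<in> pairs. host c = n}. hub_set c)"

lemma hub_subset_node: "c \<in> pairs \<Longrightarrow> hub_set c \<subseteq> node_set (host c)"
  by (auto simp: node_set_def)

lemma vertex_in_node: "p v \<in> node_set (Inl v)"
  by (simp add: node_set_def)

lemma node_set_cases:
  assumes "x \<in> node_set n"
  obtains v where "n = Inl v" "x = p v" | c where "c \<in> pairs" "host c = n" "x \<in> hub_set c"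
  using assms by (auto simp: node_set_def split: sum.splits)

text \<open>The arcs that may draw an edge of the planarization: an uncrossed edge itself, or a
  spoke. The spokes serve the star edges and also the plain edges that cross an adjacent
  edge.\<close>

definition representative :: "('a + 'a set set) set \<Rightarrow> (real \<Rightarrow> complex) \<Rightarrow> bool" where
  "representative x g \<longleftrightarrow> (\<exists>e\<in>E. e \<notin> \<Union>pairs \<and> x = Inl ` e \<and> g = \<gamma> e) \<or>
     (\<exists>c\<in>pairs. \<exists>v\<in>\<Union>c - \<Inter>c. x = {Inl v, host c} \<and> g = spoke c v)"

lemma representative_exists:
  assumes "x \<in> plain_edges \<union> star_edges"
  shows "\<exists>g. representative x g"
proof -
  consider e where "e \<in> E" "e \<notin> \<Union>Z" "x = Inl ` e" | v z where "z \<in> Z" "v \<in> \<Union>z" "x = {Inl v, Inr z}"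
    using assms
  proof
    assume "x \<in> plain_edges"
    then show thesis using that(1) by (auto simp: plain_edges_def)
  next
    assume "x \<in> star_edges"
    then show thesis using that(2) by (rule star_edge_cases)
  qed
  then show ?thesis
  proof cases
    case 1
    show ?thesis
    proof (cases "e \<in> \<Union>pairs")
      \<comment> \<open>\<open>e\<close> crosses an edge with which it shares the end
        \<open>a\<close>. The spoke from its other end \<open>b\<close> to the hub replaces it,
        because this hub belongs to the node of \<open>a\<close>.\<close>
      case True
      then obtain c where c: "c \<in> pairs" "e \<in> c" by blast
      then have "\<Inter>c \<noteq> {}" using 1 by (auto simp: Z_def)
      then obtain a where a: "a \<in> \<Inter>c" by blast
      have "a \<in> e" using a c by blast
      then obtain b where b: "e = {a, b}" "a \<noteq> b" using edge[OF 1(1)] by (auto simp: card_2_iff)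
      have "b \<in> \<Union>c - \<Inter>c" using b c common_end(1)[OF c(1) a] by auto
      moreover have "x = {Inl b, host c}" using 1(3) b common_end(2)[OF c(1) a] by auto
      ultimately show ?thesis using c(1) unfolding representative_def by blast
    next
      case False
      then show ?thesis using 1 unfolding representative_def by blast
    qed
  next
    case 2
    then have "z \<in> pairs" "\<Inter>z = {}" "host z = Inr z" by (auto simp: Z_def host_def)
    then show ?thesis
      unfolding representative_def
      by (intro exI[of _ "spoke z v"] disjI2 bexI[of _ z] bexI[of _ v]) (use 2 in simp_all)
  qed
qed

lemma representative_arc:
  assumes "representative x g"
  shows "arc g"
  using assms edge_arc spoke(1) unfolding representative_def by metis

lemma representative_ends:
  assumes "representative x g"
  shows "\<exists>m n. x = {m, n} \<and> pathstart g \<in> node_set m \<and> pathfinish g \<in> node_set n"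
  using assms unfolding representative_def
proof (elim disjE bexE conjE)
  fix e assume e: "e \<in> E" "x = Inl ` e" "g = \<gamma> e"
  obtain a b where ab: "e = {a, b}" using edge[OF e(1)] by (auto simp: card_2_iff)
  have "{pathstart g, pathfinish g} = {p a, p b}" using edge_ends[OF e(1)] e ab by simp
  then have "pathstart g = p a \<and> pathfinish g = p b \<or> pathstart g = p b \<and> pathfinish g = p a"
    by (simp add: doubleton_eq_iff)
  moreover have "x = {Inl a, Inl b}" "x = {Inl b, Inl a}" using e(2) ab by auto
  ultimately show ?thesis using vertex_in_node by metis
next
  fix c v assume c: "c \<in> pairs" "v \<in> \<Union>c - \<Inter>c" "x = {Inl v, host c}" "g = spoke c v"
  have "pathfinish g \<in> hub_set c" using spoke(3)[OF c(1,2)] c(4) by blast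
  then have "pathfinish g \<in> node_set (host c)" using hub_subset_node[OF c(1)] by blast
  moreover have "pathstart g \<in> node_set (Inl v)" using spoke(2)[OF c(1,2)] c(4) vertex_in_node by simp
  ultimately show ?thesis using c(3) by blast
qed

lemma representative_vertices:
  assumes "representative x g"
  shows "path_image g \<inter> p ` V \<subseteq> {pathstart g, pathfinish g}"
  using assms unfolding representative_def
proof (elim disjE bexE conjE)
  fix e assume e: "e \<in> E" "g = \<gamma> e"
  then show ?thesis using edge_vertices[OF e(1)] edge_ends[OF e(1)] by simp
next
  fix c v assume c: "c \<in> pairs" "v \<in> \<Union>c - \<Inter>c" "g = spoke c v"
  then show ?thesis using spoke(2,5)[OF c(1,2)] by simp
qed

text \<open>An uncrossed edge or a spoke of another pair meets the cell of \<open>c\<close> in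
  vertices only, and a spoke of \<open>c\<close> meets the hub just in its final point.\<close>

lemma representative_hub:
  assumes g: "representative x g" and c: "c \<in> pairs"
  shows "path_image g \<inter> hub_set c \<subseteq> {pathstart g, pathfinish g}"
proof -
  have V: ?thesis if "path_image g \<inter> cell c \<subseteq> p ` V"
    using that representative_vertices[OF g] hub_set(4)[OF c] by blast
  show ?thesis
    using g unfolding representative_def
  proof (elim disjE bexE conjE)
    fix e assume e: "e \<in> E" "e \<notin> \<Union>pairs" "g = \<gamma> e"
    then show ?thesis using cell_inter_edge[OF c e(1,2)] by (intro V) (simp add: Int_commute)
  next
    fix c' v assume c': "c' \<in> pairs" "v \<in> \<Union>c' - \<Inter>c'" "g = spoke c' v"
    show ?thesis
    proof (cases "c' = c")
      case True
      then show ?thesis using spoke(3)[OF c'(1,2)] c'(3) by simp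
    next
      case False
      have "path_image g \<inter> cell c \<subseteq> p ` V"
        using cell_inter_cell[OF c'(1) c False] spoke(4)[OF c'(1,2)] c'(3) by blast
      then show ?thesis by (rule V)
    qed
  qed
qed

text \<open>Only spokes of the same pair can meet away from the vertices, and distinct ones do so
  inside their hub.\<close>

lemma representative_inter:
  assumes x: "representative x g" and y: "representative y h" and ne: "x \<noteq> y"
  shows "path_image g \<inter> path_image h \<subseteq> p ` V \<union> (\<Union>c\<in>pairs. hub_set c)"
proof -
  have *: "path_image g \<inter> path_image h \<subseteq> p ` V"
    if e: "e \<in> E" "e \<notin> \<Union>pairs" "x = Inl ` e" "g = \<gamma> e" and y: "representative y h" "x \<noteq> y" for e g h x y
    using y(1) unfolding representative_def
  proof (elim disjE bexE conjE)
    fix f assume f: "f \<in> E" "y = Inl ` f" "h = \<gamma> f"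
    then have "f \<noteq> e" using e y(2) by blast
    then show ?thesis using edge_inter_edge[OF e(1,2) f(1)] e f by simp
  next
    fix c v assume c: "c \<in> pairs" "v \<in> \<Union>c - \<Inter>c" "h = spoke c v"
    show ?thesis using cell_inter_edge[OF c(1) e(1,2)] spoke(4)[OF c(1,2)] c(3) e(4) by blast
  qed
  show ?thesis
  proof (cases "(\<exists>e\<in>E. e \<notin> \<Union>pairs \<and> x = Inl ` e \<and> g = \<gamma> e) \<or> (\<exists>e\<in>E. e \<notin> \<Union>pairs \<and> y = Inl ` e \<and> h = \<gamma> e)")
    case True
    then have "path_image g \<inter> path_image h \<subseteq> p ` V"
      using *[OF _ _ _ _ y ne] *[OF _ _ _ _ x ne[symmetric]] by (metis Int_commute)
    then show ?thesis by blast
  next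
    case False
    obtain c v where c: "c \<in> pairs" "v \<in> \<Union>c - \<Inter>c" "x = {Inl v, host c}" "g = spoke c v"
      using x False unfolding representative_def by metis
    obtain d w where d: "d \<in> pairs" "w \<in> \<Union>d - \<Inter>d" "y = {Inl w, host d}" "h = spoke d w"
      using y False unfolding representative_def by metis
    show ?thesis
    proof (cases "c = d")
      case True
      then have "v \<noteq> w" using c(3) d(3) ne by metis
      then have "path_image g \<inter> path_image h \<subseteq> hub_set c"
        using spoke_inter_spoke[OF c(1,2)] c d True by metis
      then show ?thesis using c(1) by blast
    next
      case False
      have "path_image g \<inter> path_image h \<subseteq> cell c \<inter> cell d"
        using spoke(4)[OF c(1,2)] spoke(4)[OF d(1,2)] c(4) d(4) by blast
      then show ?thesis using cell_inter_cell[OF c(1) d(1) False] by blast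
    qed
  qed
qed

text \<open>Hubs at the same vertex lie in different cells, which meet in vertices only, and each
  hub contains no vertex except \<open>p v\<close>. So they form a bouquet at
  \<open>p v\<close>.\<close>

lemma node_set_topology:
  assumes "n \<in> nodes"
  shows "compact (node_set n) \<and> path_connected (node_set n) \<and> connected (- node_set n)"
proof (cases n)
  case (Inl v)
  let ?I = "{c \<in> pairs. host c = n}"
  have v: "v \<in> V" using assms Inl by (auto simp: nodes_def)
  have eq: "node_set n = {p v} \<union> (\<Union>c\<in>?I. hub_set c)" by (simp add: node_set_def Inl)
  have int: "\<Inter>c = {v}" if "c \<in> ?I" for c using host_Inl[of c v] that Inl by simp
  have V: "hub_set c \<inter> p ` V = {p v}" if "c \<in> ?I" for c using hub_set(5)[of c] int[OF that] that by simp
  show ?thesis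
    unfolding eq
  proof (rule bouquet)
    show "finite ?I" using finite_pairs by simp
    show "compact (hub_set c) \<and> path_connected (hub_set c) \<and> connected (- hub_set c) \<and> p v \<in> hub_set c"
      if "c \<in> ?I" for c
      using hub_set(1-3)[of c] V[OF that] that by blast
    show "hub_set c \<inter> hub_set d \<subseteq> {p v}" if cd: "c \<in> ?I" "d \<in> ?I" "c \<noteq> d" for c d
    proof -
      have "hub_set c \<inter> hub_set d \<subseteq> cell c \<inter> cell d" using hub_set(4)[of c] hub_set(4)[of d] cd by auto
      also have "\<dots> \<subseteq> p ` V" using cell_inter_cell[of c d] cd by simp
      finally show ?thesis using V[OF cd(1)] by blast
    qed
  qed
next
  case (Inr z)
  then have "z \<in> Z" using assms by (auto simp: nodes_def)
  then have "z \<in> pairs" "host z = Inr z" by (auto simp: Z_def host_def)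
  then have "{c \<in> pairs. host c = n} = {z}" using host_Inr Inr by auto
  then have "node_set n = hub_set z" by (simp add: node_set_def Inr)
  then show ?thesis using hub_set[OF \<open>z \<in> pairs\<close>] by simp
qed

lemma node_set_disjoint:
  assumes mn: "m \<in> nodes" "n \<in> nodes" "m \<noteq> n"
  shows "node_set m \<inter> node_set n = {}"
proof -
  \<comment> \<open>The only vertex that a hub can contain is the common end of its pair, which is
    the host.\<close>
  have vh: False if vc: "Inl v \<in> nodes" "c \<in> pairs" "p v \<in> hub_set c" "host c \<noteq> Inl v" for v c
  proof -
    have v: "v \<in> V" using vc(1) by (auto simp: nodes_def)
    then have "p v \<in> p ` \<Inter>c" using hub_set(5)[OF vc(2)] vc(3) by blast
    then obtain w where w: "w \<in> \<Inter>c" "p v = p w" by blast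
    obtain e where "e \<in> c" "e \<in> E" using vc(2) by (auto simp: pairs_def)
    then have "w \<in> V" using w(1) edge by blast
    then have "v = w" using inj_onD[OF inj_p w(2) v] by simp
    then show False using common_end(2)[OF vc(2) w(1)] vc(4) by simp
  qed
  have False if x: "x \<in> node_set m" "x \<in> node_set n" for x
    using x(1)
  proof (cases rule: node_set_cases)
    case m: (1 v)
    show False
      using x(2)
    proof (cases rule: node_set_cases)
      case (1 w)
      have "v \<in> V" "w \<in> V" using mn m 1 by (auto simp: nodes_def)
      then have "v = w" using inj_onD[OF inj_p, of v w] m 1 by simp
      then show False using m 1 mn(3) by simp
    next
      case (2 c)
      then show False using vh[of v c] m mn by simp
    qed
  next
    case m: (2 c)
    show False
      using x(2)
    proof (cases rule: node_set_cases)
      case (1 v)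
      then show False using vh[of v c] m mn by simp
    next
      case (2 d)
      then have "c \<noteq> d" using m mn(3) by blast
      \<comment> \<open>Different cells meet in vertices only, so \<open>x\<close> is a vertex in
        both hubs and hosts them both.\<close>
      then have "x \<in> p ` V" using cell_inter_cell[OF m(1) 2(1)] hub_set(4)[OF m(1)] hub_set(4)[OF 2(1)] m(3) 2(3) by blast
      then obtain v where v: "v \<in> V" "x = p v" by blast
      then have "Inl v \<in> nodes" by (simp add: nodes_def)
      then have "host c = Inl v" "host d = Inl v" using vh[of v c] vh[of v d] m 2 v by auto
      then show False using m 2 mn(3) by simp
    qed
  qed
  then show ?thesis by blast
qed

lemma fat_planarization:
  "\<exists>\<rho>. fat_plane_graph nodes (plain_edges \<union> star_edges) node_set \<rho>"
proof -
  obtain \<rho> where \<rho>: "\<And>x. x \<in> plain_edges \<union> star_edges \<Longrightarrow> representative x (\<rho> x)"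
    using representative_exists by metis
  have hub_nodes: "hub_set c \<subseteq> \<Union>(node_set ` nodes)" if c: "c \<in> pairs" for c
  proof -
    have "host c \<in> nodes"
    proof (cases "\<Inter>c = {}")
      case True
      then have "c \<in> Z" using c by (simp add: Z_def)
      then show ?thesis using True by (simp add: nodes_def host_def)
    next
      case False
      then obtain v where v: "v \<in> \<Inter>c" by blast
      obtain e where "e \<in> c" "e \<in> E" using c by (auto simp: pairs_def)
      then have "v \<in> V" using v edge by blast
      then show ?thesis using common_end(2)[OF c v] by (simp add: nodes_def)
    qed
    then show ?thesis using hub_subset_node[OF c] by blast
  qed
  have vertex_nodes: "p ` V \<subseteq> \<Union>(node_set ` nodes)" using vertex_in_node by (force simp: nodes_def)
  have "fat_plane_graph nodes (plain_edges \<union> star_edges) node_set \<rho>"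
  proof
    show "finite nodes" using finV finZ by (simp add: nodes_def)
    show "e \<subseteq> nodes \<and> card e = 2" if "e \<in> plain_edges \<union> star_edges" for e
      using that
    proof
      assume "e \<in> plain_edges"
      then obtain f where f: "f \<in> E" "e = Inl ` f" by (auto simp: plain_edges_def)
      have "card e = card f" unfolding f(2) by (rule card_image) simp
      then show ?thesis using edge[OF f(1)] f(2) by (auto simp: nodes_def)
    next
      assume "e \<in> star_edges"
      then show ?thesis
        by (rule star_edge_cases) (use Union_pair_subset in \<open>auto simp: nodes_def\<close>)
    qed
    show "compact (node_set n) \<and> path_connected (node_set n) \<and> connected (- node_set n)" if "n \<in> nodes" for n
      by (rule node_set_topology[OF that])
    show "node_set m \<inter> node_set n = {}" if "m \<in> nodes" "n \<in> nodes" "m \<noteq> n" for m n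
      by (rule node_set_disjoint[OF that])
    show "arc (\<rho> e)" if "e \<in> plain_edges \<union> star_edges" for e
      by (rule representative_arc[OF \<rho>[OF that]])
    show "\<exists>u v. e = {u, v} \<and> pathstart (\<rho> e) \<in> node_set u \<and> pathfinish (\<rho> e) \<in> node_set v"
      if "e \<in> plain_edges \<union> star_edges" for e
      by (rule representative_ends[OF \<rho>[OF that]])
    show "path_image (\<rho> e) \<inter> node_set n \<subseteq> {pathstart (\<rho> e), pathfinish (\<rho> e)}"
      if e: "e \<in> plain_edges \<union> star_edges" and n: "n \<in> nodes" for e n
    proof
      fix x assume x: "x \<in> path_image (\<rho> e) \<inter> node_set n"
      then have "x \<in> node_set n" by simp
      then show "x \<in> {pathstart (\<rho> e), pathfinish (\<rho> e)}"
      proof (cases rule: node_set_cases)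
        case (1 v)
        then have "x \<in> p ` V" using n by (auto simp: nodes_def)
        then show ?thesis using representative_vertices[OF \<rho>[OF e]] x by blast
      next
        case (2 c)
        then show ?thesis using representative_hub[OF \<rho>[OF e] 2(1)] x by blast
      qed
    qed
    show "path_image (\<rho> e) \<inter> path_image (\<rho> f) \<subseteq> \<Union>(node_set ` nodes)"
      if "e \<in> plain_edges \<union> star_edges" "f \<in> plain_edges \<union> star_edges" "e \<noteq> f" for e f
    proof -
      have "path_image (\<rho> e) \<inter> path_image (\<rho> f) \<subseteq> p ` V \<union> (\<Union>c\<in>pairs. hub_set c)"
        by (rule representative_inter[OF \<rho>[OF that(1)] \<rho>[OF that(2)] that(3)])
      also have "\<dots> \<subseteq> \<Union>(node_set ` nodes)"
        using vertex_nodes hub_nodes by (intro Un_least UN_least)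
      finally show ?thesis .
    qed
  qed
  then show ?thesis by blast
qed

theorem optimal_not_extendable:
  assumes cE: "int (card E) = 4 * int (card V) - 8"
  shows "\<not> extendable 3 V E"
proof
  assume ext: "extendable 3 V E"
  \<comment> \<open>The size required by \<open>extendable 3\<close> makes both edge sets large
    enough for the bounds.\<close>
  then have n8: "8 \<le> card V" by (simp add: extendable_def)
  have cE': "card E + 8 = 4 * card V" using cE by linarith
  obtain \<rho> where fat: "fat_plane_graph nodes (plain_edges \<union> star_edges) node_set \<rho>"
    using fat_planarization by blast
  interpret P: fat_plane_graph nodes "plain_edges \<union> star_edges" node_set \<rho> by (rule fat)
  \<comment> \<open>The same drawing restricted to the bipartite part, for the second bound.\<close>
  interpret Q: fat_plane_graph nodes star_edges node_set \<rho> by (rule fat_plane_graph_subset[OF fat]) simp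
  have big: "4 \<le> card (plain_edges \<union> star_edges)" using card_all_edges cE' n8 by linarith
  then have le: "card E + 2 * card Z + 6 \<le> 3 * (card V + card Z)"
    using P.card_edges_le card_nodes card_all_edges by simp
  have crossings_ge: "n \<le> z + 2" if "m + 2 * z + 6 \<le> 3 * (n + z)" "m + 8 = 4 * n" for m n z :: nat
    using that by presburger
  have zge: "card V \<le> card Z + 2" by (rule crossings_ge[OF le cE'])
  have "6 \<le> card Z" using zge n8 by linarith
  then have "4 \<le> card star_edges" unfolding card_star_edges by linarith
  then have "card star_edges + 4 \<le> 2 * card nodes"
    using Q.card_edges_le_triangle_free star_edges_triangle_free by blast
  then have "4 * card Z + 4 \<le> 2 * (card V + card Z)" using card_star_edges card_nodes by simp
  then have "card Z + 2 \<le> card V" by simp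
  with zge have cZ': "card Z + 2 = card V" by simp
  then have cZ: "int (card Z) = int (card V) - 2" by linarith
  then have tight: "card (plain_edges \<union> star_edges) + 6 = 3 * card nodes"
    unfolding card_all_edges card_nodes using cE' cZ' by presburger
  obtain T where T: "finite T" "3 * card T = 2 * card (plain_edges \<union> star_edges)"
    "\<And>t. t \<in> T \<Longrightarrow> card t = 3"
    "\<And>t x y. \<lbrakk>t \<in> T; x \<in> t; y \<in> t; x \<noteq> y\<rbrakk> \<Longrightarrow> {x, y} \<in> plain_edges \<union> star_edges"
    "\<And>e. e \<in> plain_edges \<union> star_edges \<Longrightarrow> card {t \<in> T. e \<subseteq> t} = 2"
    using P.triangulation[OF big tight] by blast
  interpret triangulated_crossing_pairs V E Z T
    by unfold_locales (fact T cE cZ)+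
  show False using not_extendable ext by simp
qed

end

theorem theorem1p9:
  fixes V :: "'a set" and E :: "'a set set"
  assumes "simple_graph V E" and "optimal_one_planar V E"
  shows "\<not> extendable 3 V E"
proof -
  obtain p \<gamma> where "drawing V E p \<gamma>" "\<forall>e\<in>E. card {f \<in> E. edges_cross V p \<gamma> e f} \<le> 1"
    using assms(2) by (auto simp: optimal_one_planar_def one_planar_def)
  then interpret one_planar_drawing V E p \<gamma>
    by unfold_locales (use assms(1) in auto)
  show ?thesis
    by (rule optimal_not_extendable) (use assms(2) in \<open>simp add: optimal_one_planar_def\<close>)
qed

end
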